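(* Let $N\in\mathbb{N}\setminus\{0,1\}$ and $p\in(1,\infty)$. There exists a constant $C$ depending only on $N$ and $p$ such that, if $u\colon\mathbb{R}^N_+\to\mathbb{R}$ and $v\colon\partial\mathbb{R}^N_+\to\mathbb{R}$ are measurable and satisfy $$\liminf_{s\to1^-}\,(1-s)\int_{\partial\mathbb{R}^N_+}\Bigl(\int_{\mathbb{R}^N_+}\frac{|v(x)-u(y)|^p}{|x-y|^{N+sp}}\,\mathrm{d}y\Bigr)\mathrm{d}x<\infty,$$ then $v\in\dot W^{1,p}(\partial\mathbb{R}^N_+)$ and $$\int_{\partial\mathbb{R}^N_+}|\mathrm{D}v|^p\le C\liminf_{s\to1^-}\,(1-s)\int_{\partial\mathbb{R}^N_+}\Bigl(\int_{\mathbb{R}^N_+}\frac{|v(x)-u(y)|^p}{|x-y|^{N+sp}}\,\mathrm{d}y\Bigr)\mathrm{d}x .$$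
   Context: $\mathbb{R}^N_+ = \mathbb{R}^{N-1}\times(0,\infty)$. Its boundary $\partial\mathbb{R}^N_+ = \mathbb{R}^{N-1}\times\{0\}$ is identified with $\mathbb{R}^{N-1}$ and carries the $(N-1)$-dimensional Lebesgue measure; $|x-y|$ is the Euclidean distance in $\mathbb{R}^N$. The homogeneous Sobolev space $\dot W^{1,p}(\partial\mathbb{R}^N_+)$ is the set of weakly differentiable functions $v\colon\mathbb{R}^{N-1}\to\mathbb{R}$ with $\int_{\mathbb{R}^{N-1}}|\mathrm{D}v|^p<\infty$ (no integrability of $v$ itself is required). *)

theory Defs
  imports "HOL-Analysis.Analysis"
begin

definition half_space :: "((real^'n) \<times> real) set" where
  "half_space = UNIV \<times> {0<..}"

(* A point x of the boundary is identified with (x, 0).  "lebesgue" is the completed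
   Lebesgue measure: of dimension N - 1 in the outer integral, of dimension N in the inner
   one.  The metric on the product type is the Euclidean one.  N is meant to be
   CARD('n) + 1. *)
definition trace_energy ::
    "nat \<Rightarrow> real \<Rightarrow> real \<Rightarrow> ((real^'n) \<times> real \<Rightarrow> real) \<Rightarrow> ((real^'n) \<Rightarrow> real) \<Rightarrow> ennreal" where
  "trace_energy N p s u v =
     (\<integral>\<^sup>+x. (\<integral>\<^sup>+y\<in>half_space.
        ennreal (\<bar>v x - u y\<bar> powr p / dist (x, 0) y powr (real N + s * p)) \<partial>lebesgue) \<partial>lebesgue)"

definition partial_deriv :: "'n \<Rightarrow> ((real^'n) \<Rightarrow> real) \<Rightarrow> (real^'n) \<Rightarrow> real" where
  "partial_deriv i f x = frechet_derivative f (at x) (axis i 1)"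

fun C_k :: "nat \<Rightarrow> ((real^'n) \<Rightarrow> real) \<Rightarrow> bool" where
  "C_k 0 f \<longleftrightarrow> continuous_on UNIV f"
| "C_k (Suc k) f \<longleftrightarrow> (\<forall>x. f differentiable (at x)) \<and> (\<forall>i. C_k k (partial_deriv i f))"

definition test_function :: "((real^'n) \<Rightarrow> real) \<Rightarrow> bool" where
  "test_function \<phi> \<longleftrightarrow> (\<forall>k. C_k k \<phi>) \<and> compact (closure {x. \<phi> x \<noteq> 0})"

definition locally_integrable :: "((real^'n) \<Rightarrow> 'b::euclidean_space) \<Rightarrow> bool" where
  "locally_integrable f \<longleftrightarrow> (\<forall>K. compact K \<longrightarrow> f absolutely_integrable_on K)"

definition has_weak_gradient :: "((real^'n) \<Rightarrow> real) \<Rightarrow> ((real^'n) \<Rightarrow> real^'n) \<Rightarrow> bool" where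
  "has_weak_gradient v g \<longleftrightarrow>
     locally_integrable v \<and> locally_integrable g \<and>
     (\<forall>\<phi> i. test_function \<phi> \<longrightarrow>
        (LINT x|lebesgue. v x * partial_deriv i \<phi> x) = - (LINT x|lebesgue. g x $ i * \<phi> x))"

definition weakly_differentiable :: "((real^'n) \<Rightarrow> real) \<Rightarrow> bool" where
  "weakly_differentiable v \<longleftrightarrow> (\<exists>g. has_weak_gradient v g)"

(* A weak gradient is unique up to null sets, so the choice does not affect integrals. *)
definition weak_gradient :: "((real^'n) \<Rightarrow> real) \<Rightarrow> (real^'n) \<Rightarrow> real^'n" where
  "weak_gradient v = (SOME g. has_weak_gradient v g)"

definition dirichlet_energy :: "real \<Rightarrow> ((real^'n) \<Rightarrow> real) \<Rightarrow> ennreal" where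
  "dirichlet_energy p v = (\<integral>\<^sup>+x. ennreal (norm (weak_gradient v x) powr p) \<partial>lebesgue)"

definition hom_sobolev :: "real \<Rightarrow> ((real^'n) \<Rightarrow> real) set" where
  "hom_sobolev p = {v. weakly_differentiable v \<and> dirichlet_energy p v < \<infinity>}"

end

theory Submission
  imports Defs
begin

text \<open>Write \<open>E s\<close> for the trace energy and \<open>L\<close> for the lower limit of \<open>(1 - s) E s\<close>.  The proof
  eliminates \<open>u\<close> by the triangle inequality, obtains bounds on translations of \<open>v\<close> at every
  single scale, and reads off a gradient from mean difference quotients.

  \<^bold>\<open>From the trace energy to translations.\<close>  Let \<open>G z = \<integral>|v (x + z) - v x|^p dx\<close>, and
  let \<open>T t\<close> be the integral of \<open>G (t h)\<close> over \<open>h\<close> in the ball of radius 1/3 around a unit vector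
  \<open>e\<close>.  Comparing \<open>v (x + t h)\<close> and \<open>v x\<close> with the same value \<open>u y\<close>, for \<open>y\<close> at height about
  \<open>2 t\<close> above \<open>x\<close>, and averaging over \<open>y\<close> bounds \<open>T t\<close> by the part of the energy in which
  \<open>|x - y|\<close> lies between \<open>t\<close> and \<open>4 t\<close> (\<open>mean_increment_le_annulus_energy\<close>).  For
  \<open>t = r / 4^k\<close> these parts are disjoint.  On the other hand \<open>G (2 z) \<le> 2^p G z\<close>, so that
  \<open>T t / t^p\<close> can only grow when \<open>t\<close> is halved: every scale \<open>r / 4^k\<close> contributes at least a
  multiple of \<open>T r / r^p\<close>, damped by \<open>4^(- k p (1 - s))\<close>.  The sum of the geometric series is of order
  \<open>1 / (1 - s)\<close> and cancels the factor \<open>1 - s\<close> in front of the energy.  Hence \<open>T r \<le> D r^p L\<close>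
  for all \<open>r > 0\<close> (\<open>mean_increment_le_liminf\<close>).

  \<^bold>\<open>From translations to a gradient.\<close>  The bound for large \<open>r\<close> shows that \<open>v\<close> is locally
  integrable.  The mean difference quotients \<open>(v (x + r h) - v x) / r\<close>, averaged over \<open>h\<close> in the ball
  around a coordinate vector \<open>e\<close>, are bounded in Lp by a multiple of \<open>L\<close>, by Jensen's inequality, and
  tested against a smooth function they converge to the distributional derivative in direction
  \<open>e\<close>, because the mean of \<open>h\<close> over the ball is \<open>e\<close> (\<open>mean_quotient_test_tendsto\<close>).  Bounded
  sequences in Lp with \<open>1 < p\<close> are weakly compact (\<open>weak_Lp_compactness\<close>), and a weak limit
  is a weak partial derivative with the same bound.

  \<^bold>\<open>Weak compactness.\<close>  It is derived for nonnegative functions from Tychonoff's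
  theorem: the functionals \<open>\<phi> \<mapsto> \<integral>f\<^sub>k \<phi>\<close> have a cluster point in a product of compact
  intervals.  The cluster point is countably additive on indicator functions because a bound
  in Lp gives uniform integrability, so it has a Radon-Nikodym density.  Jensen's inequality and
  the lower semicontinuity of the Lp norm both come from the fact that
  \<open>a^p\<close> lies above its tangents (\<open>powr_ge_tangent\<close>).

  \<^bold>\<open>Uniqueness.\<close>  The Dirichlet energy refers to a chosen weak gradient.  Smooth bumps
  that approximate indicators of boxes show that two weak gradients agree almost everywhere
  (\<open>weak_gradient_AE_unique\<close>), so a bound for one of them is a bound for the Dirichlet energy.\<close>

section \<open>Smooth functions and test functions\<close>

lemma partial_deriv_eq:
  assumes "(f has_derivative f') (at x)"
  shows "partial_deriv i f x = f' (axis i 1)"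
  using frechet_derivative_at[OF assms] by (simp add: partial_deriv_def)

lemma C_k_has_derivative:
  "C_k (Suc k) f \<Longrightarrow> (f has_derivative frechet_derivative f (at x)) (at x)"
  by (simp add: frechet_derivative_works)

lemma C_k_imp_continuous: "C_k k f \<Longrightarrow> continuous_on UNIV f"
  by (cases k) (auto simp: continuous_on_eq_continuous_at differentiable_imp_continuous_within)

lemma C_k_antimono: "C_k (Suc k) f \<Longrightarrow> C_k k f"
proof (induction k arbitrary: f)
  case 0
  then show ?case using C_k_imp_continuous by (metis C_k.simps(1))
next
  case (Suc k)
  then show ?case by (metis C_k.simps(2))
qed

lemma C_k_const: "C_k k (\<lambda>x. c)"
proof (induction k arbitrary: c)
  case (Suc k)
  have "partial_deriv i (\<lambda>x::real^'a. c) = (\<lambda>x. 0)" for i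
    by (intro ext, subst partial_deriv_eq[of _ "\<lambda>x. 0"]) auto
  with Suc show ?case by simp
qed simp

lemma C_k_add:
  assumes "C_k k f" "C_k k g"
  shows "C_k k (\<lambda>x. f x + g x)"
  using assms
proof (induction k arbitrary: f g)
  case 0
  then show ?case by (auto intro: continuous_intros)
next
  case (Suc k)
  have "partial_deriv i (\<lambda>x. f x + g x) = (\<lambda>x. partial_deriv i f x + partial_deriv i g x)" for i
    by (rule ext, subst partial_deriv_eq[OF has_derivative_add[OF
        C_k_has_derivative[OF Suc.prems(1)] C_k_has_derivative[OF Suc.prems(2)]]])
      (simp add: partial_deriv_def)
  with Suc show ?case by (auto intro: differentiable_add)
qed

lemma C_k_mult:
  assumes "C_k k f" "C_k k g"
  shows "C_k k (\<lambda>x. f x * g x)"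
  using assms
proof (induction k arbitrary: f g)
  case 0
  then show ?case by (auto intro: continuous_intros)
next
  case (Suc k)
  have eq: "partial_deriv i (\<lambda>x. f x * g x)
      = (\<lambda>x. f x * partial_deriv i g x + partial_deriv i f x * g x)" for i
    by (rule ext, subst partial_deriv_eq[OF has_derivative_mult[OF
        C_k_has_derivative[OF Suc.prems(1)] C_k_has_derivative[OF Suc.prems(2)]]])
      (simp add: partial_deriv_def)
  have "C_k k f" "C_k k g"
    using Suc.prems C_k_antimono by auto
  then have "C_k k (\<lambda>x. f x * partial_deriv i g x + partial_deriv i f x * g x)" for i
    using Suc by (intro C_k_add) auto
  with Suc.prems show ?case by (auto simp: eq intro: differentiable_mult)
qed

lemma C_k_prod:
  assumes "\<And>i. i \<in> I \<Longrightarrow> C_k k (f i)"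
  shows "C_k k (\<lambda>x. \<Prod>i\<in>I. f i x)"
  using assms
  by (induction I rule: infinite_finite_induct) (auto intro: C_k_const C_k_mult)

text \<open>One-variable smoothness, phrased so that the derivative can be named instead of
  computed; \<open>C_k_component\<close> turns it into smoothness of \<open>x \<mapsto> f (x\<^sub>i)\<close>, and products of such
  functions give enough test functions.\<close>

fun C_k_real :: "nat \<Rightarrow> (real \<Rightarrow> real) \<Rightarrow> bool" where
  "C_k_real 0 f \<longleftrightarrow> continuous_on UNIV f"
| "C_k_real (Suc k) f \<longleftrightarrow> (\<exists>f'. (\<forall>t. (f has_real_derivative f' t) (at t)) \<and> C_k_real k f')"

lemma C_k_real_cmult: "C_k_real k f \<Longrightarrow> C_k_real k (\<lambda>t. c * f t)"
proof (induction k arbitrary: f)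
  case 0
  then show ?case by (auto intro: continuous_intros)
next
  case (Suc k)
  then obtain f' where "\<And>t. (f has_real_derivative f' t) (at t)" "C_k_real k f'" by auto
  then show ?case using Suc.IH[of f']
    by (auto intro!: exI[of _ "\<lambda>t. c * f' t"] DERIV_cmult)
qed

lemma C_k_real_affine: "C_k_real k f \<Longrightarrow> C_k_real k (\<lambda>t. f (a * t + b))"
proof (induction k arbitrary: f)
  case 0
  then show ?case
    by (auto intro!: continuous_on_compose2[of UNIV f] continuous_intros)
next
  case (Suc k)
  then obtain f' where f': "\<And>t. (f has_real_derivative f' t) (at t)" "C_k_real k f'" by auto
  have "((\<lambda>t. f (a * t + b)) has_real_derivative f' (a * t + b) * a) (at t)" for t
    by (rule DERIV_chain2[OF f'(1)]) (auto intro!: derivative_eq_intros)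
  then show ?case using Suc.IH[OF f'(2)]
    by (auto intro!: exI[of _ "\<lambda>t. a * f' (a * t + b)"] C_k_real_cmult simp: mult.commute)
qed

lemma C_k_component:
  assumes "C_k_real k f"
  shows "C_k k (\<lambda>x::real^'n. f (x $ i))"
  using assms
proof (induction k arbitrary: f)
  case 0
  then show ?case
    by (auto intro!: continuous_on_compose2[of UNIV f] continuous_intros)
next
  case (Suc k)
  then obtain f' where f': "\<And>t. (f has_real_derivative f' t) (at t)" "C_k_real k f'" by auto
  have d: "((\<lambda>x::real^'n. f (x $ i)) has_derivative (\<lambda>h. f' (x $ i) * h $ i)) (at x)" for x
    using has_derivative_compose[of "\<lambda>x::real^'n. x $ i" "\<lambda>h. h $ i" x UNIV f "(*) (f' (x $ i))"]
      f'(1)[of "x $ i"]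
    by (simp add: bounded_linear_imp_has_derivative bounded_linear_vec_nth has_field_derivative_def)
  have "partial_deriv j (\<lambda>x::real^'n. f (x $ i)) = (\<lambda>x. (if i = j then 1 else 0) * f' (x $ i))" for j
    by (rule ext, subst partial_deriv_eq[OF d]) (auto simp: axis_def)
  moreover have "C_k k (\<lambda>x::real^'n. (if i = j then 1 else 0) * f' (x $ i))" for j
    by (rule C_k_mult[OF C_k_const Suc.IH[OF f'(2)]])
  ultimately show ?case
    using d by (auto simp only: C_k.simps differentiable_def)
qed

text \<open>The classical function \<open>exp (- 1/t)\<close> that is smooth and flat at the origin.  The polynomial
  factor in \<open>1/t\<close> makes the family closed under differentiation, so that smoothness is a
  one-line induction.\<close>

definition flat :: "real poly \<Rightarrow> real \<Rightarrow> real" where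
  "flat p t = (if 0 < t then poly p (1 / t) * exp (- (1 / t)) else 0)"

lemma poly_times_exp_neg_tendsto_0: "((\<lambda>y::real. poly p y * exp (- y)) \<longlongrightarrow> 0) at_top"
proof -
  have "((\<lambda>y. \<Sum>i\<le>degree p. coeff p i * (y ^ i / exp y)) \<longlongrightarrow> (\<Sum>i\<le>degree p. coeff p i * 0)) at_top"
    by (intro tendsto_sum tendsto_mult tendsto_const tendsto_power_div_exp_0)
  then show ?thesis
    by (simp add: poly_altdef exp_minus sum_distrib_right divide_inverse mult.assoc)
qed

lemma flat_has_derivative:
  "(flat p has_real_derivative flat ([:0, 0, 1:] * (p - pderiv p)) t) (at t)"
proof -
  consider "t < 0" | "t > 0" | "t = 0" by linarith
  then show ?thesis
  proof cases
    case 1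
    have ev: "eventually (\<lambda>s::real. s < 0) (nhds t)"
      using eventually_nhds_in_open[of "{..<0}" t] 1 by simp
    have "(flat p has_real_derivative 0) (at t)"
      by (rule DERIV_cong_ev[THEN iffD1, OF refl _ refl, of "\<lambda>_. 0"])
        (use ev in \<open>auto simp: flat_def elim!: eventually_mono\<close>)
    then show ?thesis using 1 by (simp add: flat_def)
  next
    case 2
    have ev: "eventually (\<lambda>s::real. s > 0) (nhds t)"
      using eventually_nhds_in_open[of "{0<..}" t] 2 by simp
    have "((\<lambda>s. poly p (1 / s) * exp (- (1 / s))) has_real_derivative
        flat ([:0, 0, 1:] * (p - pderiv p)) t) (at t)"
      using 2 by (auto intro!: derivative_eq_intros DERIV_chain2[OF poly_DERIV]
          simp: flat_def field_simps power2_eq_square)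
    then show ?thesis
      by (rule DERIV_cong_ev[THEN iffD1, OF refl _ refl, rotated])
        (use ev in \<open>auto simp: flat_def elim!: eventually_mono\<close>)
  next
    case 3
    have "((\<lambda>y::real. poly ([:0, 1:] * p) y * exp (- y)) \<longlongrightarrow> 0) at_top"
      by (rule poly_times_exp_neg_tendsto_0)
    then have "((\<lambda>h::real. poly ([:0, 1:] * p) (inverse h) * exp (- inverse h)) \<longlongrightarrow> 0) (at_right 0)"
      by (rule filterlim_compose[OF _ filterlim_inverse_at_top_right])
    then have r: "((\<lambda>h. flat p h / h) \<longlongrightarrow> 0) (at_right 0)"
      by (rule Lim_transform_eventually)
        (auto simp: flat_def field_simps eventually_at_filter)
    have l: "((\<lambda>h. flat p h / h) \<longlongrightarrow> 0) (at_left 0)"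
      by (rule Lim_transform_eventually[OF tendsto_const])
        (auto simp: flat_def eventually_at_filter)
    have "((\<lambda>h. flat p h / h) \<longlongrightarrow> 0) (at 0)"
      using l r by (rule filterlim_split_at)
    then show ?thesis using 3
      by (simp add: DERIV_def) (simp add: flat_def)
  qed
qed

lemma C_k_real_flat: "C_k_real k (flat p)"
proof (induction k arbitrary: p)
  case 0
  show ?case
    using DERIV_isCont[OF flat_has_derivative] by (simp add: continuous_at_imp_continuous_on)
next
  case (Suc k)
  then show ?case using flat_has_derivative by (auto intro: exI)
qed

text \<open>A product of one-variable bumps.  Scaling the argument of \<open>exp (- 1/t)\<close> by \<open>k + 1\<close> amounts to
  taking a root, so the bumps increase to 1 inside the box and keep the support fixed.\<close>

definition box_bump :: "nat \<Rightarrow> real^'n \<Rightarrow> real^'n \<Rightarrow> real^'n \<Rightarrow> real" where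
  "box_bump k a b x =
     (\<Prod>i\<in>UNIV. flat 1 (real (Suc k) * (x $ i - a $ i)) * flat 1 (real (Suc k) * (b $ i - x $ i)))"

lemma flat_1_bounds: "0 \<le> flat 1 t" "flat 1 t \<le> 1"
  by (auto simp: flat_def)

lemma box_bump_bounds: "0 \<le> box_bump k a b x" "box_bump k a b x \<le> 1"
proof -
  have "0 \<le> flat 1 s * flat 1 t" "flat 1 s * flat 1 t \<le> 1" for s t
    using flat_1_bounds by (auto intro: mult_le_one)
  then show "0 \<le> box_bump k a b x" "box_bump k a b x \<le> 1"
    unfolding box_bump_def by (auto intro: prod_nonneg prod_le_1)
qed

lemma box_bump_outside: "x \<notin> box a b \<Longrightarrow> box_bump k a b x = 0"
proof -
  assume "x \<notin> box a b"
  then obtain i where "x $ i - a $ i \<le> 0 \<or> b $ i - x $ i \<le> 0"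
    by (auto simp: mem_box_cart not_less)
  then have "real (Suc k) * (x $ i - a $ i) \<le> 0 \<or> real (Suc k) * (b $ i - x $ i) \<le> 0"
    using mult_nonneg_nonpos[of "real (Suc k)"] by auto
  then have "flat 1 (real (Suc k) * (x $ i - a $ i)) * flat 1 (real (Suc k) * (b $ i - x $ i)) = 0"
    by (auto simp: flat_def simp del: of_nat_Suc)
  then show ?thesis
    unfolding box_bump_def by (intro prod_zero) auto
qed

lemma test_function_box_bump: "test_function (box_bump k a b :: real^'n \<Rightarrow> real)"
proof -
  have "C_k m (\<lambda>x::real^'n. flat 1 (real (Suc k) * (x $ i - a $ i)) * flat 1 (real (Suc k) * (b $ i - x $ i)))" for m i
  proof (rule C_k_mult)
    show "C_k m (\<lambda>x::real^'n. flat 1 (real (Suc k) * (x $ i - a $ i)))"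
      using C_k_component[OF C_k_real_affine[OF C_k_real_flat[of m 1], where a = "real (Suc k)" and b = "- (real (Suc k) * a $ i)"], of i]
      by (simp add: right_diff_distrib)
    show "C_k m (\<lambda>x::real^'n. flat 1 (real (Suc k) * (b $ i - x $ i)))"
      using C_k_component[OF C_k_real_affine[OF C_k_real_flat[of m 1], where a = "- real (Suc k)" and b = "real (Suc k) * b $ i"], of i]
      by (simp add: algebra_simps)
  qed
  then have "C_k m (box_bump k a b)" for m
    unfolding box_bump_def[abs_def] by (intro C_k_prod)
  moreover have "bounded {x. box_bump k a b x \<noteq> 0}"
    by (rule bounded_subset[OF bounded_box[of a b]]) (use box_bump_outside in blast)
  ultimately show ?thesis
    unfolding test_function_def compact_closure by (intro conjI allI)
qed

lemma box_bump_tendsto: "(\<lambda>k. box_bump k a b x) \<longlonglongrightarrow> indicator (box a b) x"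
proof (cases "x \<in> box a b")
  case True
  have *: "(\<lambda>k. flat 1 (real (Suc k) * t)) \<longlonglongrightarrow> 1" if "t > 0" for t
  proof -
    have "(\<lambda>k. exp (- (inverse (real (Suc k)) * inverse t))) \<longlonglongrightarrow> exp (- (0 * inverse t))"
      by (rule tendsto_exp[OF tendsto_minus[OF tendsto_mult[OF LIMSEQ_inverse_real_of_nat tendsto_const]]])
    moreover have "flat 1 (real (Suc k) * t) = exp (- (inverse (real (Suc k)) * inverse t))" for k
      using that by (simp add: flat_def divide_inverse del: of_nat_Suc)
    ultimately show ?thesis by simp
  qed
  have "(\<lambda>k. box_bump k a b x) \<longlonglongrightarrow> (\<Prod>i\<in>(UNIV::'a set). 1 * 1)"
    unfolding box_bump_def
  proof (rule tendsto_prod, rule tendsto_mult)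
    fix i
    show "(\<lambda>k. flat 1 (real (Suc k) * (x $ i - a $ i))) \<longlonglongrightarrow> 1"
      "(\<lambda>k. flat 1 (real (Suc k) * (b $ i - x $ i))) \<longlonglongrightarrow> 1"
      using True *[of "x $ i - a $ i"] *[of "b $ i - x $ i"] by (auto simp: mem_box_cart)
  qed
  moreover have "(\<Prod>i\<in>(UNIV::'a set). 1 * 1) = (indicator (box a b) x :: real)"
    using True by simp
  ultimately show ?thesis by (rule back_subst)
qed (simp add: box_bump_outside)

section \<open>Uniqueness of weak gradients\<close>

text \<open>The positive and the negative part of \<open>h\<close> are densities of two measures that agree on boxes,
  which are closed under intersection and generate the Borel sets.  Localising to the boxes
  \<open>B m\<close> makes the measures finite.\<close>

lemma AE_zero_if_box_integrals_zero:
  fixes h :: "'a::euclidean_space \<Rightarrow> real"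
  assumes h[measurable]: "h \<in> borel_measurable lborel"
    and int: "\<And>a b. integrable lborel (\<lambda>x. indicator (box a b) x * h x)"
    and zero: "\<And>a b. (LINT x|lborel. indicator (box a b) x * h x) = 0"
  shows "AE x in lborel. h x = 0"
proof -
  define B :: "nat \<Rightarrow> 'a set" where "B m = box (- (real m *\<^sub>R One)) (real m *\<^sub>R One)" for m
  have [measurable]: "B m \<in> sets borel" for m by (simp add: B_def)
  have "AE x in lborel. \<forall>m. x \<in> B m \<longrightarrow> h x = 0"
  proof (rule AE_all_countable[THEN iffD2], rule allI)
    fix m
    define P where "P x = ennreal (indicator (B m) x * h x)" for x
    define Q where "Q x = ennreal (- (indicator (B m) x * h x))" for x
    have [measurable]: "P \<in> borel_measurable lborel" "Q \<in> borel_measurable lborel"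
      by (auto simp: P_def[abs_def] Q_def[abs_def])
    have intB: "integrable lborel (\<lambda>x. indicator (B m) x * h x)"
      using int by (simp add: B_def)
    then have intB': "integrable lborel (\<lambda>x. - (indicator (B m) x * h x))" by simp
    have finP: "integral\<^sup>N lborel P \<noteq> \<infinity>" and finQ: "integral\<^sup>N lborel Q \<noteq> \<infinity>"
    proof -
      have "integral\<^sup>N lborel P \<le> (\<integral>\<^sup>+x. ennreal (norm (indicator (B m) x * h x)) \<partial>lborel)"
        by (rule nn_integral_mono) (auto simp: P_def intro!: ennreal_leI)
      also have "\<dots> < \<infinity>" using intB by (simp add: integrable_iff_bounded)
      finally show "integral\<^sup>N lborel P \<noteq> \<infinity>" by simp
      have "integral\<^sup>N lborel Q \<le> (\<integral>\<^sup>+x. ennreal (norm (indicator (B m) x * h x)) \<partial>lborel)"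
        by (rule nn_integral_mono) (auto simp: Q_def intro!: ennreal_leI)
      also have "\<dots> < \<infinity>" using intB by (simp add: integrable_iff_bounded)
      finally show "integral\<^sup>N lborel Q \<noteq> \<infinity>" by simp
    qed
    have "density lborel P = density lborel Q"
    proof (rule measure_eqI_generator_eq[where E = "range (\<lambda>(a, b). box a b)" and \<Omega> = UNIV
          and A = "\<lambda>n::nat. box (- (real n *\<^sub>R One)) (real n *\<^sub>R One)"])
      show "Int_stable (range (\<lambda>(a, b). box a b :: 'a set))"
        by (auto simp: Int_stable_def box_Int_box)
      show "sets (density lborel P) = sigma_sets UNIV (range (\<lambda>(a, b). box a b))"
        "sets (density lborel Q) = sigma_sets UNIV (range (\<lambda>(a, b). box a b))"
        by (simp_all add: borel_eq_box)
      show "(\<Union>i. box (- (real i *\<^sub>R One)) (real i *\<^sub>R One)) = (UNIV :: 'a set)"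
        by (rule UN_box_eq_UNIV)
      show "emeasure (density lborel P) (box (- (real i *\<^sub>R One)) (real i *\<^sub>R One)) \<noteq> \<infinity>" for i
      proof -
        have "emeasure (density lborel P) (box (- (real i *\<^sub>R One)) (real i *\<^sub>R One)) \<le> integral\<^sup>N lborel P"
          by (simp add: emeasure_density) (rule nn_integral_mono, auto split: split_indicator)
        then show ?thesis using finP by (auto simp: top_unique)
      qed
      fix X :: "'a set" assume "X \<in> range (\<lambda>(a, b). box a b)"
      then obtain a b where X: "X = box a b" by auto
      obtain c d where cd: "box c d = B m \<inter> X" unfolding X B_def box_Int_box by blast
      have X_meas: "X \<in> sets lborel" by (simp add: X)
      let ?f = "\<lambda>x. indicator (box c d) x * h x"
      have "emeasure (density lborel P) X = (\<integral>\<^sup>+x. ennreal (?f x) \<partial>lborel)"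
        unfolding emeasure_density[OF \<open>P \<in> _\<close> X_meas] cd
      proof (rule nn_integral_cong)
        fix x show "P x * indicator X x = ennreal (indicator (B m \<inter> X) x * h x)"
          by (cases "x \<in> B m"; cases "x \<in> X") (simp_all add: P_def)
      qed
      moreover have "emeasure (density lborel Q) X = (\<integral>\<^sup>+x. ennreal (- ?f x) \<partial>lborel)"
        unfolding emeasure_density[OF \<open>Q \<in> _\<close> X_meas] cd
      proof (rule nn_integral_cong)
        fix x show "Q x * indicator X x = ennreal (- (indicator (B m \<inter> X) x * h x))"
          by (cases "x \<in> B m"; cases "x \<in> X") (simp_all add: Q_def)
      qed
      moreover have "(\<integral>\<^sup>+x. ennreal (?f x) \<partial>lborel) = (\<integral>\<^sup>+x. ennreal (- ?f x) \<partial>lborel)"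
      proof -
        obtain r q where "0 \<le> r" "0 \<le> q" "(\<integral>\<^sup>+x. ennreal (?f x) \<partial>lborel) = ennreal r"
          "(\<integral>\<^sup>+x. ennreal (- ?f x) \<partial>lborel) = ennreal q" "integral\<^sup>L lborel ?f = r - q"
          by (rule integrableE[OF int[of c d]]) (erule (4) that)
        then show ?thesis using zero[of c d] by simp
      qed
      ultimately show "emeasure (density lborel P) X = emeasure (density lborel Q) X" by simp
    qed auto
    then have "AE x in lborel. P x = Q x"
      using finite_density_unique[of P lborel Q] finP by (auto simp: density_def)
    then show "AE x in lborel. x \<in> B m \<longrightarrow> h x = 0"
    proof eventually_elim
      case (elim x)
      have "ennreal t = ennreal (- t) \<Longrightarrow> t = 0" for t :: real
        by (cases "0 \<le> t") (auto simp: ennreal_neg ennreal_eq_0_iff dest: sym)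
      then show ?case using elim by (auto simp: P_def Q_def)
    qed
  qed
  moreover have "\<exists>m. x \<in> B m" for x
    using UN_box_eq_UNIV[where 'a='a] unfolding B_def by blast
  ultimately show ?thesis by (auto elim!: eventually_mono)
qed

lemma integrable_mult_bounded:
  fixes f \<phi> :: "'a \<Rightarrow> real"
  assumes "integrable M f" and [measurable]: "\<phi> \<in> borel_measurable M" and "\<And>x. x \<in> space M \<Longrightarrow> \<bar>\<phi> x\<bar> \<le> c"
  shows "integrable M (\<lambda>x. f x * \<phi> x)"
proof (rule Bochner_Integration.integrable_bound)
  show "integrable M (\<lambda>x. c * f x)" using assms(1) by simp
  show "(\<lambda>x. f x * \<phi> x) \<in> borel_measurable M"
    using borel_measurable_integrable[OF assms(1)] by measurable
  show "AE x in M. norm (f x * \<phi> x) \<le> norm (c * f x)"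
  proof (rule AE_I2)
    fix x assume "x \<in> space M"
    then have "\<bar>\<phi> x\<bar> \<le> \<bar>c\<bar>" using assms(3)[of x] by linarith
    then show "norm (f x * \<phi> x) \<le> norm (c * f x)"
      by (simp add: abs_mult mult.commute mult_right_mono)
  qed
qed

lemma locally_integrable_mult_integrable:
  fixes f \<phi> :: "real^'n \<Rightarrow> real"
  assumes f: "locally_integrable f" and \<phi>[measurable]: "\<phi> \<in> borel_measurable lebesgue"
    and bound: "\<And>x. \<bar>\<phi> x\<bar> \<le> c" and supp: "\<And>x. x \<notin> K \<Longrightarrow> \<phi> x = 0" and "compact K"
  shows "integrable lebesgue (\<lambda>x. f x * \<phi> x)"
proof -
  have int: "integrable lebesgue (\<lambda>x. indicator K x * f x)"
    using f \<open>compact K\<close> by (simp add: locally_integrable_def set_integrable_def)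
  have "integrable lebesgue (\<lambda>x. (indicator K x * f x) * \<phi> x)"
    by (rule integrable_mult_bounded[OF int \<phi> bound])
  moreover have "(indicator K x * f x) * \<phi> x = f x * \<phi> x" for x
    using supp by (auto split: split_indicator)
  ultimately show ?thesis by simp
qed

lemma continuous_imp_borel_measurable_lebesgue:
  "continuous_on UNIV f \<Longrightarrow> f \<in> borel_measurable lebesgue"
  by (rule measurable_completion) (simp add: borel_measurable_continuous_onI)

lemma test_function_bounded_support:
  assumes "test_function \<phi>"
  obtains c K where "continuous_on UNIV \<phi>" "\<forall>x. \<bar>\<phi> x\<bar> \<le> c" "compact K" "\<forall>x. x \<notin> K \<longrightarrow> \<phi> x = 0"
proof -
  define K where "K = closure {x. \<phi> x \<noteq> 0}"
  have K: "compact K" "\<And>x. x \<notin> K \<Longrightarrow> \<phi> x = 0"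
    using assms closure_subset[of "{x. \<phi> x \<noteq> 0}"] by (auto simp: test_function_def K_def)
  have cont: "continuous_on UNIV \<phi>"
    using assms C_k.simps(1)[of \<phi>] by (auto simp: test_function_def simp del: C_k.simps)
  have "bounded (\<phi> ` K)"
    using K(1) cont by (intro compact_imp_bounded compact_continuous_image) (auto intro: continuous_on_subset)
  then obtain c where "\<And>x. x \<in> K \<Longrightarrow> \<bar>\<phi> x\<bar> \<le> c" by (auto simp: bounded_iff)
  then have "\<bar>\<phi> x\<bar> \<le> max c 0" for x
    using K(2)[of x] by (cases "x \<in> K") (auto simp: le_max_iff_disj)
  with cont K show thesis by (intro that) auto
qed

lemma locally_integrable_component:
  fixes g :: "real^'n \<Rightarrow> real^'n"
  assumes "locally_integrable g"
  shows "locally_integrable (\<lambda>x. g x $ i)"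
  using assms absolutely_integrable_component[where f = g and b = "axis i 1"]
  by (auto simp: locally_integrable_def cart_eq_inner_axis)

text \<open>The fundamental lemma of the calculus of variations: the bumps \<open>box_bump k a b\<close> transfer
  the hypothesis from test functions to indicators of boxes by dominated convergence.\<close>

lemma AE_zero_if_test_integrals_zero:
  fixes h :: "real^'n \<Rightarrow> real"
  assumes h: "locally_integrable h"
    and zero: "\<And>\<phi>. test_function \<phi> \<Longrightarrow> (LINT x|lebesgue. h x * \<phi> x) = 0"
  shows "AE x in lebesgue. h x = 0"
proof -
  have box_int: "integrable lebesgue (\<lambda>x. h x * indicator (box a b) x)" for a b
    by (rule locally_integrable_mult_integrable[OF h, where c = 1 and K = "cbox a b"])
      (use box_subset_cbox in \<open>auto split: split_indicator intro!: borel_measurable_indicator\<close>)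
  have box_zero: "(LINT x|lebesgue. h x * indicator (box a b) x) = 0" for a b
  proof -
    have [measurable]: "box_bump k a b \<in> borel_measurable lebesgue" for k
      by (rule test_function_bounded_support[OF test_function_box_bump[of k a b]],
          rule continuous_imp_borel_measurable_lebesgue)
    have bump_int: "integrable lebesgue (\<lambda>x. h x * box_bump k a b x)" for k
    proof (rule locally_integrable_mult_integrable[OF h, where c = 1 and K = "cbox a b"])
      show "\<bar>box_bump k a b x\<bar> \<le> 1" for x
        using box_bump_bounds[of k a b x] by simp
      show "x \<notin> cbox a b \<Longrightarrow> box_bump k a b x = 0" for x
        using box_subset_cbox[of a b] by (intro box_bump_outside) blast
    qed simp_all
    have "(\<lambda>k. LINT x|lebesgue. h x * box_bump k a b x)
        \<longlonglongrightarrow> (LINT x|lebesgue. h x * indicator (box a b) x)"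
    proof (rule integral_dominated_convergence[where w = "\<lambda>x. norm (h x * indicator (box a b) x)"])
      show "(\<lambda>x. h x * indicator (box a b) x) \<in> borel_measurable lebesgue"
        using box_int by (rule borel_measurable_integrable)
      show "(\<lambda>x. h x * box_bump k a b x) \<in> borel_measurable lebesgue" for k
        using bump_int by (rule borel_measurable_integrable)
      show "integrable lebesgue (\<lambda>x. norm (h x * indicator (box a b) x))"
        using box_int by (rule integrable_norm)
      show "AE x in lebesgue. (\<lambda>k. h x * box_bump k a b x) \<longlonglongrightarrow> h x * indicator (box a b) x"
        by (intro AE_I2 tendsto_mult tendsto_const box_bump_tendsto)
      show "AE x in lebesgue. norm (h x * box_bump k a b x) \<le> norm (h x * indicator (box a b) x)" for k
        using box_bump_bounds[of k a b] box_bump_outside[of _ a b k]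
        by (intro AE_I2) (auto simp: abs_mult split: split_indicator intro!: mult_left_le)
    qed
    then show ?thesis
      using zero[OF test_function_box_bump] by (simp add: LIMSEQ_const_iff)
  qed
  have "h \<in> borel_measurable lebesgue"
  proof (rule borel_measurable_LIMSEQ_real)
    show "(\<lambda>x. h x * indicator (box (- (real k *\<^sub>R One)) (real k *\<^sub>R One)) x) \<in> borel_measurable lebesgue" for k
      using box_int by (rule borel_measurable_integrable)
    fix x :: "real^'n"
    obtain m :: nat where m: "x \<in> box (- (real m *\<^sub>R One)) (real m *\<^sub>R One)"
      using UN_box_eq_UNIV[where 'a="real^'n"] by blast
    have "\<forall>\<^sub>F k in sequentially. h x * indicator (box (- (real k *\<^sub>R One)) (real k *\<^sub>R One)) x = h x"
      using eventually_ge_at_top[of m]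
    proof eventually_elim
      case (elim k)
      then have "box (- (real m *\<^sub>R One)) (real m *\<^sub>R One) \<subseteq> box (- (real k *\<^sub>R One)) (real k *\<^sub>R (One::real^'n))"
        by (intro subset_box_imp) auto
      then show ?case using m by auto
    qed
    then show "(\<lambda>k. h x * indicator (box (- (real k *\<^sub>R One)) (real k *\<^sub>R One)) x) \<longlonglongrightarrow> h x"
      by (rule tendsto_eventually)
  qed
  then obtain h' where [measurable]: "h' \<in> borel_measurable lborel" and ae: "AE x in lborel. h x = h' x"
    using completion_ex_borel_measurable_real by blast
  have ae': "AE x in lebesgue. h x * indicator (box a b) x = indicator (box a b) x * h' x" for a b
    using AE_completion[OF ae] by eventually_elim simp
  have "integrable lebesgue (\<lambda>x. indicator (box a b) x * h' x)" for a b
    by (rule integrable_cong_AE_imp[OF box_int[of a b] _ ae'[of a b]]) (intro measurable_completion, measurable)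
  moreover have "(LINT x|lebesgue. indicator (box a b) x * h' x) = 0" for a b
  proof -
    have "(LINT x|lebesgue. h x * indicator (box a b) x) = (LINT x|lebesgue. indicator (box a b) x * h' x)"
      by (rule integral_cong_AE[OF borel_measurable_integrable[OF box_int[of a b]] _ ae'[of a b]])
        (intro measurable_completion, measurable)
    with box_zero[of a b] show ?thesis by simp
  qed
  ultimately have "AE x in lborel. h' x = 0"
    by (intro AE_zero_if_box_integrals_zero) (auto simp: integrable_completion integral_completion)
  with ae have "AE x in lborel. h x = 0" by eventually_elim simp
  then show ?thesis by (rule AE_completion)
qed

lemma weak_gradient_AE_unique:
  assumes g: "has_weak_gradient v g" and g': "has_weak_gradient v g'"
  shows "AE x in lebesgue. g x = g' x"
proof -
  have "AE x in lebesgue. g x $ i - g' x $ i = 0" for i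
  proof (rule AE_zero_if_test_integrals_zero)
    have li: "locally_integrable (\<lambda>x. g x $ i)" "locally_integrable (\<lambda>x. g' x $ i)"
      using g g' by (auto simp: has_weak_gradient_def intro: locally_integrable_component)
    then show "locally_integrable (\<lambda>x. g x $ i - g' x $ i)"
      by (auto simp: locally_integrable_def intro: set_integral_diff)
    fix \<phi> :: "real^'a \<Rightarrow> real" assume \<phi>: "test_function \<phi>"
    then obtain c K where cont: "continuous_on UNIV \<phi>" and c: "\<forall>x. \<bar>\<phi> x\<bar> \<le> c"
      and K: "compact K" "\<forall>x. x \<notin> K \<longrightarrow> \<phi> x = 0"
      by (rule test_function_bounded_support)
    have [measurable]: "\<phi> \<in> borel_measurable lebesgue"
      using cont by (rule continuous_imp_borel_measurable_lebesgue)
    have K_out: "\<phi> x = 0" if "x \<notin> K" for x using K(2) that by simp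
    have "integrable lebesgue (\<lambda>x. g x $ i * \<phi> x)"
      by (rule locally_integrable_mult_integrable[OF li(1) \<open>\<phi> \<in> _\<close> spec[OF c] K_out K(1)])
    moreover have "integrable lebesgue (\<lambda>x. g' x $ i * \<phi> x)"
      by (rule locally_integrable_mult_integrable[OF li(2) \<open>\<phi> \<in> _\<close> spec[OF c] K_out K(1)])
    moreover have "(LINT x|lebesgue. g x $ i * \<phi> x) = (LINT x|lebesgue. g' x $ i * \<phi> x)"
    proof -
      have "(LINT x|lebesgue. v x * partial_deriv i \<phi> x) = - (LINT x|lebesgue. g x $ i * \<phi> x)"
        using g \<phi> by (simp add: has_weak_gradient_def)
      moreover have "(LINT x|lebesgue. v x * partial_deriv i \<phi> x) = - (LINT x|lebesgue. g' x $ i * \<phi> x)"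
        using g' \<phi> by (simp add: has_weak_gradient_def)
      ultimately show ?thesis by simp
    qed
    ultimately show "(LINT x|lebesgue. (g x $ i - g' x $ i) * \<phi> x) = 0"
      by (simp add: left_diff_distrib)
  qed
  then have "AE x in lebesgue. \<forall>i. g x $ i - g' x $ i = 0"
    by (simp add: AE_all_countable)
  then show ?thesis by eventually_elim (simp add: vec_eq_iff)
qed

section \<open>Weak compactness of bounded sequences in Lp\<close>

text \<open>The convex function \<open>a \<mapsto> a^p\<close> lies above its tangent at \<open>c\<close>; this is Young's inequality
  with the conjugate exponent \<open>q\<close>.  The tangent is affine in \<open>a\<close>, hence
  stable under weak limits and under averaging.\<close>

lemma powr_ge_tangent:
  fixes a c p :: real
  assumes "1 < p" "0 \<le> a" "0 \<le> c"
  shows "p * c powr (p - 1) * a - (p - 1) * c powr p \<le> a powr p"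
proof -
  define q where "q = p / (p - 1)"
  have q: "1 < q" "1 / p + 1 / q = 1"
    using assms by (auto simp: q_def field_simps)
  have "a * c powr (p - 1) \<le> a powr p / p + (c powr (p - 1)) powr q / q"
    using assms q by (intro Youngs_inequality) auto
  also have "(c powr (p - 1)) powr q = c powr p"
    using assms by (simp add: powr_powr q_def)
  finally have "p * (a * c powr (p - 1)) \<le> p * (a powr p / p + c powr p / q)"
    using assms by (intro mult_left_mono) auto
  also have "\<dots> = a powr p + (p - 1) * c powr p"
    using assms by (simp add: q_def field_simps)
  finally show ?thesis by (simp add: algebra_simps)
qed

text \<open>Uniform integrability in pointwise form: above the level \<open>c\<close>, the function is dominated by
  its \<open>p\<close>-th power with a factor that tends to 0 as \<open>c\<close> grows.\<close>

lemma le_add_powr: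
  fixes a c p :: real
  assumes "1 < p" "0 \<le> a" "0 < c"
  shows "a \<le> c + c powr (1 - p) * a powr p"
proof (cases "a \<le> c")
  case True
  then show ?thesis using assms by (simp add: add_increasing2)
next
  case False
  then have "1 \<le> (a / c) powr (p - 1)"
    using assms by (intro ge_one_powr_ge_zero) auto
  then have "a * 1 \<le> a * (a / c) powr (p - 1)"
    using assms by (intro mult_left_mono) auto
  also have "\<dots> = c powr (1 - p) * a powr p"
    using assms False by (simp add: powr_divide powr_diff field_simps)
  finally show ?thesis using assms by simp
qed

text \<open>Tychonoff's theorem, used through filters: a cluster point of \<open>\<Lambda>\<close> in the product of the
  intervals is a limit along a finer filter.  A filter is needed in place of a subsequence,
  because the index type \<open>'i\<close> may be uncountable; below it is a space of functions.\<close>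

lemma subconvergent_filter_of_bounded:
  fixes \<Lambda> :: "'k \<Rightarrow> 'i \<Rightarrow> real"
  assumes F: "F \<noteq> bot" and bound: "\<And>k i. \<bar>\<Lambda> k i\<bar> \<le> b i"
  obtains F' L where "F' \<le> F" "F' \<noteq> bot" "\<forall>i. ((\<lambda>k. \<Lambda> k i) \<longlongrightarrow> L i) F'"
proof -
  have "compactin (product_topology (\<lambda>i. euclideanreal) UNIV) (PiE UNIV (\<lambda>i. {- b i..b i}))"
    by (simp add: compactin_PiE)
  then have "compact (PiE UNIV (\<lambda>i. {- b i..b i}))"
    by (simp add: euclidean_product_topology)
  moreover have "\<Lambda> k \<in> PiE UNIV (\<lambda>i. {- b i..b i})" for k
    using bound[of k] by (auto simp: abs_le_iff minus_le_iff)
  then have "eventually (\<lambda>x. x \<in> PiE UNIV (\<lambda>i. {- b i..b i})) (filtermap \<Lambda> F)"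
    by (simp add: eventually_filtermap)
  moreover have "filtermap \<Lambda> F \<noteq> bot" using F by (simp add: filtermap_bot_iff)
  ultimately obtain L where L: "inf (nhds L) (filtermap \<Lambda> F) \<noteq> bot"
    unfolding compact_filter by blast
  \<comment> \<open>The coarsest refinement of \<open>F\<close> along which \<open>\<Lambda>\<close> converges to \<open>L\<close>.\<close>
  define F' where "F' = inf F (filtercomap \<Lambda> (nhds L))"
  have "F' \<noteq> bot"
  proof
    assume "F' = bot"
    then have "eventually (\<lambda>_. False) F'" by simp
    then obtain P Q where P: "eventually P F" and Q: "eventually Q (filtercomap \<Lambda> (nhds L))"
      and PQ: "\<And>k. P k \<Longrightarrow> Q k \<Longrightarrow> False"
      unfolding F'_def eventually_inf by blast
    from Q obtain R where R: "eventually R (nhds L)" and RQ: "\<And>k. R (\<Lambda> k) \<Longrightarrow> Q k"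
      unfolding eventually_filtercomap by blast
    have "eventually (\<lambda>x. \<not> R x) (filtermap \<Lambda> F)"
      unfolding eventually_filtermap using P by eventually_elim (use PQ RQ in blast)
    with R have "eventually (\<lambda>_. False) (inf (nhds L) (filtermap \<Lambda> F))"
      unfolding eventually_inf by blast
    with L show False by (simp add: trivial_limit_def)
  qed
  moreover have "(\<Lambda> \<longlongrightarrow> L) F'"
    unfolding filterlim_def F'_def
    by (rule order_trans[OF filtermap_mono[OF inf_le2] filtermap_filtercomap])
  then have "((\<lambda>k. \<Lambda> k i) \<longlongrightarrow> L i) F'" for i
    using continuous_on_tendsto_compose[OF continuous_on_product_coordinates[of i], of \<Lambda> L F'] by simp
  ultimately show thesis using that[of F' L] by (simp add: F'_def)
qed

lemma (in finite_measure) integrable_of_powr: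
  fixes f :: "'a \<Rightarrow> real"
  assumes p: "1 < p" and [measurable]: "f \<in> borel_measurable M" and "\<And>x. 0 \<le> f x"
    and fin: "(\<integral>\<^sup>+x. ennreal (f x powr p) \<partial>M) < \<infinity>"
  shows "integrable M (\<lambda>x. f x powr p)" "integrable M f"
proof -
  show int: "integrable M (\<lambda>x. f x powr p)"
    using fin by (intro integrableI_nonneg) auto
  show "integrable M f"
  proof (rule Bochner_Integration.integrable_bound)
    show "integrable M (\<lambda>x. 1 + f x powr p)" using int by simp
    show "AE x in M. norm (f x) \<le> norm (1 + f x powr p)"
      using le_add_powr[OF p assms(3), of 1] assms(3)
      by (intro AE_I2) (simp add: add_nonneg_nonneg)
  qed measurable
qed

text \<open>The bound has a part that is small for small \<open>\<psi>\<close> and a part that is small for large \<open>t\<close>,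
  uniformly over all \<open>f\<close> with the given bound in Lp.\<close>

lemma (in finite_measure) integral_mult_le_truncation:
  fixes f \<psi> :: "'a \<Rightarrow> real"
  assumes p: "1 < p" and f[measurable]: "f \<in> borel_measurable M" and f0: "\<And>x. 0 \<le> f x"
    and K: "(\<integral>\<^sup>+x. ennreal (f x powr p) \<partial>M) \<le> ennreal K" "0 \<le> K"
    and \<psi>[measurable]: "\<psi> \<in> borel_measurable M" 
    and c: "\<And>x. x \<in> space M \<Longrightarrow> \<bar>\<psi> x\<bar> \<le> c" and c0: "0 \<le> c" and t: "0 < t"
  shows "\<bar>\<integral>x. f x * \<psi> x \<partial>M\<bar> \<le> t * (\<integral>x. \<bar>\<psi> x\<bar> \<partial>M) + c * (t powr (1 - p) * K)"
proof -
  have fin: "(\<integral>\<^sup>+x. ennreal (f x powr p) \<partial>M) < \<infinity>"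
    using K(1) by (rule le_less_trans) simp
  note int = integrable_of_powr[OF p f f0 fin]
  have int_\<psi>: "integrable M (\<lambda>x. \<bar>\<psi> x\<bar>)"
    using c by (intro integrable_const_bound[where B = c]) auto
  have "\<bar>\<integral>x. f x * \<psi> x \<partial>M\<bar> \<le> (\<integral>x. norm (f x * \<psi> x) \<partial>M)"
    by (metis integral_norm_bound real_norm_def)
  also have "\<dots> \<le> (\<integral>x. t * \<bar>\<psi> x\<bar> + c * (t powr (1 - p) * f x powr p) \<partial>M)"
  proof (rule integral_mono)
    show "integrable M (\<lambda>x. norm (f x * \<psi> x))"
      using integrable_mult_bounded[OF int(2) \<psi> c] by simp
    show "integrable M (\<lambda>x. t * \<bar>\<psi> x\<bar> + c * (t powr (1 - p) * f x powr p))"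
      using int(1) int_\<psi> by simp
    fix x assume x: "x \<in> space M"
    have "norm (f x * \<psi> x) = f x * \<bar>\<psi> x\<bar>" using f0 by (simp add: abs_mult)
    also have "\<dots> \<le> (t + t powr (1 - p) * f x powr p) * \<bar>\<psi> x\<bar>"
      using le_add_powr[OF p f0 t] by (intro mult_right_mono) auto
    also have "\<dots> \<le> t * \<bar>\<psi> x\<bar> + c * (t powr (1 - p) * f x powr p)"
      using mult_right_mono[OF c[OF x], of "t powr (1 - p) * f x powr p"]
      by (simp add: algebra_simps)
    finally show "norm (f x * \<psi> x) \<le> t * \<bar>\<psi> x\<bar> + c * (t powr (1 - p) * f x powr p)" .
  qed
  also have "\<dots> = t * (\<integral>x. \<bar>\<psi> x\<bar> \<partial>M) + c * (t powr (1 - p) * (\<integral>x. f x powr p \<partial>M))"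
    using int(1) int_\<psi> by simp
  also have "\<dots> \<le> t * (\<integral>x. \<bar>\<psi> x\<bar> \<partial>M) + c * (t powr (1 - p) * K)"
  proof -
    have "ennreal (\<integral>x. f x powr p \<partial>M) \<le> ennreal K"
      using K(1) by (subst nn_integral_eq_integral[symmetric, OF int(1)]) auto
    then have "(\<integral>x. f x powr p \<partial>M) \<le> K" using K(2) by (simp add: ennreal_le_iff)
    then show ?thesis using c0 by (intro add_left_mono mult_left_mono) auto
  qed
  finally show ?thesis .
qed

text \<open>A cluster point \<open>L\<close> of the functionals \<open>\<phi> \<mapsto> \<integral>f\<^sub>k \<phi>\<close> on bounded functions inherits their
  linearity, positivity and, from uniform integrability, continuity under bounded pointwise
  convergence.  So \<open>A \<mapsto> L (indicator A)\<close> is a finite measure, and its Radon-Nikodym density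
  represents \<open>L\<close>.\<close>

lemma (in finite_measure) weak_Lp_compactness_finite:
  fixes f :: "'k \<Rightarrow> 'a \<Rightarrow> real"
  assumes F: "F \<noteq> bot" and p: "1 < p"
    and f[measurable]: "\<And>k. f k \<in> borel_measurable M" and f0: "\<And>k x. 0 \<le> f k x"
    and K: "\<And>k. (\<integral>\<^sup>+x. ennreal (f k x powr p) \<partial>M) \<le> ennreal K" "0 \<le> K"
  obtains F' g where "F' \<le> F" "F' \<noteq> bot" "integrable M g" "\<forall>x. 0 \<le> g x"
    "g \<in> borel_measurable M" "\<forall>\<phi> c. \<phi> \<in> borel_measurable M \<longrightarrow> (\<forall>x\<in>space M. \<bar>\<phi> x\<bar> \<le> c) \<longrightarrow>
       ((\<lambda>k. \<integral>x. f k x * \<phi> x \<partial>M) \<longlongrightarrow> (\<integral>x. g x * \<phi> x \<partial>M)) F'"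
proof -
  define adm where "adm \<phi> c \<longleftrightarrow> \<phi> \<in> borel_measurable M \<and> 0 \<le> c \<and> (\<forall>x\<in>space M. \<bar>\<phi> x\<bar> \<le> c)" for \<phi> :: "'a \<Rightarrow> real" and c
  have fin: "(\<integral>\<^sup>+x. ennreal (f k x powr p) \<partial>M) < \<infinity>" for k
    using K(1)[of k] by (rule le_less_trans) simp
  have f_int: "integrable M (f k)" for k
    using integrable_of_powr(2)[OF p f f0 fin] .
  have f\<phi>_int: "integrable M (\<lambda>x. f k x * \<phi> x)" if "adm \<phi> c" for \<phi> c k
    using integrable_mult_bounded[OF f_int] that by (auto simp: adm_def)
  \<comment> \<open>The value 0 on functions that are not bounded and measurable keeps every coordinate bounded.\<close>
  define \<Lambda> where "\<Lambda> k \<phi> = (if \<exists>c. adm \<phi> c then \<integral>x. f k x * \<phi> x \<partial>M else 0)" for k \<phi>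
  have \<Lambda>_eq: "\<Lambda> k \<phi> = (\<integral>x. f k x * \<phi> x \<partial>M)" if "adm \<phi> c" for \<phi> c k
    using that by (auto simp: \<Lambda>_def)
  have \<Lambda>_bound: "\<bar>\<Lambda> k \<phi>\<bar> \<le> t * (\<integral>x. \<bar>\<phi> x\<bar> \<partial>M) + c * (t powr (1 - p) * K)"
    if "adm \<phi> c" "0 < t" for \<phi> c k t
    using integral_mult_le_truncation[OF p f f0 K, of \<phi> c t k] that \<Lambda>_eq[OF that(1)]
    by (auto simp: adm_def)
  have "\<exists>b. \<forall>k. \<bar>\<Lambda> k \<phi>\<bar> \<le> b" for \<phi>
  proof (cases "\<exists>c. adm \<phi> c")
    case True
    then obtain c where "adm \<phi> c" ..
    then show ?thesis using \<Lambda>_bound[of \<phi> c 1] by auto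
  next
    case False
    then show ?thesis by (auto simp: \<Lambda>_def)
  qed
  then have "\<forall>\<phi>. \<exists>b. \<forall>k. \<bar>\<Lambda> k \<phi>\<bar> \<le> b" by (rule allI)
  from choice[OF this] obtain b where "\<forall>\<phi> k. \<bar>\<Lambda> k \<phi>\<bar> \<le> b \<phi>" ..
  then have b: "\<And>k \<phi>. \<bar>\<Lambda> k \<phi>\<bar> \<le> b \<phi>" by simp
  obtain F' L where F': "F' \<le> F" "F' \<noteq> bot" and "\<forall>\<phi>. ((\<lambda>k. \<Lambda> k \<phi>) \<longlongrightarrow> L \<phi>) F'"
    by (rule subconvergent_filter_of_bounded[where \<Lambda> = \<Lambda> and b = b, OF F b])
  then have lim: "((\<lambda>k. \<Lambda> k \<phi>) \<longlongrightarrow> L \<phi>) F'" for \<phi> by simp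
  have L_bound: "\<bar>L \<phi>\<bar> \<le> t * (\<integral>x. \<bar>\<phi> x\<bar> \<partial>M) + c * (t powr (1 - p) * K)"
    if "adm \<phi> c" "0 < t" for \<phi> c t
    by (rule tendsto_upperbound[OF tendsto_rabs[OF lim] _ F'(2)])
      (use \<Lambda>_bound[OF that] in simp)
  have L_add: "L (\<lambda>x. a * \<phi> x + b * \<psi> x) = a * L \<phi> + b * L \<psi>"
    if A: "adm \<phi> c" "adm \<psi> d" for \<phi> \<psi> c d a b
  proof (rule tendsto_unique[OF F'(2)])
    have B: "adm (\<lambda>x. a * \<phi> x + b * \<psi> x) (\<bar>a\<bar> * c + \<bar>b\<bar> * d)"
    proof -
      have "\<bar>a * \<phi> x + b * \<psi> x\<bar> \<le> \<bar>a\<bar> * c + \<bar>b\<bar> * d" if "x \<in> space M" for x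
        using A that by (intro order_trans[OF abs_triangle_ineq] add_mono)
          (auto simp: abs_mult adm_def intro!: mult_left_mono)
      then show ?thesis using A by (auto simp: adm_def)
    qed
    have "\<Lambda> k (\<lambda>x. a * \<phi> x + b * \<psi> x) = a * \<Lambda> k \<phi> + b * \<Lambda> k \<psi>" for k
    proof -
      have "(\<lambda>x. f k x * (a * \<phi> x + b * \<psi> x)) = (\<lambda>x. a * (f k x * \<phi> x) + b * (f k x * \<psi> x))"
        by (rule ext) (simp add: algebra_simps)
      then show ?thesis
        using f\<phi>_int[OF A(1)] f\<phi>_int[OF A(2)]
        by (simp add: \<Lambda>_eq[OF A(1)] \<Lambda>_eq[OF A(2)] \<Lambda>_eq[OF B])
    qed
    then show "((\<lambda>k. \<Lambda> k (\<lambda>x. a * \<phi> x + b * \<psi> x)) \<longlongrightarrow> a * L \<phi> + b * L \<psi>) F'"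
      by (simp add: tendsto_add tendsto_mult_left lim)
  qed (rule lim)
  have L_nonneg: "0 \<le> L \<phi>" if "adm \<phi> c" "\<And>x. 0 \<le> \<phi> x" for \<phi> c
    by (rule tendsto_lowerbound[OF lim _ F'(2)])
      (use that f0 in \<open>auto simp: \<Lambda>_eq[OF that(1)] intro!: always_eventually integral_nonneg_AE\<close>)
  \<comment> \<open>First \<open>t\<close> is chosen large to control the high values of the \<open>f k\<close>, then \<open>i\<close> large.\<close>
  have L_cont: "(\<lambda>i. L (\<psi> i)) \<longlonglongrightarrow> 0"
    if A: "\<And>i. adm (\<psi> i) c" and ptw: "\<And>x. x \<in> space M \<Longrightarrow> (\<lambda>i. \<psi> i x) \<longlonglongrightarrow> 0"
    for \<psi> :: "nat \<Rightarrow> 'a \<Rightarrow> real" and c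
  proof (rule LIMSEQ_I)
    fix e :: real assume e: "0 < e"
    have [measurable]: "\<psi> i \<in> borel_measurable M" for i using A by (simp add: adm_def)
    have "(\<lambda>i. \<integral>x. \<bar>\<psi> i x\<bar> \<partial>M) \<longlonglongrightarrow> (\<integral>x. 0 \<partial>M)"
      using A ptw by (intro integral_dominated_convergence[where w = "\<lambda>_. c"])
        (auto simp: adm_def intro!: AE_I2 tendsto_rabs_zero)
    then have I: "(\<lambda>i. \<integral>x. \<bar>\<psi> i x\<bar> \<partial>M) \<longlonglongrightarrow> 0" by simp
    have "((\<lambda>t. c * (t powr (1 - p) * K)) \<longlongrightarrow> c * (0 * K)) at_top"
      using p by (intro tendsto_mult tendsto_const tendsto_neg_powr filterlim_ident) auto
    from order_tendstoD(2)[OF this, of "e / 2"]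
    have ev: "eventually (\<lambda>t. c * (t powr (1 - p) * K) < e / 2) at_top"
      using e by simp
    obtain t where t: "0 < t" "c * (t powr (1 - p) * K) < e / 2"
      using eventually_happens'[OF trivial_limit_at_top_linorder
          eventually_conj[OF eventually_gt_at_top[of "0::real"] ev]] by auto
    have "eventually (\<lambda>i. (\<integral>x. \<bar>\<psi> i x\<bar> \<partial>M) < e / (2 * t)) sequentially"
      using order_tendstoD(2)[OF I, of "e / (2 * t)"] e t by simp
    then obtain n0 where n0: "\<And>i. i \<ge> n0 \<Longrightarrow> (\<integral>x. \<bar>\<psi> i x\<bar> \<partial>M) < e / (2 * t)"
      by (auto simp: eventually_sequentially)
    have "norm (L (\<psi> i) - 0) < e" if "i \<ge> n0" for i
    proof -
      have "t * (\<integral>x. \<bar>\<psi> i x\<bar> \<partial>M) < e / 2"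
        using n0[OF that] t by (simp add: field_simps)
      then show ?thesis using L_bound[OF A t(1), of i] t(2) by simp
    qed
    then show "\<exists>n0. \<forall>i\<ge>n0. norm (L (\<psi> i) - 0) < e" by blast
  qed
  have adm_ind: "adm (indicator A) 1" if "A \<in> sets M" for A
    using that by (auto simp: adm_def split: split_indicator)
  define \<nu> where "\<nu> A = ennreal (L (indicator A))" for A
  have \<nu>_add: "\<nu> (A \<union> B) = \<nu> A + \<nu> B" if "A \<in> sets M" "B \<in> sets M" "A \<inter> B = {}" for A B
  proof -
    have "indicator (A \<union> B) = (\<lambda>x. 1 * indicator A x + 1 * indicator B x :: real)"
      using that(3) by (intro ext) (auto simp: indicator_def)
    then have "L (indicator (A \<union> B)) = L (indicator A) + L (indicator B)"
      using L_add[OF adm_ind[OF that(1)] adm_ind[OF that(2)], of 1 1] by simp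
    then show ?thesis
      using L_nonneg[OF adm_ind] that by (simp add: \<nu>_def ennreal_plus)
  qed
  have \<nu>_empty: "\<nu> {} = 0"
  proof -
    have "L (indicator {}) = 0"
      using L_add[OF adm_ind[of "{}"] adm_ind[of "{}"], of 0 0]
      by (simp add: indicator_def[abs_def])
    then show ?thesis by (simp add: \<nu>_def)
  qed
  have pos: "positive (sets M) \<nu>" by (simp add: positive_def \<nu>_empty)
  have ca: "countably_additive (sets M) \<nu>"
  proof (rule sets.empty_continuous_imp_countably_additive[OF pos])
    show "additive (sets M) \<nu>" using \<nu>_add by (auto simp: additive_def)
    show "\<forall>A\<in>sets M. \<nu> A \<noteq> \<infinity>" by (simp add: \<nu>_def)
    fix A :: "nat \<Rightarrow> 'a set"
    assume A: "range A \<subseteq> sets M" "decseq A" "(\<Inter>i. A i) = {}"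
    have "(\<lambda>i. L (indicator (A i))) \<longlonglongrightarrow> 0"
    proof (rule L_cont)
      show "adm (indicator (A i)) 1" for i using A by (intro adm_ind) auto
      show "(\<lambda>i. indicator (A i) x :: real) \<longlonglongrightarrow> 0" for x
        using LIMSEQ_indicator_decseq[OF A(2), of x] A(3) by simp
    qed
    then show "(\<lambda>i. \<nu> (A i)) \<longlonglongrightarrow> 0"
      unfolding \<nu>_def ennreal_0[symmetric] by (rule tendsto_ennrealI)
  qed
  define N where "N = measure_of (space M) (sets M) \<nu>"
  have sets_N: "sets N = sets M" by (simp add: N_def)
  have N_eq: "emeasure N A = \<nu> A" if "A \<in> sets M" for A
    unfolding N_def using pos ca that by (intro emeasure_measure_of_sigma sets.sigma_algebra_axioms)
  have "absolutely_continuous M N"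
    unfolding absolutely_continuous_def
  proof
    fix A assume A: "A \<in> null_sets M"
    then have AM: "A \<in> sets M" by auto
    have "AE x in M. f k x * indicator A x = 0" for k
      using AE_not_in[OF A] by eventually_elim simp
    then have "\<Lambda> k (indicator A) = 0" for k
      unfolding \<Lambda>_eq[OF adm_ind[OF AM]] by (rule integral_eq_zero_AE)
    then have "L (indicator A) = 0"
      using lim[of "indicator A"] F'(2) by (simp add: tendsto_const_iff)
    then show "A \<in> null_sets N" using N_eq[OF AM] AM by (auto simp: \<nu>_def sets_N null_sets_def)
  qed
  from Radon_Nikodym[OF this sets_N] obtain g' where g'[measurable]: "g' \<in> borel_measurable M"
    and dens: "density M g' = N" by blast
  define g where "g x = enn2real (g' x)" for x
  have g_meas[measurable]: "g \<in> borel_measurable M" by (simp add: g_def[abs_def])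
  have g0: "0 \<le> g x" for x by (simp add: g_def)
  have g'_ind: "(\<integral>\<^sup>+x. g' x * indicator A x \<partial>M) = ennreal (L (indicator A))" if "A \<in> sets M" for A
    using emeasure_density[OF g' that] that N_eq[OF that] by (simp add: dens \<nu>_def)
  have "(\<integral>\<^sup>+x. g' x \<partial>M) \<noteq> \<infinity>"
  proof -
    have "(\<integral>\<^sup>+x. g' x \<partial>M) = (\<integral>\<^sup>+x. g' x * indicator (space M) x \<partial>M)"
      by (rule nn_integral_cong) simp
    also have "\<dots> = ennreal (L (indicator (space M)))" by (rule g'_ind) simp
    finally show ?thesis by simp
  qed
  then have "AE x in M. g' x \<noteq> \<infinity>" by (intro nn_integral_PInf_AE) auto
  then have g_eq: "AE x in M. ennreal (g x) = g' x"
    by eventually_elim (simp add: g_def less_top)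
  have g_int: "integrable M g"
  proof (rule integrableI_nonneg)
    have "(\<integral>\<^sup>+x. ennreal (g x) \<partial>M) = (\<integral>\<^sup>+x. g' x \<partial>M)" using g_eq by (rule nn_integral_cong_AE)
    then show "(\<integral>\<^sup>+x. ennreal (g x) \<partial>M) < \<infinity>" using \<open>(\<integral>\<^sup>+x. g' x \<partial>M) \<noteq> \<infinity>\<close> by (simp add: less_top)
  qed (auto simp: g0)
  have ind: "L (indicator A) = (\<integral>x. g x * indicator A x \<partial>M)" if [measurable]: "A \<in> sets M" for A
  proof -
    have "ennreal (\<integral>x. g x * indicator A x \<partial>M) = (\<integral>\<^sup>+x. ennreal (g x * indicator A x) \<partial>M)"
      using g_int g0 that by (intro nn_integral_eq_integral[symmetric] integrable_mult_bounded[where c = 1])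
        (auto split: split_indicator)
    also have "\<dots> = (\<integral>\<^sup>+x. g' x * indicator A x \<partial>M)"
      using g_eq by (intro nn_integral_cong_AE) (auto split: split_indicator)
    finally show ?thesis
      using g'_ind[OF that] L_nonneg[OF adm_ind[OF that]] g0
      by (simp add: integral_nonneg_AE ennreal_inj)
  qed
  \<comment> \<open>\<open>L\<close> and integration against \<open>g\<close> agree on indicators, and both are linear and continuous
    under bounded monotone limits.\<close>
  have nonneg_case: "(\<exists>c. \<forall>x\<in>space M. \<phi> x \<le> c) \<longrightarrow> L \<phi> = (\<integral>x. g x * \<phi> x \<partial>M)"
    if "\<phi> \<in> borel_measurable M" "\<And>x. 0 \<le> \<phi> x" for \<phi> :: "'a \<Rightarrow> real"
    using that
  proof (induction rule: borel_measurable_induct_real)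
    case (set A)
    then show ?case by (simp add: ind)
  next
    case (mult u a)
    show ?case
    proof (cases "a = 0")
      case True
      then show ?thesis using L_add[OF adm_ind[of "{}"] adm_ind[of "{}"], of 0 0] by simp
    next
      case False
      show ?thesis
      proof
        assume "\<exists>c. \<forall>x\<in>space M. a * u x \<le> c"
        then obtain c where c: "\<And>x. x \<in> space M \<Longrightarrow> a * u x \<le> c" by blast
        have u: "u x \<le> c / a" if "x \<in> space M" for x
          using c[OF that] mult(1) False by (simp add: field_simps)
        then have "adm u (max 0 (c / a))" using mult by (auto simp: adm_def le_max_iff_disj)
        moreover have "\<exists>c. \<forall>x\<in>space M. u x \<le> c" using u by blast
        ultimately show "L (\<lambda>x. a * u x) = (\<integral>x. g x * (a * u x) \<partial>M)"
          using L_add[of u _ u _ a 0] mult by (auto simp: mult.left_commute)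
      qed
    qed
  next
    case (add u v)
    show ?case
    proof
      assume "\<exists>c. \<forall>x\<in>space M. v x + u x \<le> c"
      then obtain c where c: "\<And>x. x \<in> space M \<Longrightarrow> v x + u x \<le> c" by blast
      have uc: "u x \<le> c" "v x \<le> c" if "x \<in> space M" for x
        using c[OF that] add(2)[of x] add(4)[of x] by linarith+
      then have A: "adm v (max 0 c)" "adm u (max 0 c)"
        using add by (auto simp: adm_def le_max_iff_disj)
      have "integrable M (\<lambda>x. g x * u x)" "integrable M (\<lambda>x. g x * v x)"
        using A by (auto simp: adm_def intro!: integrable_mult_bounded[OF g_int])
      moreover have "L v = (\<integral>x. g x * v x \<partial>M)" "L u = (\<integral>x. g x * u x \<partial>M)"
        using add(6,7) uc by blast+
      ultimately show "L (\<lambda>x. v x + u x) = (\<integral>x. g x * (v x + u x) \<partial>M)"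
        using L_add[OF A, of 1 1] by (simp add: distrib_left)
    qed
  next
    case (seq U)
    show ?case
    proof
      assume "\<exists>c. \<forall>x\<in>space M. \<phi> x \<le> c"
      then obtain c where c: "\<And>x. x \<in> space M \<Longrightarrow> \<phi> x \<le> c" by blast
      have U_le: "U i x \<le> \<phi> x" if "x \<in> space M" for i x
        using seq(3) seq(4)[OF that] by (intro incseq_le) (auto simp: incseq_def le_fun_def)
      have A: "adm \<phi> (max 0 c)" "adm (U i) (max 0 c)" for i
      proof -
        have "\<bar>U i x\<bar> \<le> max 0 c" "\<bar>\<phi> x\<bar> \<le> max 0 c" if "x \<in> space M" for x
          using U_le[OF that, of i] seq(2)[of i x] c[OF that] by (simp_all add: abs_le_iff)
        then show "adm \<phi> (max 0 c)" "adm (U i) (max 0 c)"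
          using \<open>\<phi> \<in> borel_measurable M\<close> seq(1) by (auto simp: adm_def)
      qed
      have ptw: "x \<in> space M \<Longrightarrow> (\<lambda>i. 1 * \<phi> x + (- 1) * U i x) \<longlonglongrightarrow> 1 * \<phi> x + (- 1) * \<phi> x" for x
        using seq(4)[of x] by (intro tendsto_intros)
      have "(\<lambda>i. L (\<lambda>x. 1 * \<phi> x + (- 1) * U i x)) \<longlonglongrightarrow> 0"
      proof (rule L_cont)
        show "adm (\<lambda>x. 1 * \<phi> x + (- 1) * U i x) (max 0 c)" for i
        proof -
          have "\<bar>1 * \<phi> x + (- 1) * U i x\<bar> \<le> max 0 c" if "x \<in> space M" for x
            using U_le[OF that, of i] seq(2)[of i x] c[OF that] by (simp add: abs_le_iff)
          then show ?thesis using A(1) A(2)[of i] by (auto simp: adm_def)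
        qed
      qed (use ptw in simp)
      then have 1: "(\<lambda>i. L \<phi> - L (U i)) \<longlonglongrightarrow> 0"
        unfolding L_add[OF A] by simp
      have 2: "(\<lambda>i. \<integral>x. g x * U i x \<partial>M) \<longlonglongrightarrow> (\<integral>x. g x * \<phi> x \<partial>M)"
      proof (rule integral_dominated_convergence[where w = "\<lambda>x. max 0 c * g x"])
        show "AE x in M. norm (g x * U i x) \<le> max 0 c * g x" for i
          using A(2)[of i] g0 by (intro AE_I2) (auto simp: adm_def abs_mult mult.commute[of _ "g _"] intro!: mult_left_mono)
        show "AE x in M. (\<lambda>i. g x * U i x) \<longlonglongrightarrow> g x * \<phi> x"
          using seq(4) by (intro AE_I2 tendsto_intros)
      qed (use that seq(1) g_int in auto)
      have "L (U i) = (\<integral>x. g x * U i x \<partial>M)" for i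
        using seq(5)[of i] A(2)[of i] by (auto simp: adm_def abs_le_iff)
      then have "(\<lambda>i. L \<phi> - (\<integral>x. g x * U i x \<partial>M)) \<longlonglongrightarrow> 0" using 1 by simp
      then have "L \<phi> - (\<integral>x. g x * \<phi> x \<partial>M) = 0"
        by (rule LIMSEQ_unique[OF tendsto_diff[OF tendsto_const 2]])
      then show "L \<phi> = (\<integral>x. g x * \<phi> x \<partial>M)" by simp
    qed
  qed
  have repr: "L \<phi> = (\<integral>x. g x * \<phi> x \<partial>M)" if A: "adm \<phi> c" for \<phi> c
  proof -
    define P where "P x = max 0 (\<phi> x)" for x
    define Q where "Q x = max 0 (- \<phi> x)" for x
    have PQ: "adm P c" "adm Q c" "\<And>x. 0 \<le> P x" "\<And>x. 0 \<le> Q x"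
    proof -
      have "\<bar>max 0 (\<phi> x)\<bar> \<le> c" "\<bar>max 0 (- \<phi> x)\<bar> \<le> c" if "x \<in> space M" for x
        using A[unfolded adm_def] that by (auto simp: abs_le_iff dest: bspec[of _ _ x])
      then show "adm P c" "adm Q c" using A by (auto simp: adm_def P_def[abs_def] Q_def[abs_def])
    qed (auto simp: P_def Q_def)
    have eq: "\<phi> = (\<lambda>x. 1 * P x + (-1) * Q x)" by (auto simp: P_def Q_def)
    have "L P = (\<integral>x. g x * P x \<partial>M)" "L Q = (\<integral>x. g x * Q x \<partial>M)"
      using nonneg_case PQ by (auto simp: adm_def abs_le_iff)
    moreover have "integrable M (\<lambda>x. g x * P x)" "integrable M (\<lambda>x. g x * Q x)"
      using PQ by (auto simp: adm_def intro!: integrable_mult_bounded[OF g_int])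
    ultimately show ?thesis
      by (subst (1 2) eq) (subst L_add[OF PQ(1,2)], simp add: right_diff_distrib)
  qed
  show thesis
  proof (rule that[OF F' g_int allI[OF g0] g_meas], intro allI impI)
    fix \<phi> c assume "\<phi> \<in> borel_measurable M" "\<forall>x\<in>space M. \<bar>\<phi> x\<bar> \<le> (c::real)"
    then have A: "adm \<phi> (max 0 c)" by (simp add: adm_def le_max_iff_disj)
    show "((\<lambda>k. \<integral>x. f k x * \<phi> x \<partial>M) \<longlongrightarrow> (\<integral>x. g x * \<phi> x \<partial>M)) F'"
      using lim[of \<phi>] by (simp add: \<Lambda>_eq[OF A] repr[OF A])
  qed
qed

lemma nn_integral_exp_neg_abs_finite: "(\<integral>\<^sup>+t. ennreal (exp (- \<bar>t\<bar>)) \<partial>(lborel :: real measure)) < \<infinity>"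
proof -
  have half: "(\<integral>\<^sup>+t. ennreal (exp (- t)) * indicator {0..} t \<partial>(lborel :: real measure)) = ennreal (0 - (- exp (- 0)))"
  proof (rule nn_integral_FTC_atLeast)
    have "((\<lambda>t::real. - exp (- t)) \<longlongrightarrow> - 0) at_top"
      by (intro tendsto_minus filterlim_compose[OF exp_at_bot filterlim_uminus_at_bot_at_top])
    then show "((\<lambda>t::real. - exp (- t)) \<longlongrightarrow> 0) at_top" by simp
  qed (auto intro!: derivative_eq_intros)
  have "(\<integral>\<^sup>+t. ennreal (exp (- t)) * indicator {0..} t \<partial>(lborel :: real measure))
      = (\<integral>\<^sup>+t. ennreal (exp t) * indicator {..0} t \<partial>(lborel :: real measure))"
    by (subst nn_integral_real_affine[where c = "-1" and t = 0])
      (auto intro!: nn_integral_cong split: split_indicator)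
  with half have half': "(\<integral>\<^sup>+t. ennreal (exp t) * indicator {..0} t \<partial>(lborel :: real measure)) = 1"
    by simp
  have "(\<integral>\<^sup>+t. ennreal (exp (- \<bar>t\<bar>)) \<partial>(lborel :: real measure))
      \<le> (\<integral>\<^sup>+t. ennreal (exp (- t)) * indicator {0..} t + ennreal (exp t) * indicator {..0} t \<partial>lborel)"
    by (rule nn_integral_mono) (auto split: split_indicator)
  also have "\<dots> = 1 + 1"
    using half half' by (subst nn_integral_add) auto
  finally show ?thesis by (rule le_less_trans) simp
qed

text \<open>A weight that makes Lebesgue measure finite and is bounded below on bounded sets, so that a
  test function with bounded support stays bounded after division by the weight.\<close>

definition exp_weight :: "'a::euclidean_space \<Rightarrow> real" where
  "exp_weight x = (\<Prod>b\<in>Basis. exp (- \<bar>x \<bullet> b\<bar>))"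

lemma exp_weight_measurable[measurable]: "exp_weight \<in> borel_measurable borel"
  unfolding exp_weight_def[abs_def] by measurable

lemma exp_weight_bounds: "0 < exp_weight x" "exp_weight x \<le> 1"
  by (auto simp: exp_weight_def intro!: prod_pos prod_le_1)

lemma exp_weight_lower_bound:
  fixes x :: "'a::euclidean_space"
  assumes "norm x \<le> R"
  shows "exp (- R) ^ DIM('a) \<le> exp_weight x"
proof -
  have "(\<Prod>b\<in>(Basis::'a set). exp (- R)) \<le> exp_weight x"
    unfolding exp_weight_def
    by (rule prod_mono) (use assms Basis_le_norm order_trans in fastforce)
  then show ?thesis by simp
qed

lemma finite_measure_exp_weight: "finite_measure (density lborel (\<lambda>x::'a::euclidean_space. ennreal (exp_weight x)))"
proof
  have "(\<integral>\<^sup>+x. ennreal (exp_weight (x::'a)) \<partial>lborel) = (\<integral>\<^sup>+x. (\<Prod>b\<in>Basis. ennreal (exp (- \<bar>(x::'a) \<bullet> b\<bar>))) \<partial>lborel)"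
    by (simp add: exp_weight_def prod_ennreal)
  also have "\<dots> = (\<Prod>b\<in>(Basis::'a set). \<integral>\<^sup>+t. ennreal (exp (- \<bar>t\<bar>)) \<partial>lborel)"
    by (rule nn_integral_lborel_prod) auto
  also have "\<dots> < \<infinity>"
    using nn_integral_exp_neg_abs_finite by (simp add: power_less_top_ennreal)
  finally show "emeasure (density lborel (\<lambda>x::'a. ennreal (exp_weight x))) (space (density lborel (\<lambda>x::'a. ennreal (exp_weight x)))) \<noteq> \<infinity>"
    by (simp add: emeasure_density)
qed

text \<open>The weighted measure is finite and \<open>exp_weight \<le> 1\<close>, so the compactness for finite measures
  applies and yields convergence against \<open>\<phi> / exp_weight\<close>.  The bound for the limit \<open>g\<close> with
  respect to Lebesgue measure follows by integrating the tangent of \<open>a \<mapsto> a^p\<close> at the truncation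
  of \<open>g\<close> to the set \<open>S m\<close>: the tangent is an admissible test function against \<open>f\<^sub>k\<close>, and at the
  limit it touches \<open>g^p\<close>.\<close>

lemma weak_Lp_compactness:
  fixes f :: "'k \<Rightarrow> 'a::euclidean_space \<Rightarrow> real"
  assumes F: "F \<noteq> bot" and p: "1 < p"
    and f[measurable]: "\<And>k. f k \<in> borel_measurable borel" and f0: "\<And>k x. 0 \<le> f k x"
    and K: "\<And>k. (\<integral>\<^sup>+x. ennreal (f k x powr p) \<partial>lborel) \<le> ennreal K" "0 \<le> K"
  obtains F' g where "F' \<le> F" "F' \<noteq> bot" "g \<in> borel_measurable borel" "\<forall>x. 0 \<le> g x"
    "(\<integral>\<^sup>+x. ennreal (g x powr p) \<partial>lborel) \<le> ennreal K"
    "\<forall>\<phi> c. \<phi> \<in> borel_measurable borel \<longrightarrow> (\<forall>x. \<bar>\<phi> x\<bar> \<le> c) \<longrightarrow> bounded {x. \<phi> x \<noteq> 0} \<longrightarrow>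
       integrable lborel (\<lambda>x. g x * \<phi> x) \<and>
       ((\<lambda>k. \<integral>x. f k x * \<phi> x \<partial>lborel) \<longlongrightarrow> (\<integral>x. g x * \<phi> x \<partial>lborel)) F'"
proof -
  define M where "M = density lborel (\<lambda>x::'a. ennreal (exp_weight x))"
  have sets_M[measurable_cong, simp]: "sets M = sets borel" and space_M[simp]: "space M = UNIV"
    by (simp_all add: M_def)
  interpret M: finite_measure M unfolding M_def by (rule finite_measure_exp_weight)
  have f_M: "f k \<in> borel_measurable M" for k by measurable
  have K_M: "(\<integral>\<^sup>+x. ennreal (f k x powr p) \<partial>M) \<le> ennreal K" for k
  proof -
    have "(\<integral>\<^sup>+x. ennreal (f k x powr p) \<partial>M) = (\<integral>\<^sup>+x. ennreal (exp_weight x) * ennreal (f k x powr p) \<partial>lborel)"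
      unfolding M_def by (rule nn_integral_density) auto
    also have "\<dots> \<le> (\<integral>\<^sup>+x. ennreal (f k x powr p) \<partial>lborel)"
    proof (rule nn_integral_mono)
      fix x
      have "exp_weight x * f k x powr p \<le> 1 * f k x powr p"
        by (intro mult_right_mono exp_weight_bounds) auto
      then show "ennreal (exp_weight x) * ennreal (f k x powr p) \<le> ennreal (f k x powr p)"
        by (subst ennreal_mult''[symmetric]) (auto intro: ennreal_leI)
    qed
    finally show ?thesis using K(1)[of k] by (rule order_trans)
  qed
  obtain F' g where F': "F' \<le> F" "F' \<noteq> bot" and g_int: "integrable M g" and g_nonneg: "\<forall>x. 0 \<le> g x"
    and g_M: "g \<in> borel_measurable M"
    and lim: "\<forall>\<phi> c. \<phi> \<in> borel_measurable M \<longrightarrow> (\<forall>x\<in>space M. \<bar>\<phi> x\<bar> \<le> c) \<longrightarrow>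
       ((\<lambda>k. \<integral>x. f k x * \<phi> x \<partial>M) \<longlongrightarrow> (\<integral>x. g x * \<phi> x \<partial>M)) F'"
    by (rule M.weak_Lp_compactness_finite[OF F p f_M f0 K_M K(2)])
  have g0: "0 \<le> g x" for x using g_nonneg by simp
  have g[measurable]: "g \<in> borel_measurable borel" using g_M by (simp cong: measurable_cong_sets)
  have test: "integrable lborel (\<lambda>x. g x * \<phi> x)"
      "((\<lambda>k. \<integral>x. f k x * \<phi> x \<partial>lborel) \<longlongrightarrow> (\<integral>x. g x * \<phi> x \<partial>lborel)) F'"
    if \<phi>[measurable]: "\<phi> \<in> borel_measurable borel" and c: "\<And>x. \<bar>\<phi> x\<bar> \<le> c"
      and bdd: "bounded {x. \<phi> x \<noteq> 0}" for \<phi> c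
  proof -
    obtain R where R: "\<And>x. \<phi> x \<noteq> 0 \<Longrightarrow> norm x \<le> R" using bdd by (auto simp: bounded_iff)
    obtain \<delta> where \<delta>: "0 < \<delta>" and lower: "\<And>x. \<phi> x \<noteq> 0 \<Longrightarrow> \<delta> \<le> exp_weight x"
    proof
      show "0 < exp (- R) ^ DIM('a)" by (rule zero_less_power) (rule exp_gt_zero)
      show "\<phi> x \<noteq> 0 \<Longrightarrow> exp (- R) ^ DIM('a) \<le> exp_weight x" for x
        by (rule exp_weight_lower_bound[OF R])
    qed
    define \<psi> where "\<psi> x = \<phi> x / exp_weight x" for x
    have \<psi>[measurable]: "\<psi> \<in> borel_measurable borel" unfolding \<psi>_def[abs_def] by measurable
    have \<psi>_bound: "\<bar>\<psi> x\<bar> \<le> c / \<delta>" for x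
    proof (cases "\<phi> x = 0")
      case True
      then show ?thesis using c[of x] \<delta> by (simp add: \<psi>_def)
    next
      case False
      have "\<bar>\<phi> x\<bar> / exp_weight x \<le> c / \<delta>"
      proof (rule frac_le[OF _ c _ lower[OF False]])
        show "0 \<le> c" using c[of x] by linarith
        show "0 < \<delta>" by (rule \<delta>)
      qed
      then show ?thesis using exp_weight_bounds(1)[of x] by (simp only: \<psi>_def abs_div_pos)
    qed
    have eq: "exp_weight x *\<^sub>R (h x * \<psi> x) = h x * \<phi> x" for h :: "'a \<Rightarrow> real" and x
      using exp_weight_bounds(1)[of x] by (simp add: \<psi>_def)
    have nn: "AE x in lborel. 0 \<le> exp_weight (x::'a)"
      by (intro AE_I2 less_imp_le exp_weight_bounds(1))
    have change: "(\<integral>x. h x * \<psi> x \<partial>M) = (\<integral>x. h x * \<phi> x \<partial>lborel)" if [measurable]: "h \<in> borel_measurable borel" for h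
      unfolding M_def by (subst integral_density) (use nn in \<open>auto simp: eq[unfolded real_scaleR_def]\<close>)
    have "integrable M (\<lambda>x. g x * \<psi> x)"
      using \<psi>_bound by (intro integrable_mult_bounded[OF g_int]) auto
    then have "integrable lborel (\<lambda>x. exp_weight x *\<^sub>R (g x * \<psi> x))"
      unfolding M_def by (subst (asm) integrable_density) (use nn in auto)
    then show "integrable lborel (\<lambda>x. g x * \<phi> x)" by (simp only: eq)
    have "((\<lambda>k. \<integral>x. f k x * \<psi> x \<partial>M) \<longlongrightarrow> (\<integral>x. g x * \<psi> x \<partial>M)) F'"
      using lim[rule_format, of \<psi> "c / \<delta>"] \<psi>_bound by simp
    then show "((\<lambda>k. \<integral>x. f k x * \<phi> x \<partial>lborel) \<longlongrightarrow> (\<integral>x. g x * \<phi> x \<partial>lborel)) F'"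
      by (simp only: change[OF f] change[OF g])
  qed
  have fin: "(\<integral>\<^sup>+x. ennreal (f k x powr p) \<partial>lborel) < \<infinity>" for k
    using K(1)[of k] by (rule le_less_trans) simp
  have f_int: "integrable lborel (\<lambda>x. f k x powr p)" for k
    using fin[of k] by (intro integrableI_nonneg) auto
  have f_le: "(\<integral>x. f k x powr p \<partial>lborel) \<le> K" for k
  proof -
    have "ennreal (\<integral>x. f k x powr p \<partial>lborel) \<le> ennreal K"
      using K(1)[of k] by (subst nn_integral_eq_integral[symmetric, OF f_int]) auto
    then show ?thesis using K(2) by (simp add: ennreal_le_iff)
  qed
  define S where "S m = {x. norm x \<le> real m \<and> g x \<le> real m}" for m
  have S[measurable]: "S m \<in> sets borel" for m unfolding S_def by measurable
  have trunc: "(\<integral>\<^sup>+x. ennreal (g x powr p) * indicator (S m) x \<partial>lborel) \<le> ennreal K" for m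
  proof -
    \<comment> \<open>The slope of the tangent at the truncated \<open>g\<close>.\<close>
    define \<phi> where "\<phi> x = indicator (S m) x * (p * g x powr (p - 1))" for x
    define \<theta> where "\<theta> x = indicator (S m) x * g x powr (p - 1)" for x
    have S_bdd: "bounded (S m)" by (auto simp: S_def bounded_iff)
    have \<phi>[measurable]: "\<phi> \<in> borel_measurable borel" "\<theta> \<in> borel_measurable borel"
      unfolding \<phi>_def[abs_def] \<theta>_def[abs_def] by measurable
    have pw: "g x powr (p - 1) \<le> real m powr (p - 1)" if "x \<in> S m" for x
      using that g0 p by (intro powr_mono2) (auto simp: S_def)
    have b\<phi>: "\<bar>\<phi> x\<bar> \<le> p * real m powr (p - 1)" and b\<theta>: "\<bar>\<theta> x\<bar> \<le> real m powr (p - 1)" for x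
      using pw[of x] p by (auto simp: \<phi>_def \<theta>_def abs_mult split: split_indicator)
    have supp: "bounded {x. \<phi> x \<noteq> 0}" "bounded {x. \<theta> x \<noteq> 0}"
      by (rule bounded_subset[OF S_bdd], auto simp: \<phi>_def \<theta>_def split: split_indicator_asm)+
    have g_pow: "g x * \<theta> x = g x powr p * indicator (S m) x" "g x * \<phi> x = p * (g x powr p * indicator (S m) x)" for x
    proof -
      have pw1: "g x * g x powr (p - 1) = g x powr p"
        using powr_mult_base[of "g x" "p - 1"] g0[of x] by simp
      have "g x * \<theta> x = (g x * g x powr (p - 1)) * indicator (S m) x"
        unfolding \<theta>_def by (simp only: mult_ac)
      then show "g x * \<theta> x = g x powr p * indicator (S m) x" unfolding pw1 .
      have "g x * \<phi> x = p * ((g x * g x powr (p - 1)) * indicator (S m) x)"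
        unfolding \<phi>_def by (simp only: mult_ac)
      then show "g x * \<phi> x = p * (g x powr p * indicator (S m) x)" unfolding pw1 .
    qed
    have int_S: "integrable lborel (\<lambda>x. g x powr p * indicator (S m) x)"
      using test(1)[OF \<phi>(2) b\<theta> supp(2)] by (simp add: g_pow)
    define I where "I = (\<integral>x. g x powr p * indicator (S m) x \<partial>lborel)"
    have tangent: "f k x * \<phi> x - (p - 1) * (g x powr p * indicator (S m) x) \<le> f k x powr p" for k x
    proof (cases "x \<in> S m")
      case True
      have eq: "f k x * \<phi> x = p * g x powr (p - 1) * f k x"
        using True by (simp only: \<phi>_def indicator_simps mult_ac mult_1)
      show ?thesis
        unfolding eq using powr_ge_tangent[OF p f0[of k x] g0[of x]] True by simp
    qed (simp add: \<phi>_def)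
    have "(\<integral>x. f k x * \<phi> x \<partial>lborel) - (p - 1) * I \<le> K" for k
    proof -
      have int1: "integrable lborel (\<lambda>x. f k x * \<phi> x)"
      proof (rule Bochner_Integration.integrable_bound)
        show "integrable lborel (\<lambda>x. f k x powr p + (p - 1) * (g x powr p * indicator (S m) x))"
          using f_int int_S by simp
        show "AE x in lborel. norm (f k x * \<phi> x) \<le> norm (f k x powr p + (p - 1) * (g x powr p * indicator (S m) x))"
        proof (rule AE_I2)
          fix x
          have "0 \<le> f k x * \<phi> x" using f0[of k x] p by (simp add: \<phi>_def)
          moreover have "f k x * \<phi> x \<le> f k x powr p + (p - 1) * (g x powr p * indicator (S m) x)"
            using tangent[of k x] by linarith
          ultimately show "norm (f k x * \<phi> x) \<le> norm (f k x powr p + (p - 1) * (g x powr p * indicator (S m) x))"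
            unfolding real_norm_def by linarith
        qed
      qed measurable
      have "(\<integral>x. f k x * \<phi> x - (p - 1) * (g x powr p * indicator (S m) x) \<partial>lborel) \<le> (\<integral>x. f k x powr p \<partial>lborel)"
      proof (rule integral_mono)
        fix x
        show "f k x * \<phi> x - (p - 1) * (g x powr p * indicator (S m) x) \<le> f k x powr p"
          by (rule tangent)
      qed (use int1 int_S f_int in auto)
      then show ?thesis using int1 int_S f_le[of k] by (simp add: I_def)
    qed
    moreover have "((\<lambda>k. (\<integral>x. f k x * \<phi> x \<partial>lborel) - (p - 1) * I) \<longlongrightarrow> (\<integral>x. g x * \<phi> x \<partial>lborel) - (p - 1) * I) F'"
      by (intro tendsto_diff tendsto_const test(2)[OF \<phi>(1) b\<phi> supp(1)])
    ultimately have "(\<integral>x. g x * \<phi> x \<partial>lborel) - (p - 1) * I \<le> K"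
      by (intro tendsto_upperbound[OF _ always_eventually F'(2)]) auto
    moreover have "(\<integral>x. g x * \<phi> x \<partial>lborel) = p * I"
      by (simp only: g_pow I_def integral_mult_right_zero)
    ultimately have "I \<le> K" by (simp add: left_diff_distrib)
    have "(\<integral>\<^sup>+x. ennreal (g x powr p) * indicator (S m) x \<partial>lborel)
        = (\<integral>\<^sup>+x. ennreal (g x powr p * indicator (S m) x) \<partial>lborel)"
      by (intro nn_integral_cong) (auto split: split_indicator)
    also have "\<dots> = ennreal I"
      unfolding I_def by (rule nn_integral_eq_integral[OF int_S]) auto
    also have "\<dots> \<le> ennreal K" using \<open>I \<le> K\<close> by (rule ennreal_leI)
    finally show ?thesis .
  qed
  have "(\<integral>\<^sup>+x. ennreal (g x powr p) \<partial>lborel) = (\<integral>\<^sup>+x. (SUP m. ennreal (g x powr p) * indicator (S m) x) \<partial>lborel)"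
  proof (rule nn_integral_cong)
    fix x
    obtain m :: nat where "max (norm x) (g x) \<le> real m" using real_arch_simple by blast
    then have "ennreal (g x powr p) = ennreal (g x powr p) * indicator (S m) x" by (simp add: S_def)
    then have "ennreal (g x powr p) \<le> (SUP m. ennreal (g x powr p) * indicator (S m) x)"
      by (metis SUP_upper UNIV_I)
    moreover have "(SUP m. ennreal (g x powr p) * indicator (S m) x) \<le> ennreal (g x powr p)"
      by (rule SUP_least) (auto split: split_indicator)
    ultimately show "ennreal (g x powr p) = (SUP m. ennreal (g x powr p) * indicator (S m) x)" by (rule antisym)
  qed
  also have "\<dots> = (SUP m. \<integral>\<^sup>+x. ennreal (g x powr p) * indicator (S m) x \<partial>lborel)"
    by (rule nn_integral_monotone_convergence_SUP)
      (auto simp: incseq_def le_fun_def S_def split: split_indicator)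
  also have "\<dots> \<le> ennreal K" by (rule SUP_least) (rule trunc)
  finally have gK: "(\<integral>\<^sup>+x. ennreal (g x powr p) \<partial>lborel) \<le> ennreal K" .
  show thesis
  proof (rule that[OF F' g _ gK])
    show "\<forall>x. 0 \<le> g x" using g0 by simp
    show "\<forall>\<phi> c. \<phi> \<in> borel_measurable borel \<longrightarrow> (\<forall>x. \<bar>\<phi> x\<bar> \<le> c) \<longrightarrow> bounded {x. \<phi> x \<noteq> 0} \<longrightarrow>
       integrable lborel (\<lambda>x. g x * \<phi> x) \<and>
       ((\<lambda>k. \<integral>x. f k x * \<phi> x \<partial>lborel) \<longlongrightarrow> (\<integral>x. g x * \<phi> x \<partial>lborel)) F'"
    proof (intro allI impI)
      fix \<phi> :: "'a \<Rightarrow> real" and c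
      assume "\<phi> \<in> borel_measurable borel" "\<forall>x. \<bar>\<phi> x\<bar> \<le> (c::real)" "bounded {x. \<phi> x \<noteq> 0}"
      with test[of \<phi> c] show "integrable lborel (\<lambda>x. g x * \<phi> x) \<and>
          ((\<lambda>k. \<integral>x. f k x * \<phi> x \<partial>lborel) \<longlongrightarrow> (\<integral>x. g x * \<phi> x \<partial>lborel)) F'"
        by simp
    qed
  qed
qed

section \<open>Translation increments and the trace energy\<close>

lemma emeasure_ball_eq_measure:
  fixes e :: "'a::euclidean_space"
  shows "emeasure lborel (ball e \<rho>) = ennreal (measure lborel (ball e \<rho>))"
  using emeasure_lborel_ball_finite[of e \<rho>] by (simp add: emeasure_eq_ennreal_measure less_top)

lemma nn_integral_lborel_affine:
  fixes f :: "'a::euclidean_space \<Rightarrow> ennreal"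
  assumes [measurable]: "f \<in> borel_measurable borel" and c: "c \<noteq> 0"
  shows "(\<integral>\<^sup>+x. f x \<partial>lborel) = ennreal (\<bar>c\<bar> ^ DIM('a)) * (\<integral>\<^sup>+x. f (t + c *\<^sub>R x) \<partial>lborel)"
  by (subst lborel_affine[OF c, of t])
    (simp add: nn_integral_density nn_integral_distr nn_integral_cmult ennreal_power)

lemma nn_integral_lborel_translate:
  fixes f :: "'a::euclidean_space \<Rightarrow> ennreal"
  assumes "f \<in> borel_measurable borel"
  shows "(\<integral>\<^sup>+x. f (t + x) \<partial>lborel) = (\<integral>\<^sup>+x. f x \<partial>lborel)"
  using nn_integral_lborel_affine[OF assms, of 1 t] by simp

text \<open>The constant \<open>2^(p - 1)\<close> is sharp, and that matters: it makes the constant in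
  \<open>increment_energy_double\<close> equal to \<open>2^p\<close>, the scaling of a function with a gradient in Lp.\<close>

lemma powr_add_le:
  fixes a b p :: real
  assumes "1 < p"
  shows "\<bar>a + b\<bar> powr p \<le> 2 powr (p - 1) * (\<bar>a\<bar> powr p + \<bar>b\<bar> powr p)"
proof -
  define c where "c = (\<bar>a\<bar> + \<bar>b\<bar>) / 2"
  have c0: "0 \<le> c" by (simp add: c_def)
  have "c * c powr (p - 1) = c powr p"
    using powr_mult_base[OF c0, of "p - 1"] by simp
  moreover have "p * c powr (p - 1) * \<bar>a\<bar> + p * c powr (p - 1) * \<bar>b\<bar> = 2 * (p * (c * c powr (p - 1)))"
  proof -
    have "p * c powr (p - 1) * \<bar>a\<bar> + p * c powr (p - 1) * \<bar>b\<bar> = p * c powr (p - 1) * (\<bar>a\<bar> + \<bar>b\<bar>)"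
      by (simp only: distrib_left)
    also have "\<bar>a\<bar> + \<bar>b\<bar> = 2 * c" by (simp add: c_def)
    finally show ?thesis by simp
  qed
  moreover have "p * c powr (p - 1) * \<bar>a\<bar> - (p - 1) * c powr p \<le> \<bar>a\<bar> powr p"
    "p * c powr (p - 1) * \<bar>b\<bar> - (p - 1) * c powr p \<le> \<bar>b\<bar> powr p"
    using assms c0 by (auto intro: powr_ge_tangent)
  ultimately have mid: "2 * c powr p \<le> \<bar>a\<bar> powr p + \<bar>b\<bar> powr p"
    by (simp add: left_diff_distrib)
  have "2 * c = \<bar>a\<bar> + \<bar>b\<bar>" by (simp add: c_def)
  then have "\<bar>a + b\<bar> powr p \<le> (2 * c) powr p"
    using assms abs_triangle_ineq[of a b] by (intro powr_mono2) auto
  also have "\<dots> = 2 powr (p - 1) * (2 * c powr p)"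
    using c0 by (simp add: powr_mult powr_diff)
  also have "\<dots> \<le> 2 powr (p - 1) * (\<bar>a\<bar> powr p + \<bar>b\<bar> powr p)"
    using mid by (intro mult_left_mono) auto
  finally show ?thesis .
qed

definition increment_energy :: "real \<Rightarrow> ('a::euclidean_space \<Rightarrow> real) \<Rightarrow> 'a \<Rightarrow> ennreal" where
  "increment_energy p v z = (\<integral>\<^sup>+x. ennreal (\<bar>v (x + z) - v x\<bar> powr p) \<partial>lborel)"

lemma increment_energy_measurable[measurable]:
  assumes [measurable]: "v \<in> borel_measurable borel"
  shows "increment_energy p v \<in> borel_measurable borel"
  unfolding increment_energy_def[abs_def] by measurable

text \<open>The increment over \<open>2 z\<close> is the sum of two increments over \<open>z\<close>, which have the same integral
  by translation invariance.\<close>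

lemma increment_energy_double:
  fixes v :: "'a::euclidean_space \<Rightarrow> real"
  assumes [measurable]: "v \<in> borel_measurable borel" and p: "1 < p"
  shows "increment_energy p v (2 *\<^sub>R z) \<le> ennreal (2 powr p) * increment_energy p v z"
proof -
  let ?d = "\<lambda>x. ennreal (\<bar>v (x + z) - v x\<bar> powr p)"
  have "increment_energy p v (2 *\<^sub>R z) \<le> (\<integral>\<^sup>+x. ennreal (2 powr (p - 1)) * (?d (z + x) + ?d x) \<partial>lborel)"
    unfolding increment_energy_def
  proof (rule nn_integral_mono)
    fix x
    have "\<bar>v (x + 2 *\<^sub>R z) - v x\<bar> powr p
        \<le> 2 powr (p - 1) * (\<bar>v (z + x + z) - v (z + x)\<bar> powr p + \<bar>v (x + z) - v x\<bar> powr p)"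
      using powr_add_le[OF p, of "v (z + x + z) - v (z + x)" "v (x + z) - v x"]
      by (simp add: algebra_simps scaleR_2)
    then show "ennreal (\<bar>v (x + 2 *\<^sub>R z) - v x\<bar> powr p) \<le> ennreal (2 powr (p - 1)) * (?d (z + x) + ?d x)"
      by (simp add: ennreal_mult''[symmetric] ennreal_plus[symmetric] ennreal_leI del: ennreal_plus)
  qed
  also have "\<dots> = ennreal (2 powr (p - 1)) * (increment_energy p v z + increment_energy p v z)"
    using nn_integral_lborel_translate[of ?d z]
    by (simp add: nn_integral_cmult nn_integral_add increment_energy_def)
  also have "\<dots> = ennreal (2 powr p) * increment_energy p v z"
    by (simp add: mult_2[symmetric] mult.assoc[symmetric] powr_diff
        flip: ennreal_numeral ennreal_mult'')
  finally show ?thesis .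
qed

text \<open>The increments are averaged over directions close to \<open>e\<close>.  The radius 1/3 keeps the length of
  \<open>h\<close> away from 0 and leaves \<open>e\<close> as the mean of the ball.\<close>

definition mean_increment :: "real \<Rightarrow> ('a::euclidean_space \<Rightarrow> real) \<Rightarrow> 'a \<Rightarrow> real \<Rightarrow> ennreal" where
  "mean_increment p v e t = (\<integral>\<^sup>+h\<in>ball e (1/3). increment_energy p v (t *\<^sub>R h) \<partial>lborel)"

lemma mean_increment_scale:
  fixes v :: "'a::euclidean_space \<Rightarrow> real"
  assumes [measurable]: "v \<in> borel_measurable borel" and p: "1 < p"
  shows "mean_increment p v e t \<le> ennreal ((2 ^ m) powr p) * mean_increment p v e (t / 2 ^ m)"
proof (induction m)
  case (Suc m)
  have "mean_increment p v e (t / 2 ^ m) \<le> ennreal (2 powr p) * mean_increment p v e (t / 2 ^ Suc m)"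
  proof -
    have [measurable]: "ball e (1/3) \<in> sets borel" by simp
    have cmult: "ennreal (2 powr p) * mean_increment p v e (t / 2 ^ Suc m) =
        (\<integral>\<^sup>+h. ennreal (2 powr p) * (increment_energy p v ((t / 2 ^ Suc m) *\<^sub>R h) * indicator (ball e (1/3)) h) \<partial>lborel)"
      unfolding mean_increment_def by (rule nn_integral_cmult[symmetric]) measurable
    show ?thesis
      unfolding cmult unfolding mean_increment_def
    proof (rule nn_integral_mono)
      fix h
      have "increment_energy p v ((t / 2 ^ m) *\<^sub>R h) \<le> ennreal (2 powr p) * increment_energy p v ((t / 2 ^ Suc m) *\<^sub>R h)"
        using increment_energy_double[OF assms, of "(t / 2 ^ Suc m) *\<^sub>R h"] by simp
      then show "increment_energy p v ((t / 2 ^ m) *\<^sub>R h) * indicator (ball e (1 / 3)) h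
         \<le> ennreal (2 powr p) * (increment_energy p v ((t / 2 ^ Suc m) *\<^sub>R h) * indicator (ball e (1 / 3)) h)"
        by (auto split: split_indicator)
    qed
  qed
  then have "mean_increment p v e t \<le> ennreal ((2 ^ m) powr p) * (ennreal (2 powr p) * mean_increment p v e (t / 2 ^ Suc m))"
    by (intro order_trans[OF Suc.IH] mult_left_mono) auto
  also have "\<dots> = ennreal ((2 ^ Suc m) powr p) * mean_increment p v e (t / 2 ^ Suc m)"
    by (simp add: mult.assoc[symmetric] ennreal_mult''[symmetric] powr_mult mult.commute)
  finally show ?case .
qed simp

text \<open>The part of the energy in which the interior point sits at the fixed position \<open>t \<eta>\<close> relative to
  the boundary point.\<close>

definition slice_energy ::
    "real \<Rightarrow> ('a::euclidean_space \<times> real \<Rightarrow> real) \<Rightarrow> ('a \<Rightarrow> real) \<Rightarrow> real \<Rightarrow> 'a \<times> real \<Rightarrow> ennreal" where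
  "slice_energy p u v t \<eta> = (\<integral>\<^sup>+x. ennreal (\<bar>v x - u ((x, 0) + t *\<^sub>R \<eta>)\<bar> powr p) \<partial>lborel)"

lemma slice_energy_measurable[measurable]:
  assumes [measurable]: "v \<in> borel_measurable borel" "u \<in> borel_measurable borel"
  shows "slice_energy p u v t \<in> borel_measurable borel"
  unfolding slice_energy_def[abs_def] by measurable

text \<open>Both \<open>v x\<close> and \<open>v (x + t h)\<close> are compared with the value of \<open>u\<close> at the point with position
  \<open>t \<eta>\<close> relative to \<open>x\<close>; relative to \<open>x + t h\<close> its position is \<open>t (\<eta> - (h, 0))\<close>.\<close>

lemma increment_le_slice_energy:
  fixes v :: "'a::euclidean_space \<Rightarrow> real"
  assumes [measurable]: "v \<in> borel_measurable borel" "u \<in> borel_measurable borel" and p: "1 < p"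
  shows "increment_energy p v (t *\<^sub>R h)
    \<le> ennreal (2 powr (p - 1)) * (slice_energy p u v t \<eta> + slice_energy p u v t (\<eta> - (h, 0)))"
proof -
  let ?a = "\<lambda>x. ennreal (\<bar>v x - u ((x, 0) + t *\<^sub>R \<eta>)\<bar> powr p)"
  let ?b = "\<lambda>x. ennreal (\<bar>v x - u ((x, 0) + t *\<^sub>R (\<eta> - (h, 0)))\<bar> powr p)"
  have "increment_energy p v (t *\<^sub>R h) \<le> (\<integral>\<^sup>+x. ennreal (2 powr (p - 1)) * (?a x + ?b (t *\<^sub>R h + x)) \<partial>lborel)"
    unfolding increment_energy_def
  proof (rule nn_integral_mono)
    fix x
    have eq: "(t *\<^sub>R h + x, 0) + t *\<^sub>R (\<eta> - (h, 0)) = (x, 0) + t *\<^sub>R \<eta>"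
      by (cases \<eta>) (simp add: algebra_simps)
    have "\<bar>v (x + t *\<^sub>R h) - v x\<bar> powr p
        \<le> 2 powr (p - 1) * (\<bar>u ((x, 0) + t *\<^sub>R \<eta>) - v x\<bar> powr p + \<bar>v (x + t *\<^sub>R h) - u ((x, 0) + t *\<^sub>R \<eta>)\<bar> powr p)"
      using powr_add_le[OF p, of "u ((x, 0) + t *\<^sub>R \<eta>) - v x" "v (x + t *\<^sub>R h) - u ((x, 0) + t *\<^sub>R \<eta>)"]
      by simp
    then show "ennreal (\<bar>v (x + t *\<^sub>R h) - v x\<bar> powr p) \<le> ennreal (2 powr (p - 1)) * (?a x + ?b (t *\<^sub>R h + x))"
      unfolding eq
      by (simp add: ennreal_mult''[symmetric] ennreal_plus[symmetric] ennreal_leI abs_minus_commute add.commute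
          del: ennreal_plus)
  qed
  also have "\<dots> = ennreal (2 powr (p - 1)) * (slice_energy p u v t \<eta> + slice_energy p u v t (\<eta> - (h, 0)))"
    using nn_integral_lborel_translate[of ?b "t *\<^sub>R h"]
    by (simp add: nn_integral_cmult nn_integral_add slice_energy_def)
  finally show ?thesis .
qed

definition half_annulus :: "real \<Rightarrow> ('a::euclidean_space \<times> real) set" where
  "half_annulus t = {\<eta>. 0 < snd \<eta> \<and> t < norm \<eta> \<and> norm \<eta> < 4 * t}"

lemma half_annulus_measurable[measurable]: "half_annulus t \<in> sets borel"
proof -
  have "open (half_annulus t :: ('a \<times> real) set)"
    unfolding half_annulus_def
    by (intro open_Collect_conj open_Collect_less continuous_intros)
  then show ?thesis by simp
qed

definition annulus_energy ::
    "real \<Rightarrow> ('a::euclidean_space \<times> real \<Rightarrow> real) \<Rightarrow> ('a \<Rightarrow> real) \<Rightarrow> real \<Rightarrow> ennreal" where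
  "annulus_energy p u v t = (\<integral>\<^sup>+\<eta>\<in>half_annulus 1. slice_energy p u v t \<eta> \<partial>lborel)"

text \<open>The position \<open>(0, 2)\<close> is high enough above the boundary that the whole ball around it stays in
  the half annulus between the radii 1 and 4 after a horizontal shift by \<open>h\<close>.  The ratio 4 of the
  radii is what makes the annuli at the scales \<open>r / 4^k\<close> disjoint.\<close>

lemma half_annulus_shift:
  fixes e h :: "'a::euclidean_space"
  assumes e: "norm e = 1" and h: "h \<in> ball e (1/3)" and \<eta>: "\<eta> \<in> ball (0, 2) (1/2)"
  shows "\<eta> \<in> half_annulus 1" "\<eta> - (h, 0) \<in> half_annulus 1"
proof -
  have snd_le: "\<bar>snd z\<bar> \<le> norm z" for z :: "'a \<times> real"
    using norm_snd_le[of "snd z" "fst z"] by simp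
  have d: "norm (\<eta> - (0, 2)) < 1/2" using \<eta> by (simp add: dist_norm norm_minus_commute)
  then have "\<bar>snd \<eta> - 2\<bar> < 1/2"
    using snd_le[of "\<eta> - (0, 2)"] by simp
  then have s: "3/2 < snd \<eta>" unfolding abs_less_iff by linarith
  have n: "norm \<eta> < 5/2"
    using norm_triangle_ineq[of "\<eta> - (0, 2)" "(0, 2)"] d by (simp add: norm_Pair)
  have "norm h < 4/3"
    using norm_triangle_ineq[of "h - e" e] h e by (simp add: dist_norm norm_minus_commute)
  then have n': "norm (\<eta> - (h, 0)) < 4"
    using norm_triangle_ineq4[of \<eta> "(h, 0)"] n by (simp add: norm_Pair)
  have "snd \<eta> \<le> norm \<eta>" "snd \<eta> \<le> norm (\<eta> - (h, 0))"
    using snd_le[of \<eta>] snd_le[of "\<eta> - (h, 0)"] by auto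
  then show "\<eta> \<in> half_annulus 1" "\<eta> - (h, 0) \<in> half_annulus 1"
    using s n n' by (auto simp: half_annulus_def)
qed

text \<open>Averaging \<open>increment_le_slice_energy\<close> over \<open>\<eta>\<close> in the ball around \<open>(0, 2)\<close> and over \<open>h\<close>.\<close>

lemma mean_increment_le_annulus_energy:
  fixes v :: "'a::euclidean_space \<Rightarrow> real" and u :: "'a \<times> real \<Rightarrow> real"
  assumes [measurable]: "v \<in> borel_measurable borel" "u \<in> borel_measurable borel"
    and p: "1 < p" and e: "norm e = 1"
  shows "emeasure lborel (ball (0::'a, 2::real) (1/2)) * mean_increment p v e t
    \<le> ennreal (2 powr p) * emeasure lborel (ball e (1/3)) * annulus_energy p u v t"
proof -
  let ?Y = "ball (0::'a, 2::real) (1/2)" and ?B = "ball e (1/3)"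
  have [measurable]: "ball e (1/3) \<in> sets borel" by simp
  let ?s = "slice_energy p u v t" and ?A = "annulus_energy p u v t"
  have inner: "emeasure lborel ?Y * increment_energy p v (t *\<^sub>R h) \<le> ennreal (2 powr p) * ?A"
    if h: "h \<in> ?B" for h
  proof -
    have "emeasure lborel ?Y * increment_energy p v (t *\<^sub>R h)
        = (\<integral>\<^sup>+\<eta>. increment_energy p v (t *\<^sub>R h) * indicator ?Y \<eta> \<partial>lborel)"
      by (subst nn_integral_cmult_indicator) (auto simp: mult.commute)
    also have "\<dots> \<le> (\<integral>\<^sup>+\<eta>. ennreal (2 powr (p - 1)) *
        (?s \<eta> * indicator (half_annulus 1) \<eta>
          + ?s (\<eta> - (h, 0)) * indicator (half_annulus 1) (\<eta> - (h, 0))) \<partial>lborel)"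
    proof (rule nn_integral_mono)
      fix \<eta> :: "'a \<times> real"
      show "increment_energy p v (t *\<^sub>R h) * indicator ?Y \<eta> \<le> ennreal (2 powr (p - 1)) *
        (?s \<eta> * indicator (half_annulus 1) \<eta>
          + ?s (\<eta> - (h, 0)) * indicator (half_annulus 1) (\<eta> - (h, 0)))"
        using half_annulus_shift[OF e h, of \<eta>]
          increment_le_slice_energy[OF assms(1,2) p, of t h \<eta>]
        by (cases "\<eta> \<in> ?Y") simp_all
    qed
    also have "\<dots> = ennreal (2 powr (p - 1)) * (?A + ?A)"
    proof -
      have shift: "\<eta> - (h, 0) = (- h, 0) + \<eta>" for \<eta> :: "'a \<times> real" by (cases \<eta>) simp
      have "(\<integral>\<^sup>+\<eta>. ?s (\<eta> - (h, 0)) * indicator (half_annulus 1) (\<eta> - (h, 0)) \<partial>lborel) = ?A"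
        unfolding shift annulus_energy_def
        by (rule nn_integral_lborel_translate[of "\<lambda>\<eta>. ?s \<eta> * indicator (half_annulus 1) \<eta>"]) measurable
      then show ?thesis
        by (simp add: nn_integral_cmult nn_integral_add annulus_energy_def)
    qed
    also have "\<dots> = ennreal (2 powr p) * ?A"
      by (simp add: mult_2[symmetric] mult.assoc[symmetric] powr_diff flip: ennreal_numeral ennreal_mult'')
    finally show ?thesis .
  qed
  have "emeasure lborel ?Y * mean_increment p v e t
      = (\<integral>\<^sup>+h\<in>?B. emeasure lborel ?Y * increment_energy p v (t *\<^sub>R h) \<partial>lborel)"
    unfolding mean_increment_def mult.assoc by (rule nn_integral_cmult[symmetric]) measurable
  also have "\<dots> \<le> (\<integral>\<^sup>+h\<in>?B. ennreal (2 powr p) * ?A \<partial>lborel)"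
    by (rule nn_integral_mono) (use inner in \<open>auto split: split_indicator\<close>)
  also have "\<dots> = ennreal (2 powr p) * emeasure lborel ?B * ?A"
    by (subst nn_integral_cmult_indicator) (auto simp: mult_ac)
  finally show ?thesis .
qed

text \<open>The substitution \<open>\<zeta> = t \<eta>\<close> gives a factor \<open>t^N\<close>, and on the annulus the kernel is at least
  \<open>t^(- N - s p)\<close> up to a constant that is uniform in \<open>s\<close>.\<close>

lemma scaled_annulus_energy_le:
  fixes v :: "'a::euclidean_space \<Rightarrow> real" and u :: "'a \<times> real \<Rightarrow> real"
  assumes [measurable]: "v \<in> borel_measurable borel" "u \<in> borel_measurable borel"
    and p: "1 < p" and s: "0 < s" "s < 1" and t: "0 < t" and N: "N = DIM('a) + 1"
  shows "ennreal (t powr (- (s * p)) * 4 powr (- (real N + p))) * annulus_energy p u v t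
    \<le> (\<integral>\<^sup>+x. (\<integral>\<^sup>+\<zeta>\<in>half_annulus t.
         ennreal (\<bar>v x - u ((x, 0) + \<zeta>)\<bar> powr p / norm \<zeta> powr (real N + s * p)) \<partial>lborel) \<partial>lborel)"
proof -
  let ?w = "t powr (- (real N + s * p)) * 4 powr (- (real N + p))"
  let ?d = "\<lambda>x \<eta>. ennreal (\<bar>v x - u ((x, 0) + t *\<^sub>R \<eta>)\<bar> powr p)"
  have weight: "?w \<le> 1 / norm (t *\<^sub>R \<eta>) powr (real N + s * p)"
    if \<eta>: "\<eta> \<in> half_annulus 1" for \<eta> :: "'a \<times> real"
  proof -
    have n: "1 < norm \<eta>" "norm \<eta> < 4" using \<eta> by (auto simp: half_annulus_def)
    have "norm \<eta> powr (real N + s * p) \<le> 4 powr (real N + s * p)"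
      using n s p by (intro powr_mono2) auto
    also have "\<dots> \<le> 4 powr (real N + p)"
      using s p by (intro powr_mono) (auto simp: mult_left_le_one_le)
    finally have "t powr (real N + s * p) * norm \<eta> powr (real N + s * p)
        \<le> t powr (real N + s * p) * 4 powr (real N + p)"
      by (intro mult_left_mono) auto
    then have "1 / (t powr (real N + s * p) * 4 powr (real N + p))
        \<le> 1 / (t powr (real N + s * p) * norm \<eta> powr (real N + s * p))"
    proof (intro divide_left_mono mult_pos_pos)
      have "norm \<eta> \<noteq> 0" using n by linarith
      then show "0 < norm \<eta> powr (real N + s * p)" by (simp only: powr_gt_zero not_False_eq_True simp_thms)
    qed (use t in auto)
    moreover have "?w = 1 / (t powr (real N + s * p) * 4 powr (real N + p))"
      by (simp only: powr_minus inverse_mult_distrib divide_inverse mult_1)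
    moreover have "norm (t *\<^sub>R \<eta>) powr (real N + s * p) = t powr (real N + s * p) * norm \<eta> powr (real N + s * p)"
      using t by (simp add: powr_mult)
    ultimately show ?thesis by simp
  qed
  have "ennreal (t powr (- (s * p)) * 4 powr (- (real N + p))) * annulus_energy p u v t
      = ennreal (t ^ N * ?w) * annulus_energy p u v t"
  proof -
    have "t powr (- (s * p)) = t ^ N * t powr (- (real N + s * p))"
      using t by (simp add: powr_realpow[symmetric] powr_add[symmetric])
    then show ?thesis by (simp add: mult.assoc)
  qed
  also have "\<dots> = ennreal (t ^ N) * (\<integral>\<^sup>+\<eta>. ennreal ?w * (slice_energy p u v t \<eta> * indicator (half_annulus 1) \<eta>) \<partial>lborel)"
    using t unfolding annulus_energy_def
    by (subst nn_integral_cmult) (auto simp: ennreal_mult mult.assoc)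
  also have "(\<integral>\<^sup>+\<eta>. ennreal ?w * (slice_energy p u v t \<eta> * indicator (half_annulus 1) \<eta>) \<partial>lborel)
      = (\<integral>\<^sup>+\<eta>. (\<integral>\<^sup>+x. ennreal ?w * (?d x \<eta> * indicator (half_annulus 1) \<eta>) \<partial>lborel) \<partial>lborel)"
    unfolding slice_energy_def
    by (intro nn_integral_cong) (simp add: nn_integral_cmult nn_integral_multc)
  also have "\<dots> = (\<integral>\<^sup>+x. (\<integral>\<^sup>+\<eta>. ennreal ?w * (?d x \<eta> * indicator (half_annulus 1) \<eta>) \<partial>lborel) \<partial>lborel)"
    by (rule lborel_pair.Fubini') measurable
  also have "ennreal (t ^ N) * \<dots>
      = (\<integral>\<^sup>+x. ennreal (t ^ N) * (\<integral>\<^sup>+\<eta>. ennreal ?w * (?d x \<eta> * indicator (half_annulus 1) \<eta>) \<partial>lborel) \<partial>lborel)"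
    by (rule nn_integral_cmult[symmetric]) measurable
  also have "\<dots> \<le> (\<integral>\<^sup>+x. (\<integral>\<^sup>+\<zeta>\<in>half_annulus t.
         ennreal (\<bar>v x - u ((x, 0) + \<zeta>)\<bar> powr p / norm \<zeta> powr (real N + s * p)) \<partial>lborel) \<partial>lborel)"
  proof (rule nn_integral_mono)
    fix x
    have ann: "indicator (half_annulus t) (t *\<^sub>R \<eta>) = (indicator (half_annulus 1) \<eta> :: ennreal)" for \<eta> :: "'a \<times> real"
      using t by (auto simp: half_annulus_def zero_less_mult_iff split: split_indicator)
    have "(\<integral>\<^sup>+\<zeta>\<in>half_annulus t. ennreal (\<bar>v x - u ((x, 0) + \<zeta>)\<bar> powr p / norm \<zeta> powr (real N + s * p)) \<partial>lborel)
        = ennreal (t ^ N) * (\<integral>\<^sup>+\<eta>. ennreal (\<bar>v x - u ((x, 0) + t *\<^sub>R \<eta>)\<bar> powr p / norm (t *\<^sub>R \<eta>) powr (real N + s * p))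
            * indicator (half_annulus 1) \<eta> \<partial>lborel)"
      using t N by (subst nn_integral_lborel_affine[where c = t and t = 0]) (auto simp: ann)
    moreover have "(\<integral>\<^sup>+\<eta>. ennreal ?w * (?d x \<eta> * indicator (half_annulus 1) \<eta>) \<partial>lborel)
        \<le> (\<integral>\<^sup>+\<eta>. ennreal (\<bar>v x - u ((x, 0) + t *\<^sub>R \<eta>)\<bar> powr p / norm (t *\<^sub>R \<eta>) powr (real N + s * p))
            * indicator (half_annulus 1) \<eta> \<partial>lborel)"
    proof (rule nn_integral_mono)
      fix \<eta> :: "'a \<times> real"
      show "ennreal ?w * (?d x \<eta> * indicator (half_annulus 1) \<eta>)
        \<le> ennreal (\<bar>v x - u ((x, 0) + t *\<^sub>R \<eta>)\<bar> powr p / norm (t *\<^sub>R \<eta>) powr (real N + s * p)) * indicator (half_annulus 1) \<eta>"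
      proof (cases "\<eta> \<in> half_annulus 1")
        case True
        have "?w * \<bar>v x - u ((x, 0) + t *\<^sub>R \<eta>)\<bar> powr p
            \<le> 1 / norm (t *\<^sub>R \<eta>) powr (real N + s * p) * \<bar>v x - u ((x, 0) + t *\<^sub>R \<eta>)\<bar> powr p"
          by (rule mult_right_mono[OF weight[OF True]]) simp
        then have "ennreal (?w * \<bar>v x - u ((x, 0) + t *\<^sub>R \<eta>)\<bar> powr p)
            \<le> ennreal (\<bar>v x - u ((x, 0) + t *\<^sub>R \<eta>)\<bar> powr p / norm (t *\<^sub>R \<eta>) powr (real N + s * p))"
          by (intro ennreal_leI) simp
        then show ?thesis using True by (simp add: ennreal_mult'')
      qed simp
    qed
    ultimately show "ennreal (t ^ N) * (\<integral>\<^sup>+\<eta>. ennreal ?w * (?d x \<eta> * indicator (half_annulus 1) \<eta>) \<partial>lborel)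
      \<le> (\<integral>\<^sup>+\<zeta>\<in>half_annulus t. ennreal (\<bar>v x - u ((x, 0) + \<zeta>)\<bar> powr p / norm \<zeta> powr (real N + s * p)) \<partial>lborel)"
      by (simp add: mult_left_mono)
  qed
  finally show ?thesis .
qed

lemma disjoint_half_annuli:
  assumes r: "0 < r"
  shows "disjoint_family (\<lambda>k::nat. half_annulus (r / 4 ^ k))"
proof -
  have sep: "half_annulus (r / 4 ^ i) \<inter> half_annulus (r / 4 ^ j) = {}" if "i < j" for i j :: nat
  proof -
    have "(4::real) ^ Suc i \<le> 4 ^ j" using that by (intro power_increasing) auto
    then have "4 * (r / 4 ^ j) \<le> r / 4 ^ i" using r by (simp add: field_simps)
    then show ?thesis by (auto simp: half_annulus_def)
  qed
  show ?thesis unfolding disjoint_family_on_def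
  proof (intro ballI impI)
    fix m n :: nat assume "m \<noteq> n"
    then show "half_annulus (r / 4 ^ m) \<inter> half_annulus (r / 4 ^ n) = {}"
      using sep[of m n] sep[of n m] by (cases "m < n") (auto simp: Int_commute)
  qed
qed

lemma trace_energy_ge_annuli:
  fixes v :: "real^'n \<Rightarrow> real" and u :: "(real^'n) \<times> real \<Rightarrow> real"
  assumes [measurable]: "v \<in> borel_measurable borel" "u \<in> borel_measurable borel"
    and p: "1 < p" and s: "0 < s" "s < 1" and r: "0 < r" and N: "N = CARD('n) + 1"
  shows "(\<Sum>k. ennreal ((r / 4 ^ k) powr (- (s * p)) * 4 powr (- (real N + p))) * annulus_energy p u v (r / 4 ^ k))
    \<le> trace_energy N p s u v"
proof -
  let ?\<Phi> = "\<lambda>x \<zeta>. ennreal (\<bar>v x - u ((x, 0) + \<zeta>)\<bar> powr p / norm \<zeta> powr (real N + s * p))"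
  let ?A = "\<lambda>k::nat. half_annulus (r / 4 ^ k) :: ((real^'n) \<times> real) set"
  have half[measurable]: "(half_space :: ((real^'n) \<times> real) set) \<in> sets borel"
    unfolding half_space_def by (intro borel_open open_Times) auto
  have "(\<Sum>k. ennreal ((r / 4 ^ k) powr (- (s * p)) * 4 powr (- (real N + p))) * annulus_energy p u v (r / 4 ^ k))
      \<le> (\<Sum>k. \<integral>\<^sup>+x. (\<integral>\<^sup>+\<zeta>\<in>?A k. ?\<Phi> x \<zeta> \<partial>lborel) \<partial>lborel)"
  proof (rule suminf_le)
    fix k
    show "ennreal ((r / 4 ^ k) powr (- (s * p)) * 4 powr (- (real N + p))) * annulus_energy p u v (r / 4 ^ k)
        \<le> (\<integral>\<^sup>+x. (\<integral>\<^sup>+\<zeta>\<in>?A k. ?\<Phi> x \<zeta> \<partial>lborel) \<partial>lborel)"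
      using r N by (intro scaled_annulus_energy_le[OF assms(1,2) p s]) auto
  qed auto
  also have "\<dots> = (\<integral>\<^sup>+x. (\<integral>\<^sup>+\<zeta>. (\<Sum>k. ?\<Phi> x \<zeta> * indicator (?A k) \<zeta>) \<partial>lborel) \<partial>lborel)"
    by (subst nn_integral_suminf[symmetric], measurable, intro nn_integral_cong)
      (subst nn_integral_suminf[symmetric], measurable)
  also have "\<dots> \<le> (\<integral>\<^sup>+x. (\<integral>\<^sup>+\<zeta>\<in>half_space. ?\<Phi> x \<zeta> \<partial>lborel) \<partial>lborel)"
  proof (intro nn_integral_mono)
    fix x :: "real^'n" and \<zeta> :: "(real^'n) \<times> real"
    have "(\<Sum>k. ?\<Phi> x \<zeta> * indicator (?A k) \<zeta>) = ?\<Phi> x \<zeta> * indicator (\<Union>k. ?A k) \<zeta>"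
      using suminf_indicator[OF disjoint_half_annuli[OF r], of \<zeta>] by simp
    moreover have "(\<Union>k. ?A k) \<subseteq> half_space"
      by (auto simp: half_annulus_def half_space_def)
    ultimately show "(\<Sum>k. ?\<Phi> x \<zeta> * indicator (?A k) \<zeta>) \<le> ?\<Phi> x \<zeta> * indicator half_space \<zeta>"
      by (auto simp: indicator_def)
  qed
  also have "\<dots> = trace_energy N p s u v"
    unfolding trace_energy_def nn_integral_completion
  proof (rule nn_integral_cong)
    fix x :: "real^'n"
    let ?f = "\<lambda>y. ennreal (\<bar>v x - u y\<bar> powr p / dist (x, 0) y powr (real N + s * p)) * indicator half_space y"
    have "(\<integral>\<^sup>+\<zeta>\<in>half_space. ?\<Phi> x \<zeta> \<partial>lborel) = (\<integral>\<^sup>+\<zeta>. ?f ((x, 0) + \<zeta>) \<partial>lborel)"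
    proof (rule nn_integral_cong)
      fix \<zeta> :: "(real^'n) \<times> real"
      have "dist (x, 0) ((x, 0) + \<zeta>) = norm \<zeta>" by (simp add: dist_norm)
      moreover have "(x, 0) + \<zeta> \<in> half_space \<longleftrightarrow> \<zeta> \<in> half_space" by (cases \<zeta>) (simp add: half_space_def)
      ultimately show "?\<Phi> x \<zeta> * indicator half_space \<zeta> = ?f ((x, 0) + \<zeta>)"
        by (simp add: indicator_def)
    qed
    also have "\<dots> = (\<integral>\<^sup>+y. ?f y \<partial>lborel)"
      by (rule nn_integral_lborel_translate) measurable
    finally show "(\<integral>\<^sup>+\<zeta>\<in>half_space. ?\<Phi> x \<zeta> \<partial>lborel) = (\<integral>\<^sup>+y. ?f y \<partial>lborel)" .
  qed
  finally show ?thesis .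
qed

text \<open>The geometric series with ratio \<open>4^(- \<epsilon>)\<close> thus has a sum of at least \<open>1 / (\<epsilon> ln 4)\<close>.\<close>

lemma one_minus_powr_le:
  fixes \<epsilon> :: real
  assumes "0 < \<epsilon>"
  shows "0 < 1 - 4 powr (- \<epsilon>)" "1 - 4 powr (- \<epsilon>) \<le> \<epsilon> * ln 4"
proof -
  show "0 < 1 - 4 powr (- \<epsilon>)" using assms by (simp add: powr_less_one)
  show "1 - 4 powr (- \<epsilon>) \<le> \<epsilon> * ln 4"
    using exp_ge_add_one_self[of "- \<epsilon> * ln 4"] by (simp add: powr_def)
qed

text \<open>Every scale \<open>r / 4^k\<close> contributes a multiple of the mean increment at the fixed scale \<open>r\<close>, by
  \<open>mean_increment_scale\<close>, with weights \<open>4^(- \<epsilon> k)\<close>.  Their sum is at least \<open>1 / (\<epsilon> ln 4)\<close>, and the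
  factor \<open>1 - s\<close> cancels the singularity.\<close>

lemma mean_increment_le_trace_energy:
  fixes v :: "real^'n \<Rightarrow> real" and u :: "(real^'n) \<times> real \<Rightarrow> real" and e :: "real^'n"
  assumes [measurable]: "v \<in> borel_measurable borel" "u \<in> borel_measurable borel"
    and p: "1 < p" and s: "0 < s" "s < 1" and r: "0 < r" and N: "N = CARD('n) + 1" and e: "norm e = 1"
    and a: "a = measure lborel (ball (0::real^'n, 2::real) (1/2)) / (2 powr p * measure lborel (ball e (1/3)))"
  shows "ennreal (a * 4 powr (- (real N + p)) / (p * ln 4) * r powr (- (s * p))) * mean_increment p v e r
    \<le> ennreal (1 - s) * trace_energy N p s u v"
proof -
  \<comment> \<open>The loss per scale: the kernel scales like \<open>t^(- s p)\<close> and the increments like \<open>t^p\<close>.\<close>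
  define \<epsilon> where "\<epsilon> = p * (1 - s)"
  have \<epsilon>: "0 < \<epsilon>" using p s by (simp add: \<epsilon>_def)
  have Y: "0 < measure lborel (ball (0::real^'n, 2::real) (1/2))" and B: "0 < measure lborel (ball e (1/3))"
    by (auto intro: content_ball_pos)
  have a0: "0 < a" unfolding a using Y B by simp
  define b where "b = 4 powr (- (real N + p)) * a * r powr (- (s * p))"
  have b0: "0 \<le> b" using a0 by (simp add: b_def)
  have mean: "ennreal a * mean_increment p v e t \<le> annulus_energy p u v t" for t
  proof -
    have "ennreal (measure lborel (ball (0::real^'n, 2::real) (1/2))) * mean_increment p v e t
      \<le> ennreal (2 powr p * measure lborel (ball e (1/3))) * annulus_energy p u v t"
      using mean_increment_le_annulus_energy[OF assms(1,2) p e, of t]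
      by (simp add: emeasure_ball_eq_measure ennreal_mult'')
    then have "ennreal (1 / (2 powr p * measure lborel (ball e (1/3)))) * (ennreal (measure lborel (ball (0::real^'n, 2::real) (1/2))) * mean_increment p v e t)
      \<le> ennreal (1 / (2 powr p * measure lborel (ball e (1/3)))) * (ennreal (2 powr p * measure lborel (ball e (1/3))) * annulus_energy p u v t)"
      by (rule mult_left_mono) simp
    then show ?thesis
      using Y B unfolding a by (simp add: mult.assoc[symmetric] ennreal_mult''[symmetric])
  qed
  have term_le: "ennreal (b * (4 powr (- \<epsilon>)) ^ k) * mean_increment p v e r
      \<le> ennreal ((r / 4 ^ k) powr (- (s * p)) * 4 powr (- (real N + p))) * annulus_energy p u v (r / 4 ^ k)" for k :: nat
  proof -
    let ?c = "(r / 4 ^ k) powr (- (s * p)) * 4 powr (- (real N + p))"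
    have four: "(4::real) ^ k = 2 ^ (2 * k)" by (simp add: power_mult)
    have "b * (4 powr (- \<epsilon>)) ^ k = ?c * a * (4 ^ k) powr (- p)"
    proof -
      have "(4 powr (- \<epsilon>)) ^ k = (4 powr real k) powr (- \<epsilon>)"
        by (simp add: powr_realpow[symmetric] powr_powr mult.commute)
      also have "\<dots> = (4 powr real k) powr (s * p) * (4 powr real k) powr (- p)"
        by (simp add: powr_add[symmetric] \<epsilon>_def algebra_simps)
      finally have "(4 powr (- \<epsilon>)) ^ k = (4 ^ k) powr (s * p) * (4 ^ k) powr (- p)"
        by (simp add: powr_realpow)
      moreover have "(r / 4 ^ k) powr (- (s * p)) = r powr (- (s * p)) * (4 ^ k) powr (s * p)"
        using r by (simp add: powr_divide powr_minus_divide)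
      ultimately show ?thesis by (simp only: b_def mult_ac)
    qed
    then have "ennreal (b * (4 powr (- \<epsilon>)) ^ k) * mean_increment p v e r
        = ennreal (?c * a) * (ennreal ((4 ^ k) powr (- p)) * mean_increment p v e r)"
      using a0 by (simp add: ennreal_mult'' mult.assoc)
    also have "\<dots> \<le> ennreal (?c * a) * (ennreal ((4 ^ k) powr (- p)) * (ennreal ((4 ^ k) powr p) * mean_increment p v e (r / 4 ^ k)))"
      using mean_increment_scale[OF assms(1) p, of e r "2 * k"]
      by (intro mult_left_mono) (auto simp: four)
    also have "ennreal ((4 ^ k) powr (- p)) * (ennreal ((4 ^ k) powr p) * mean_increment p v e (r / 4 ^ k))
        = mean_increment p v e (r / 4 ^ k)"
    proof -
      have "(4 ^ k) powr (- p) * (4 ^ k) powr p = (1::real)"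
        by (simp add: powr_add[symmetric])
      then have "ennreal ((4 ^ k) powr (- p)) * ennreal ((4 ^ k) powr p) = 1"
        by (simp add: ennreal_mult''[symmetric])
      then show ?thesis by (simp add: mult.assoc[symmetric])
    qed
    also have "ennreal (?c * a) * mean_increment p v e (r / 4 ^ k) = ennreal ?c * (ennreal a * mean_increment p v e (r / 4 ^ k))"
      using a0 by (simp add: ennreal_mult'' mult.assoc)
    also have "\<dots> \<le> ennreal ?c * annulus_energy p u v (r / 4 ^ k)"
      by (rule mult_left_mono[OF mean]) simp
    finally show ?thesis .
  qed
  have q: "0 \<le> 4 powr (- \<epsilon>)" "4 powr (- \<epsilon>) < (1::real)" using one_minus_powr_le(1)[OF \<epsilon>] by auto
  have geo: "(\<Sum>k. ennreal (b * (4 powr (- \<epsilon>)) ^ k)) = ennreal (b / (1 - 4 powr (- \<epsilon>)))"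
  proof (rule suminf_ennreal_eq)
    show "0 \<le> b * (4 powr (- \<epsilon>)) ^ k" for k using b0 by simp
    show "(\<lambda>k. b * (4 powr (- \<epsilon>)) ^ k) sums (b / (1 - 4 powr (- \<epsilon>)))"
      using sums_mult[OF geometric_sums[of "4 powr (- \<epsilon>)"], of b] q by simp
  qed
  have "ennreal (b / (1 - 4 powr (- \<epsilon>))) * mean_increment p v e r
      = (\<Sum>k. ennreal (b * (4 powr (- \<epsilon>)) ^ k) * mean_increment p v e r)"
    by (simp add: geo[symmetric] ennreal_suminf_multc)
  also have "\<dots> \<le> (\<Sum>k. ennreal ((r / 4 ^ k) powr (- (s * p)) * 4 powr (- (real N + p))) * annulus_energy p u v (r / 4 ^ k))"
    by (rule suminf_le[OF term_le]) auto
  also have "\<dots> \<le> trace_energy N p s u v"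
    by (rule trace_energy_ge_annuli[OF assms(1,2) p s r N])
  finally have main: "ennreal (b / (1 - 4 powr (- \<epsilon>))) * mean_increment p v e r \<le> trace_energy N p s u v" .
  have "a * 4 powr (- (real N + p)) / (p * ln 4) * r powr (- (s * p)) \<le> (1 - s) * (b / (1 - 4 powr (- \<epsilon>)))"
  proof -
    have "b / (p * ln 4) = (1 - s) * (b / (\<epsilon> * ln 4))" using s p by (simp add: \<epsilon>_def field_simps)
    also have "\<dots> \<le> (1 - s) * (b / (1 - 4 powr (- \<epsilon>)))"
      using one_minus_powr_le[OF \<epsilon>] s b0 by (intro mult_left_mono divide_left_mono mult_pos_pos) (auto simp: \<epsilon>)
    finally show ?thesis by (simp add: b_def mult_ac)
  qed
  then have "ennreal (a * 4 powr (- (real N + p)) / (p * ln 4) * r powr (- (s * p))) * mean_increment p v e r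
      \<le> ennreal ((1 - s) * (b / (1 - 4 powr (- \<epsilon>)))) * mean_increment p v e r"
    by (intro mult_right_mono ennreal_leI) auto
  also have "\<dots> = ennreal (1 - s) * (ennreal (b / (1 - 4 powr (- \<epsilon>))) * mean_increment p v e r)"
  proof -
    have "0 \<le> b / (1 - 4 powr (- \<epsilon>))" using b0 q by simp
    then have "ennreal ((1 - s) * (b / (1 - 4 powr (- \<epsilon>)))) = ennreal (1 - s) * ennreal (b / (1 - 4 powr (- \<epsilon>)))"
      using s by (intro ennreal_mult) auto
    then show ?thesis by (simp only: mult.assoc)
  qed
  also have "\<dots> \<le> ennreal (1 - s) * trace_energy N p s u v"
    by (rule mult_left_mono[OF main]) simp
  finally show ?thesis .
qed

text \<open>In \<open>mean_increment_le_trace_energy\<close> only \<open>r^(- s p)\<close> still depends on \<open>s\<close> on the left-hand side,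
  and it is eventually at least half of its limit.  The constant does not depend on \<open>e\<close>, since
  balls of equal radius have equal volume.\<close>

lemma mean_increment_le_liminf:
  fixes p :: real
  assumes p: "1 < p" and N: "N = CARD('n::finite) + 1"
  obtains D :: real where "0 < D"
    "\<And>(u :: (real^'n) \<times> real \<Rightarrow> real) (v :: real^'n \<Rightarrow> real) e r.
       u \<in> borel_measurable borel \<Longrightarrow> v \<in> borel_measurable borel \<Longrightarrow> norm e = 1 \<Longrightarrow> 0 < r \<Longrightarrow>
       mean_increment p v e r \<le> ennreal (D * r powr p) *
         Liminf (at_left 1) (\<lambda>s. ennreal (1 - s) * trace_energy N p s u v)"
proof -
  define a where "a = measure lborel (ball (0::real^'n, 2::real) (1/2)) / (2 powr p * measure lborel (ball (0::real^'n) (1/3)))"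
  define c where "c = a * 4 powr (- (real N + p)) / (p * ln 4)"
  have "0 < measure lborel (ball (0::real^'n, 2::real) (1/2))" "0 < measure lborel (ball (0::real^'n) (1/3))"
    by (auto intro: content_ball_pos)
  then have a0: "0 < a" by (simp add: a_def)
  then have c0: "0 < c" using p by (simp add: c_def)
  show thesis
  proof (rule that[of "2 / c"])
    show "0 < 2 / c" using c0 by simp
    fix u :: "(real^'n) \<times> real \<Rightarrow> real" and v :: "real^'n \<Rightarrow> real" and e :: "real^'n" and r :: real
    assume u: "u \<in> borel_measurable borel" and v: "v \<in> borel_measurable borel" and e: "norm e = 1" and r: "0 < r"
    let ?L = "Liminf (at_left 1) (\<lambda>s. ennreal (1 - s) * trace_energy N p s u v)"
    have a: "a = measure lborel (ball (0::real^'n, 2::real) (1/2)) / (2 powr p * measure lborel (ball e (1/3)))"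
      by (simp add: a_def content_ball)
    have half: "eventually (\<lambda>s. r powr (- p) / 2 < r powr (- (s * p))) (at_left 1)"
    proof (rule order_tendstoD(1))
      have "((\<lambda>s. r powr (- (s * p))) \<longlongrightarrow> r powr (- (1 * p))) (at_left 1)"
        using r by (intro tendsto_intros) auto
      then show "((\<lambda>s. r powr (- (s * p))) \<longlongrightarrow> r powr (- p)) (at_left 1)" by simp
      show "r powr (- p) / 2 < r powr (- p)" using r by simp
    qed
    have unit: "eventually (\<lambda>s::real. 0 < s \<and> s < 1) (at_left 1)"
      using eventually_at_left_real[of 0 1] by (auto elim!: eventually_mono)
    have "ennreal (c * r powr (- p) / 2) * mean_increment p v e r \<le> ?L"
    proof (rule Liminf_bounded)
      show "eventually (\<lambda>s. ennreal (c * r powr (- p) / 2) * mean_increment p v e r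
          \<le> ennreal (1 - s) * trace_energy N p s u v) (at_left 1)"
        using half unit
      proof eventually_elim
        case (elim s)
        have "c * r powr (- p) / 2 \<le> c * r powr (- (s * p))"
          using elim(1) c0 by (simp add: less_imp_le)
        then have "ennreal (c * r powr (- p) / 2) * mean_increment p v e r
            \<le> ennreal (c * r powr (- (s * p))) * mean_increment p v e r"
          by (intro mult_right_mono ennreal_leI) auto
        also have "\<dots> \<le> ennreal (1 - s) * trace_energy N p s u v"
          unfolding c_def using elim(2) by (intro mean_increment_le_trace_energy[OF v u p _ _ r N e a]) auto
        finally show ?case .
      qed
    qed
    then have "ennreal (2 / c * r powr p) * (ennreal (c * r powr (- p) / 2) * mean_increment p v e r)
        \<le> ennreal (2 / c * r powr p) * ?L"
      by (rule mult_left_mono) simp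
    moreover have "ennreal (2 / c * r powr p) * ennreal (c * r powr (- p) / 2) = 1"
    proof -
      have "(2 / c * r powr p) * (c * r powr (- p) / 2) = r powr p * r powr (- p)"
        using c0 by simp
      also have "\<dots> = 1" using r by (simp add: powr_add[symmetric])
      finally show ?thesis using c0 by (simp add: ennreal_mult''[symmetric])
    qed
    ultimately show "mean_increment p v e r \<le> ennreal (2 / c * r powr p) * ?L"
      by (simp add: mult.assoc[symmetric])
  qed
qed

section \<open>Local integrability and bounds for mean difference quotients\<close>

lemma mean_increment_eq_Fubini:
  fixes v :: "'a::euclidean_space \<Rightarrow> real"
  assumes [measurable]: "v \<in> borel_measurable borel"
  shows "mean_increment p v e r
    = (\<integral>\<^sup>+x. (\<integral>\<^sup>+h\<in>ball e (1/3). ennreal (\<bar>v (x + r *\<^sub>R h) - v x\<bar> powr p) \<partial>lborel) \<partial>lborel)"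
proof -
  have [measurable]: "ball e (1/3) \<in> sets borel" by simp
  have "mean_increment p v e r = (\<integral>\<^sup>+h. (\<integral>\<^sup>+x. ennreal (\<bar>v (x + r *\<^sub>R h) - v x\<bar> powr p) * indicator (ball e (1/3)) h \<partial>lborel) \<partial>lborel)"
    unfolding mean_increment_def increment_energy_def
    by (intro nn_integral_cong) (simp add: nn_integral_multc)
  also have "\<dots> = (\<integral>\<^sup>+x. (\<integral>\<^sup>+h. ennreal (\<bar>v (x + r *\<^sub>R h) - v x\<bar> powr p) * indicator (ball e (1/3)) h \<partial>lborel) \<partial>lborel)"
    by (rule lborel_pair.Fubini') measurable
  finally show ?thesis .
qed

text \<open>For almost every \<open>x\<close> the function \<open>h \<mapsto> |v (x + r h) - v x|^p\<close> is integrable over the ball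
  around \<open>e\<close>; since \<open>v x\<close> is a finite constant, \<open>v\<close> is integrable over the ball of radius
  \<open>r / 3 = 2 R\<close> around \<open>x + r e\<close>.  For \<open>x\<close> within \<open>R\<close> of \<open>- r e\<close> this ball contains \<open>ball 0 R\<close>.\<close>

lemma set_integrable_ball_of_mean_increment:
  fixes v :: "'a::euclidean_space \<Rightarrow> real"
  assumes v[measurable]: "v \<in> borel_measurable borel" and p: "1 < p" and R: "0 < R"
    and fin: "mean_increment p v e (6 * R) < \<infinity>"
  shows "integrable lborel (\<lambda>x. indicator (ball 0 R) x * v x)"
proof -
  define r where "r = 6 * R"
  have r: "0 < r" using R by (simp add: r_def)
  let ?B = "ball e (1/3)"
  have [measurable]: "?B \<in> sets borel" "ball (0::'a) R \<in> sets borel" by simp_all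
  let ?I = "\<lambda>x. \<integral>\<^sup>+h\<in>?B. ennreal (\<bar>v (x + r *\<^sub>R h) - v x\<bar> powr p) \<partial>lborel"
  have "(\<integral>\<^sup>+x. ?I x \<partial>lborel) \<noteq> \<infinity>"
    using fin by (simp add: mean_increment_eq_Fubini r_def)
  then have ae: "AE x in lborel. ?I x \<noteq> \<infinity>"
    by (intro nn_integral_PInf_AE) measurable
  have "\<exists>x\<in>ball (- (r *\<^sub>R e)) R. ?I x \<noteq> \<infinity>"
  proof (rule ccontr)
    assume "\<not> ?thesis"
    then have "AE x in lborel. x \<notin> ball (- (r *\<^sub>R e)) R"
      using ae by (auto elim!: eventually_mono)
    then have "emeasure lborel (ball (- (r *\<^sub>R e)) R) = 0"
      by (subst (asm) AE_iff_measurable[where N = "ball (- (r *\<^sub>R e)) R"]) auto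
    then have "measure lborel (ball (- (r *\<^sub>R e)) R) = 0" by (simp add: measure_def)
    then show False using content_ball_pos[OF R, of "- (r *\<^sub>R e)"] by simp
  qed
  then obtain x where x: "x \<in> ball (- (r *\<^sub>R e)) R" and Ix: "?I x \<noteq> \<infinity>" by blast
  have "(\<integral>\<^sup>+y. ennreal (norm (indicator (ball 0 R) y * v y)) \<partial>lborel)
      = ennreal (r ^ DIM('a)) * (\<integral>\<^sup>+h. ennreal (norm (indicator (ball 0 R) (x + r *\<^sub>R h) * v (x + r *\<^sub>R h))) \<partial>lborel)"
    using r by (subst nn_integral_lborel_affine[where c = r and t = x]) (simp_all, measurable)
  also have "\<dots> \<le> ennreal (r ^ DIM('a)) * (\<integral>\<^sup>+h. ennreal (\<bar>v x\<bar> + 1) * indicator ?B h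
        + ennreal (\<bar>v (x + r *\<^sub>R h) - v x\<bar> powr p) * indicator ?B h \<partial>lborel)"
  proof (intro mult_left_mono nn_integral_mono)
    fix h
    show "ennreal (norm (indicator (ball 0 R) (x + r *\<^sub>R h) * v (x + r *\<^sub>R h)))
        \<le> ennreal (\<bar>v x\<bar> + 1) * indicator ?B h + ennreal (\<bar>v (x + r *\<^sub>R h) - v x\<bar> powr p) * indicator ?B h"
    proof (cases "x + r *\<^sub>R h \<in> ball 0 R")
      case True
      have "norm (r *\<^sub>R h - r *\<^sub>R e) \<le> norm (x + r *\<^sub>R h) + norm (x - (- (r *\<^sub>R e)))"
        using norm_triangle_ineq4[of "x + r *\<^sub>R h" "x - (- (r *\<^sub>R e))"] by simp
      also have "\<dots> < R + R"
      proof (rule add_strict_mono)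
        show "norm (x + r *\<^sub>R h) < R" using True by (simp only: mem_ball_0)
        show "norm (x - (- (r *\<^sub>R e))) < R" using x by (simp add: dist_norm norm_minus_commute)
      qed
      also have "norm (r *\<^sub>R h - r *\<^sub>R e) = r * norm (h - e)"
        using r by (simp add: scaleR_diff_right[symmetric])
      finally have "h \<in> ?B" using R by (simp add: r_def dist_norm norm_minus_commute)
      moreover have "\<bar>v (x + r *\<^sub>R h)\<bar> \<le> (\<bar>v x\<bar> + 1) + \<bar>v (x + r *\<^sub>R h) - v x\<bar> powr p"
        using le_add_powr[OF p, of "\<bar>v (x + r *\<^sub>R h) - v x\<bar>" 1] by simp
      ultimately show ?thesis
        using True by (simp add: ennreal_plus[symmetric] ennreal_leI del: ennreal_plus)
    qed simp
  qed simp
  also have "\<dots> = ennreal (r ^ DIM('a)) * (ennreal (\<bar>v x\<bar> + 1) * emeasure lborel ?B + ?I x)"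
    by (simp add: nn_integral_add nn_integral_cmult_indicator)
  also have "\<dots> < \<infinity>"
    using Ix emeasure_lborel_ball_finite[of e "1/3"]
    by (simp add: ennreal_mult_less_top less_top)
  finally have "(\<integral>\<^sup>+y. ennreal (norm (indicator (ball 0 R) y * v y)) \<partial>lborel) < \<infinity>" .
  moreover have "ball (0::'a) R \<in> sets borel" by simp
  then have "(\<lambda>y. indicator (ball 0 R) y * v y) \<in> borel_measurable lborel" by measurable
  ultimately show ?thesis by (intro integrableI_bounded)
qed

lemma locally_integrable_of_balls:
  fixes v :: "real^'n \<Rightarrow> real"
  assumes v[measurable]: "v \<in> borel_measurable borel"
    and int: "\<And>R. 0 < R \<Longrightarrow> integrable lborel (\<lambda>x. indicator (ball 0 R) x * v x)"
  shows "locally_integrable v"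
  unfolding locally_integrable_def
proof (intro allI impI)
  fix K :: "(real^'n) set" assume K: "compact K"
  then obtain R where R: "0 < R" "K \<subseteq> ball 0 R"
    using bounded_subset_ballD[OF compact_imp_bounded[OF K], of 0] by auto
  have [measurable]: "K \<in> sets borel" using K by (simp add: borel_compact)
  have "integrable lborel (\<lambda>x. indicator K x *\<^sub>R v x)"
  proof (rule Bochner_Integration.integrable_bound[OF int[OF R(1)]])
    show "AE x in lborel. norm (indicator K x *\<^sub>R v x) \<le> norm (indicator (ball 0 R) x * v x)"
      using R(2) by (intro AE_I2) (auto split: split_indicator)
  qed measurable
  moreover have "(\<lambda>x. indicator K x *\<^sub>R v x) \<in> borel_measurable lborel" by measurable
  ultimately show "v absolutely_integrable_on K"
    unfolding set_integrable_def by (simp add: integrable_completion)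
qed

text \<open>Jensen's inequality for the mean over \<open>B\<close>, by integrating the tangent at the mean \<open>c\<close> of
  \<open>\<bar>f\<bar>\<close>.  When the right-hand side is infinite the mean need not exist, and the inequality
  holds whatever the value of the integral.\<close>

lemma powr_mean_le:
  fixes f :: "'a::euclidean_space \<Rightarrow> real"
  assumes [measurable]: "f \<in> borel_measurable borel" and p: "1 < p"
    and B[measurable]: "B \<in> sets borel" and fin: "emeasure lborel B = ennreal \<beta>" and \<beta>: "0 < \<beta>"
  shows "ennreal (\<bar>(\<integral>h. indicator B h * f h \<partial>lborel) / \<beta>\<bar> powr p)
    \<le> ennreal (1 / \<beta>) * (\<integral>\<^sup>+h\<in>B. ennreal (\<bar>f h\<bar> powr p) \<partial>lborel)"
proof (cases "(\<integral>\<^sup>+h\<in>B. ennreal (\<bar>f h\<bar> powr p) \<partial>lborel) = \<infinity>")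
  case True
  then show ?thesis using \<beta> by (simp add: ennreal_mult_top)
next
  case False
  have eq: "(\<integral>\<^sup>+h\<in>B. ennreal (\<bar>f h\<bar> powr p) \<partial>lborel) = (\<integral>\<^sup>+h. ennreal (indicator B h * \<bar>f h\<bar> powr p) \<partial>lborel)"
    by (intro nn_integral_cong) (auto split: split_indicator)
  have int_p: "integrable lborel (\<lambda>h. indicator B h * \<bar>f h\<bar> powr p)"
    using False unfolding eq by (intro integrableI_nonneg) (auto simp: less_top)
  have int_1: "integrable lborel (\<lambda>h. indicator B h :: real)"
    using fin by (simp add: integrable_indicator_iff)
  have meas_B: "(\<integral>h. indicator B h \<partial>lborel) = \<beta>"
    using fin \<beta> by (simp add: measure_def)
  have int_f: "integrable lborel (\<lambda>h. indicator B h * \<bar>f h\<bar>)"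
  proof (rule Bochner_Integration.integrable_bound[OF Bochner_Integration.integrable_add[OF int_1 int_p]])
    show "AE h in lborel. norm (indicator B h * \<bar>f h\<bar>) \<le> norm (indicator B h + indicator B h * \<bar>f h\<bar> powr p)"
      using le_add_powr[OF p, of "\<bar>f _\<bar>" 1] by (intro AE_I2) (simp split: split_indicator)
  qed measurable
  define c where "c = (\<integral>h. indicator B h * \<bar>f h\<bar> \<partial>lborel) / \<beta>"
  have c0: "0 \<le> c" using \<beta> by (auto simp: c_def intro!: divide_nonneg_pos integral_nonneg_AE)
  have cp: "c powr (p - 1) * c = c powr p"
    using powr_mult_base[OF c0, of "p - 1"] by (simp add: mult.commute)
  have "\<bar>(\<integral>h. indicator B h * f h \<partial>lborel)\<bar> \<le> (\<integral>h. indicator B h * \<bar>f h\<bar> \<partial>lborel)"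
    using integral_norm_bound[of lborel "\<lambda>h. indicator B h * f h"] by (simp add: abs_mult)
  then have "\<bar>(\<integral>h. indicator B h * f h \<partial>lborel) / \<beta>\<bar> \<le> c"
    using \<beta> by (simp add: c_def divide_right_mono)
  then have le_c: "\<bar>(\<integral>h. indicator B h * f h \<partial>lborel) / \<beta>\<bar> powr p \<le> c powr p"
    using p by (intro powr_mono2) auto
  have "(\<integral>h. p * c powr (p - 1) * (indicator B h * \<bar>f h\<bar>) - (p - 1) * c powr p * indicator B h \<partial>lborel)
      \<le> (\<integral>h. indicator B h * \<bar>f h\<bar> powr p \<partial>lborel)"
  proof (rule integral_mono)
    fix h
    show "p * c powr (p - 1) * (indicator B h * \<bar>f h\<bar>) - (p - 1) * c powr p * indicator B h
        \<le> indicator B h * \<bar>f h\<bar> powr p"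
      using powr_ge_tangent[OF p, of "\<bar>f h\<bar>" c] c0 by (simp split: split_indicator)
  qed (use int_f int_1 int_p in simp_all)
  also have "(\<integral>h. p * c powr (p - 1) * (indicator B h * \<bar>f h\<bar>) - (p - 1) * c powr p * indicator B h \<partial>lborel)
      = p * c powr (p - 1) * (c * \<beta>) - (p - 1) * c powr p * \<beta>"
    using int_f int_1 meas_B \<beta> by (simp add: c_def)
  also have "\<dots> = p * (c powr (p - 1) * c) * \<beta> - (p - 1) * c powr p * \<beta>" by simp
  also have "\<dots> = c powr p * \<beta>" unfolding cp by (simp add: left_diff_distrib)
  finally have "c powr p \<le> 1 / \<beta> * (\<integral>h. indicator B h * \<bar>f h\<bar> powr p \<partial>lborel)"
    using \<beta> by (simp add: field_simps)
  then have "ennreal (\<bar>(\<integral>h. indicator B h * f h \<partial>lborel) / \<beta>\<bar> powr p)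
      \<le> ennreal (1 / \<beta> * (\<integral>h. indicator B h * \<bar>f h\<bar> powr p \<partial>lborel))"
    using le_c by (intro ennreal_leI) linarith
  also have "\<dots> = ennreal (1 / \<beta>) * ennreal (\<integral>h. indicator B h * \<bar>f h\<bar> powr p \<partial>lborel)"
    using \<beta> by (intro ennreal_mult integral_nonneg_AE) auto
  also have "ennreal (\<integral>h. indicator B h * \<bar>f h\<bar> powr p \<partial>lborel) = (\<integral>\<^sup>+h\<in>B. ennreal (\<bar>f h\<bar> powr p) \<partial>lborel)"
    unfolding eq by (rule nn_integral_eq_integral[symmetric, OF int_p]) auto
  finally show ?thesis .
qed

definition mean_quotient :: "('a::euclidean_space \<Rightarrow> real) \<Rightarrow> 'a \<Rightarrow> real \<Rightarrow> 'a \<Rightarrow> real" where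
  "mean_quotient v e r x =
     (\<integral>h. indicator (ball e (1/3)) h * ((v (x + r *\<^sub>R h) - v x) / r) \<partial>lborel) / measure lborel (ball e (1/3))"

lemma mean_quotient_measurable[measurable]:
  fixes v :: "'a::euclidean_space \<Rightarrow> real"
  assumes [measurable]: "v \<in> borel_measurable borel"
  shows "mean_quotient v e r \<in> borel_measurable borel"
proof -
  have [measurable]: "ball e (1/3) \<in> sets borel" by simp
  have "(\<lambda>x. \<integral>h. indicator (ball e (1/3)) h * ((v (x + r *\<^sub>R h) - v x) / r) \<partial>lborel) \<in> borel_measurable borel"
    by (rule lborel.borel_measurable_lebesgue_integral) measurable
  then show ?thesis unfolding mean_quotient_def[abs_def] by measurable
qed

lemma mean_quotient_powr_integral_le:
  fixes v :: "'a::euclidean_space \<Rightarrow> real"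
  assumes v[measurable]: "v \<in> borel_measurable borel" and p: "1 < p" and r: "0 < r"
  shows "(\<integral>\<^sup>+x. ennreal (\<bar>mean_quotient v e r x\<bar> powr p) \<partial>lborel)
    \<le> ennreal (r powr (- p) / measure lborel (ball e (1/3))) * mean_increment p v e r"
proof -
  let ?B = "ball e (1/3)"
  have [measurable]: "?B \<in> sets borel" by simp
  define \<beta> where "\<beta> = measure lborel ?B"
  have \<beta>: "0 < \<beta>" unfolding \<beta>_def by (rule content_ball_pos) simp
  let ?J = "\<lambda>x. \<integral>\<^sup>+h\<in>?B. ennreal (\<bar>v (x + r *\<^sub>R h) - v x\<bar> powr p) \<partial>lborel"
  have ptw: "ennreal (\<bar>mean_quotient v e r x\<bar> powr p) \<le> ennreal (r powr (- p) / \<beta>) * ?J x" for x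
  proof -
    have "ennreal (\<bar>mean_quotient v e r x\<bar> powr p)
        \<le> ennreal (1 / \<beta>) * (\<integral>\<^sup>+h\<in>?B. ennreal (\<bar>(v (x + r *\<^sub>R h) - v x) / r\<bar> powr p) \<partial>lborel)"
      unfolding mean_quotient_def \<beta>_def[symmetric]
      using \<beta> by (intro powr_mean_le p) (auto simp: emeasure_ball_eq_measure \<beta>_def)
    also have "(\<integral>\<^sup>+h\<in>?B. ennreal (\<bar>(v (x + r *\<^sub>R h) - v x) / r\<bar> powr p) \<partial>lborel)
        = (\<integral>\<^sup>+h. ennreal (r powr (- p)) * (ennreal (\<bar>v (x + r *\<^sub>R h) - v x\<bar> powr p) * indicator ?B h) \<partial>lborel)"
    proof (rule nn_integral_cong)
      fix h
      have "\<bar>(v (x + r *\<^sub>R h) - v x) / r\<bar> powr p = r powr (- p) * \<bar>v (x + r *\<^sub>R h) - v x\<bar> powr p"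
        using r by (simp add: powr_divide powr_minus_divide)
      then show "ennreal (\<bar>(v (x + r *\<^sub>R h) - v x) / r\<bar> powr p) * indicator ?B h
          = ennreal (r powr (- p)) * (ennreal (\<bar>v (x + r *\<^sub>R h) - v x\<bar> powr p) * indicator ?B h)"
        by (simp add: ennreal_mult'' mult.assoc)
    qed
    also have "\<dots> = ennreal (r powr (- p)) * ?J x" by (rule nn_integral_cmult) measurable
    also have "ennreal (1 / \<beta>) * \<dots> = ennreal (r powr (- p) / \<beta>) * ?J x"
      using \<beta> by (simp add: mult.assoc[symmetric] ennreal_mult''[symmetric])
    finally show ?thesis .
  qed
  have "(\<integral>\<^sup>+x. ennreal (\<bar>mean_quotient v e r x\<bar> powr p) \<partial>lborel) \<le> (\<integral>\<^sup>+x. ennreal (r powr (- p) / \<beta>) * ?J x \<partial>lborel)"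
    by (rule nn_integral_mono[OF ptw])
  also have "\<dots> = ennreal (r powr (- p) / \<beta>) * mean_increment p v e r"
    unfolding mean_increment_eq_Fubini[OF v] by (rule nn_integral_cmult) measurable
  finally show ?thesis by (simp add: \<beta>_def)
qed

section \<open>Mean difference quotients against test functions\<close>

lemma frechet_derivative_partial_sum:
  fixes \<phi> :: "real^'n \<Rightarrow> real"
  assumes "\<phi> differentiable (at x)"
  shows "frechet_derivative \<phi> (at x) h = (\<Sum>j\<in>UNIV. h $ j * partial_deriv j \<phi> x)"
proof -
  have lin: "linear (frechet_derivative \<phi> (at x))"
    using assms by (rule linear_frechet_derivative)
  have "frechet_derivative \<phi> (at x) h = frechet_derivative \<phi> (at x) (\<Sum>j\<in>UNIV. h $ j *\<^sub>R axis j 1)"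
    by (simp add: basis_expansion[of h, unfolded scalar_mult_eq_scaleR])
  also have "\<dots> = (\<Sum>j\<in>UNIV. h $ j * partial_deriv j \<phi> x)"
    by (simp add: linear_sum[OF lin] linear_scale[OF lin] partial_deriv_def)
  finally show ?thesis .
qed

text \<open>The partial derivatives are continuous and vanish outside the compact support of \<open>\<phi>\<close>, hence
  are bounded; the mean value inequality then gives a Lipschitz constant.\<close>

lemma test_function_derivative_bounds:
  fixes \<phi> :: "real^'n \<Rightarrow> real"
  assumes \<phi>: "test_function \<phi>"
  obtains M R where "0 \<le> M" "0 < R" "\<forall>x. \<bar>\<phi> x\<bar> \<le> M" "\<forall>j x. \<bar>partial_deriv j \<phi> x\<bar> \<le> M"
    "\<forall>x y. \<bar>\<phi> x - \<phi> y\<bar> \<le> M * norm (x - y)" "\<forall>x. R \<le> norm x \<longrightarrow> \<phi> x = 0"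
    "\<forall>j x. R \<le> norm x \<longrightarrow> partial_deriv j \<phi> x = 0"
    "continuous_on UNIV \<phi>" "\<forall>j. continuous_on UNIV (partial_deriv j \<phi>)"
proof -
  obtain c K where cont: "continuous_on UNIV \<phi>" and c: "\<forall>x. \<bar>\<phi> x\<bar> \<le> c"
    and K: "compact K" "\<forall>x. x \<notin> K \<longrightarrow> \<phi> x = 0"
    using \<phi> by (rule test_function_bounded_support)
  have "C_k (Suc 0) \<phi>" using \<phi> unfolding test_function_def by blast
  then have diff: "\<phi> differentiable (at x)" and pcont: "continuous_on UNIV (partial_deriv j \<phi>)" for x j
    by auto
  have out: "partial_deriv j \<phi> x = 0" if "x \<notin> K" for j x
  proof -
    have "(\<phi> has_derivative (\<lambda>_. 0)) (at x)"
    proof (rule has_derivative_transform_within_open)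
      show "((\<lambda>_. 0) has_derivative (\<lambda>_. 0)) (at x)" by simp
      show "open (- K)" using K(1) by (simp add: compact_imp_closed open_Compl)
    qed (use K(2) that in auto)
    then show ?thesis by (simp add: partial_deriv_eq)
  qed
  have "\<exists>b. \<forall>x. \<bar>partial_deriv j \<phi> x\<bar> \<le> b" for j
  proof -
    have "bounded (partial_deriv j \<phi> ` K)"
      by (intro compact_imp_bounded compact_continuous_image continuous_on_subset[OF pcont] K(1)) simp
    then obtain b where b: "\<And>x. x \<in> K \<Longrightarrow> \<bar>partial_deriv j \<phi> x\<bar> \<le> b" by (auto simp: bounded_iff)
    have "\<bar>partial_deriv j \<phi> x\<bar> \<le> max b 0" for x
      using b[of x] out[of x j] by (cases "x \<in> K") (auto simp: le_max_iff_disj)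
    then show ?thesis by blast
  qed
  then have "\<forall>j. \<exists>b. \<forall>x. \<bar>partial_deriv j \<phi> x\<bar> \<le> b" by (rule allI)
  from choice[OF this] obtain b where b: "\<And>j x. \<bar>partial_deriv j \<phi> x\<bar> \<le> b j" by auto
  define M where "M = (\<Sum>j\<in>UNIV. b j) + \<bar>c\<bar>"
  have b0: "0 \<le> b j" for j using b[of j undefined] by linarith
  have bM: "b j \<le> M" for j
    using member_le_sum[of j UNIV b] b0 by (simp add: M_def)
  have M0: "0 \<le> M" unfolding M_def using b0 by (intro add_nonneg_nonneg sum_nonneg) auto
  have lip: "\<bar>\<phi> x - \<phi> y\<bar> \<le> M * norm (x - y)" for x y
  proof -
    have "norm (\<phi> x - \<phi> y) \<le> M * norm (x - y)"
    proof (rule differentiable_bound[of UNIV \<phi> "\<lambda>x. frechet_derivative \<phi> (at x)"])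
      show "(\<phi> has_derivative frechet_derivative \<phi> (at z)) (at z within UNIV)" for z
        using diff frechet_derivative_works by blast
      show "onorm (frechet_derivative \<phi> (at z)) \<le> M" for z
      proof (rule onorm_le)
        fix h
        have "norm (frechet_derivative \<phi> (at z) h) \<le> (\<Sum>j\<in>UNIV. \<bar>h $ j * partial_deriv j \<phi> z\<bar>)"
          unfolding frechet_derivative_partial_sum[OF diff] real_norm_def by (rule sum_abs)
        also have "\<dots> \<le> (\<Sum>j\<in>UNIV. norm h * b j)"
          unfolding abs_mult using b b0 by (intro sum_mono mult_mono component_le_norm_cart) auto
        also have "\<dots> \<le> M * norm h"
          by (simp add: sum_distrib_left[symmetric] M_def mult.commute mult_left_mono)
        finally show "norm (frechet_derivative \<phi> (at z) h) \<le> M * norm h" .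
      qed
    qed auto
    then show ?thesis by simp
  qed
  obtain R where R: "0 < R" "K \<subseteq> ball 0 R"
    using bounded_subset_ballD[OF compact_imp_bounded[OF K(1)], of 0] by auto
  have outK: "x \<notin> K" if "R \<le> norm x" for x using R(2) that by auto
  show thesis
  proof (rule that[of M R])
    show "\<forall>x. \<bar>\<phi> x\<bar> \<le> M"
    proof
      fix x
      have "0 \<le> (\<Sum>j\<in>UNIV. b j)" using b0 by (intro sum_nonneg) auto
      then show "\<bar>\<phi> x\<bar> \<le> M" using c[rule_format, of x] by (simp add: M_def)
    qed
    show "\<forall>j x. \<bar>partial_deriv j \<phi> x\<bar> \<le> M" using b bM order_trans by (intro allI) (rule order_trans[OF b bM])
  qed (use M0 R(1) lip outK K(2) out cont pcont in auto)
qed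

lemma integral_lborel_affine:
  fixes f :: "'a::euclidean_space \<Rightarrow> real"
  assumes [measurable]: "f \<in> borel_measurable borel" and c: "c \<noteq> 0"
  shows "(\<integral>x. f x \<partial>lborel) = \<bar>c\<bar> ^ DIM('a) * (\<integral>x. f (t + c *\<^sub>R x) \<partial>lborel)"
  by (subst lborel_affine[OF c, of t])
    (simp add: integral_density integral_distr)

text \<open>The reflection \<open>h \<mapsto> 2 e - h\<close> preserves the ball and changes the sign of \<open>l (h - e)\<close>.\<close>

lemma integral_ball_linear:
  fixes l :: "'a::euclidean_space \<Rightarrow> real"
  assumes l: "bounded_linear l"
  shows "(\<integral>h. indicator (ball e \<rho>) h * l h \<partial>lborel) = measure lborel (ball e \<rho>) * l e"
proof -
  interpret l: bounded_linear l by fact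
  let ?B = "ball e \<rho>"
  have [measurable]: "?B \<in> sets borel" by simp
  have l_meas[measurable]: "l \<in> borel_measurable borel"
    by (intro borel_measurable_continuous_onI l.continuous_on continuous_on_id)
  have int: "integrable lborel (\<lambda>h. indicator ?B h * l h)"
  proof (rule integrableI_bounded_set[where A = ?B and B = "onorm l * (norm e + \<rho>)"])
    show "emeasure lborel ?B < \<infinity>" using emeasure_lborel_ball_finite[of e \<rho>] by (simp add: less_top)
    show "AE x in lborel. x \<in> ?B \<longrightarrow> norm (indicator ?B x * l x) \<le> onorm l * (norm e + \<rho>)"
    proof (intro AE_I2 impI)
      fix x assume x: "x \<in> ?B"
      have "norm x \<le> norm e + \<rho>"
        using norm_triangle_ineq[of "x - e" e] x by (simp add: dist_norm norm_minus_commute)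
      then have "norm (l x) \<le> onorm l * (norm e + \<rho>)"
        using onorm[OF l, of x] onorm_pos_le[OF l] by (meson mult_left_mono order_trans)
      then show "norm (indicator ?B x * l x) \<le> onorm l * (norm e + \<rho>)" using x by simp
    qed
  qed auto
  have int_B: "integrable lborel (\<lambda>h. indicator ?B h * l e)"
    using emeasure_lborel_ball_finite[of e \<rho>] by (simp add: integrable_indicator_iff less_top)
  define I where "I = (\<integral>h. indicator ?B h * l (h - e) \<partial>lborel)"
  have "I = (\<integral>h. indicator ?B (2 *\<^sub>R e + (- 1) *\<^sub>R h) * l ((2 *\<^sub>R e + (- 1) *\<^sub>R h) - e) \<partial>lborel)"
    unfolding I_def by (subst integral_lborel_affine[where c = "-1" and t = "2 *\<^sub>R e"]) auto
  also have "\<dots> = (\<integral>h. - (indicator ?B h * l (h - e)) \<partial>lborel)"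
  proof (rule Bochner_Integration.integral_cong[OF refl])
    fix h
    have reflect: "2 *\<^sub>R e + (- 1) *\<^sub>R h - e = - (h - e)" by (simp add: scaleR_2)
    have "2 *\<^sub>R e + (- 1) *\<^sub>R h \<in> ?B \<longleftrightarrow> h \<in> ?B"
      by (simp add: dist_norm scaleR_2 norm_minus_commute)
    then show "indicator ?B (2 *\<^sub>R e + (- 1) *\<^sub>R h) * l ((2 *\<^sub>R e + (- 1) *\<^sub>R h) - e)
        = - (indicator ?B h * l (h - e))"
      unfolding reflect linear_neg[OF bounded_linear.linear[OF l]] by (simp add: indicator_def)
  qed
  also have "\<dots> = - I" by (simp add: I_def)
  finally have "I = 0" by simp
  moreover have "I = (\<integral>h. indicator ?B h * l h \<partial>lborel) - (\<integral>h. indicator ?B h * l e \<partial>lborel)"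
    using int int_B by (simp add: I_def l.diff right_diff_distrib)
  ultimately show ?thesis by simp
qed

text \<open>The integrability that is needed to exchange the mean over \<open>h\<close> with the integral against a test
  function; the case \<open>s = 0\<close> covers the term without translation.\<close>

lemma integrable_shift_product:
  fixes W \<psi> :: "'a::euclidean_space \<Rightarrow> real"
  assumes W: "integrable lborel W" and [measurable]: "\<psi> \<in> borel_measurable borel"
    and M: "\<And>x. \<bar>\<psi> x\<bar> \<le> M" and B[measurable]: "B \<in> sets borel" and fin: "emeasure lborel B < \<infinity>"
  shows "integrable (lborel \<Otimes>\<^sub>M lborel) (\<lambda>(x, h). indicator B h * (\<psi> x * W (x + s *\<^sub>R h)))"
proof (rule integrableI_bounded)
  have W_meas[measurable]: "W \<in> borel_measurable borel" using borel_measurable_integrable[OF W] by simp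
  show "(\<lambda>(x, h). indicator B h * (\<psi> x * W (x + s *\<^sub>R h))) \<in> borel_measurable (lborel \<Otimes>\<^sub>M lborel)"
    by measurable
  have M0: "0 \<le> M" using M[of undefined] by linarith
  let ?J = "\<integral>\<^sup>+x. ennreal \<bar>W x\<bar> \<partial>lborel"
  have "(\<integral>\<^sup>+z. ennreal (norm (case z of (x, h) \<Rightarrow> indicator B h * (\<psi> x * W (x + s *\<^sub>R h)))) \<partial>(lborel \<Otimes>\<^sub>M lborel))
      = (\<integral>\<^sup>+h. (\<integral>\<^sup>+x. ennreal (norm (indicator B h * (\<psi> x * W (x + s *\<^sub>R h)))) \<partial>lborel) \<partial>lborel)"
  proof -
    have "(\<lambda>z. ennreal (norm (case z of (x, h) \<Rightarrow> indicator B h * (\<psi> x * W (x + s *\<^sub>R h))))) \<in> borel_measurable (lborel \<Otimes>\<^sub>M lborel)"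
      by measurable
    from lborel_pair.nn_integral_snd[OF this, symmetric] show ?thesis by simp
  qed
  also have "\<dots> \<le> (\<integral>\<^sup>+h. ennreal M * ?J * indicator B h \<partial>lborel)"
  proof (rule nn_integral_mono)
    fix h
    have "(\<integral>\<^sup>+x. ennreal (norm (indicator B h * (\<psi> x * W (x + s *\<^sub>R h)))) \<partial>lborel)
        \<le> (\<integral>\<^sup>+x. (ennreal M * indicator B h) * ennreal \<bar>W (s *\<^sub>R h + x)\<bar> \<partial>lborel)"
    proof (rule nn_integral_mono)
      fix x
      have "\<bar>\<psi> x\<bar> * \<bar>W (x + s *\<^sub>R h)\<bar> \<le> M * \<bar>W (x + s *\<^sub>R h)\<bar>" by (intro mult_right_mono M) simp
      then have "ennreal (\<bar>\<psi> x\<bar> * \<bar>W (x + s *\<^sub>R h)\<bar>) \<le> ennreal M * ennreal \<bar>W (x + s *\<^sub>R h)\<bar>"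
        using M0 by (simp add: ennreal_mult'[symmetric] ennreal_leI)
      then show "ennreal (norm (indicator B h * (\<psi> x * W (x + s *\<^sub>R h)))) \<le> (ennreal M * indicator B h) * ennreal \<bar>W (s *\<^sub>R h + x)\<bar>"
        by (auto simp: abs_mult add.commute split: split_indicator)
    qed
    also have "\<dots> = (ennreal M * indicator B h) * ?J"
      using nn_integral_lborel_translate[of "\<lambda>x. ennreal \<bar>W x\<bar>" "s *\<^sub>R h"] by (simp add: nn_integral_cmult)
    finally show "(\<integral>\<^sup>+x. ennreal (norm (indicator B h * (\<psi> x * W (x + s *\<^sub>R h)))) \<partial>lborel) \<le> ennreal M * ?J * indicator B h"
      by (simp only: mult_ac)
  qed
  also have "\<dots> = ennreal M * ?J * emeasure lborel B" by (rule nn_integral_cmult_indicator) simp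
  also have "\<dots> < \<infinity>"
    using W fin by (simp add: integrable_iff_bounded ennreal_mult_less_top)
  finally show "(\<integral>\<^sup>+z. ennreal (norm (case z of (x, h) \<Rightarrow> indicator B h * (\<psi> x * W (x + s *\<^sub>R h)))) \<partial>(lborel \<Otimes>\<^sub>M lborel)) < \<infinity>" .
qed

lemma integrable_mult_bounded_lborel:
  fixes W \<psi> :: "'a::euclidean_space \<Rightarrow> real"
  assumes W: "integrable lborel W" and [measurable]: "\<psi> \<in> borel_measurable borel" and M: "\<And>x. \<bar>\<psi> x\<bar> \<le> M"
  shows "integrable lborel (\<lambda>x. W x * \<psi> x)"
  by (rule integrable_mult_bounded[OF W _ M]) simp

text \<open>The difference quotient is moved from \<open>v\<close> to the test function: Fubini's theorem brings the
  mean over \<open>h\<close> outside, and the inner integral is translated.  The integrable function \<open>W\<close> stands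
  in for \<open>v\<close>, which is only locally integrable; the two agree at all points that matter.\<close>

lemma mean_quotient_test_integral:
  fixes v W \<phi> :: "'a::euclidean_space \<Rightarrow> real"
  assumes W: "integrable lborel W" and [measurable]: "\<phi> \<in> borel_measurable borel"
    and M: "\<And>x. \<bar>\<phi> x\<bar> \<le> M" and r: "0 < r"
    and agree: "\<And>x h. \<phi> x \<noteq> 0 \<Longrightarrow> h \<in> ball e (1/3) \<Longrightarrow> W (x + r *\<^sub>R h) = v (x + r *\<^sub>R h) \<and> W x = v x"
  shows "integrable lborel (\<lambda>x. mean_quotient v e r x * \<phi> x)"
    and "(\<integral>x. mean_quotient v e r x * \<phi> x \<partial>lborel)
      = (\<integral>h. indicator (ball e (1/3)) h * (\<integral>x. W x * ((\<phi> (x - r *\<^sub>R h) - \<phi> x) / r) \<partial>lborel) \<partial>lborel)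
        / measure lborel (ball e (1/3))"
proof -
  let ?B = "ball e (1/3)"
  have [measurable]: "?B \<in> sets borel" by simp
  have W_meas[measurable]: "W \<in> borel_measurable borel" using borel_measurable_integrable[OF W] by simp
  define F where "F x h = indicator ?B h * ((W (x + r *\<^sub>R h) - W x) / r * \<phi> x)" for x h
  have F_int: "integrable (lborel \<Otimes>\<^sub>M lborel) (\<lambda>(x, h). F x h)"
  proof -
    have fin: "emeasure lborel ?B < \<infinity>" using emeasure_lborel_ball_finite[of e "1/3"] by (simp add: less_top)
    have "integrable (lborel \<Otimes>\<^sub>M lborel) (\<lambda>z. ((\<lambda>(x, h). indicator ?B h * (\<phi> x * W (x + r *\<^sub>R h))) z
        - (\<lambda>(x, h). indicator ?B h * (\<phi> x * W (x + 0 *\<^sub>R h))) z) / r)"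
      by (intro Bochner_Integration.integrable_diff integrable_divide integrable_shift_product[OF W _ M _ fin]) measurable
    moreover have "((\<lambda>(x, h). indicator ?B h * (\<phi> x * W (x + r *\<^sub>R h))) z
        - (\<lambda>(x, h). indicator ?B h * (\<phi> x * W (x + 0 *\<^sub>R h))) z) / r = (\<lambda>(x, h). F x h) z" for z
      by (cases z) (simp add: F_def algebra_simps diff_divide_distrib)
    ultimately show ?thesis by simp
  qed
  have eq: "mean_quotient v e r x * \<phi> x = (\<integral>h. F x h \<partial>lborel) / measure lborel ?B" for x
  proof (cases "\<phi> x = 0")
    case True
    then show ?thesis by (simp add: F_def)
  next
    case False
    have "(\<integral>h. F x h \<partial>lborel) = (\<integral>h. indicator ?B h * ((v (x + r *\<^sub>R h) - v x) / r) * \<phi> x \<partial>lborel)"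
      using agree[OF False] by (intro Bochner_Integration.integral_cong refl) (auto simp: F_def split: split_indicator)
    then show ?thesis by (simp add: mean_quotient_def)
  qed
  show "integrable lborel (\<lambda>x. mean_quotient v e r x * \<phi> x)"
    unfolding eq using lborel_pair.integrable_fst[OF F_int] by simp
  have inner: "(\<integral>x. F x h \<partial>lborel) = indicator ?B h * (\<integral>x. W x * ((\<phi> (x - r *\<^sub>R h) - \<phi> x) / r) \<partial>lborel)" for h
  proof -
    have i1: "integrable lborel (\<lambda>x. W x * \<phi> (x - r *\<^sub>R h))"
      by (rule integrable_mult_bounded_lborel[OF W _ M]) measurable
    have i2: "integrable lborel (\<lambda>x. W x * \<phi> x)"
      by (rule integrable_mult_bounded_lborel[OF W _ M]) measurable
    have shift: "(\<integral>x. W x * \<phi> (x - r *\<^sub>R h) \<partial>lborel) = (\<integral>x. W (r *\<^sub>R h + x) * \<phi> x \<partial>lborel)"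
    proof -
      have "(\<lambda>x. W x * \<phi> (x - r *\<^sub>R h)) \<in> borel_measurable borel" by measurable
      from integral_lborel_affine[OF this, of 1 "r *\<^sub>R h"] show ?thesis by simp
    qed
    have i3: "integrable lborel (\<lambda>x. W (x + r *\<^sub>R h) * \<phi> x)"
    proof -
      have "integrable (distr lborel borel ((+) (r *\<^sub>R h))) W"
        using W by (simp add: lborel_distr_plus)
      then have "integrable lborel (\<lambda>x. W (r *\<^sub>R h + x))"
        by (subst (asm) integrable_distr_eq) auto
      then show ?thesis
        by (intro integrable_mult_bounded_lborel[OF _ _ M]) (simp_all add: add.commute)
    qed
    have "(\<integral>x. (W (x + r *\<^sub>R h) - W x) / r * \<phi> x \<partial>lborel)
        = ((\<integral>x. W (x + r *\<^sub>R h) * \<phi> x \<partial>lborel) - (\<integral>x. W x * \<phi> x \<partial>lborel)) / r"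
    proof -
      have expand: "(W (x + r *\<^sub>R h) - W x) / r * \<phi> x = (W (x + r *\<^sub>R h) * \<phi> x - W x * \<phi> x) / r" for x
        by (simp add: left_diff_distrib)
      show ?thesis
        unfolding expand integral_divide_zero Bochner_Integration.integral_diff[OF i3 i2] ..
    qed
    also have "\<dots> = (\<integral>x. (W x * \<phi> (x - r *\<^sub>R h) - W x * \<phi> x) / r \<partial>lborel)"
      using i1 i2 by (simp add: shift add.commute)
    also have "\<dots> = (\<integral>x. W x * ((\<phi> (x - r *\<^sub>R h) - \<phi> x) / r) \<partial>lborel)"
      by (simp add: right_diff_distrib)
    finally show ?thesis unfolding F_def integral_mult_right_zero by (rule arg_cong)
  qed
  have "(\<integral>x. mean_quotient v e r x * \<phi> x \<partial>lborel) = (\<integral>x. (\<integral>h. F x h \<partial>lborel) \<partial>lborel) / measure lborel ?B"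
    unfolding eq by simp
  also have "(\<integral>x. (\<integral>h. F x h \<partial>lborel) \<partial>lborel) = (\<integral>h. (\<integral>x. F x h \<partial>lborel) \<partial>lborel)"
    by (rule lborel_pair.Fubini_integral[OF F_int, symmetric])
  finally show "(\<integral>x. mean_quotient v e r x * \<phi> x \<partial>lborel)
      = (\<integral>h. indicator ?B h * (\<integral>x. W x * ((\<phi> (x - r *\<^sub>R h) - \<phi> x) / r) \<partial>lborel) \<partial>lborel) / measure lborel ?B"
    by (simp only: inner)
qed

text \<open>After the difference quotient has been moved to the test function, dominated convergence gives
  the limit \<open>l h\<close> for each fixed \<open>h\<close>.  It is linear in \<open>h\<close>, so its mean over the ball is its value
  at the centre, the coordinate vector.\<close>

lemma mean_quotient_test_tendsto:
  fixes v :: "real^'n \<Rightarrow> real"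
  assumes v[measurable]: "v \<in> borel_measurable borel"
    and int: "\<And>R. 0 < R \<Longrightarrow> integrable lborel (\<lambda>x. indicator (ball 0 R) x * v x)"
    and \<phi>: "test_function \<phi>" and r: "\<And>k. 0 < r k" "\<And>k. r k \<le> 1" "r \<longlonglongrightarrow> 0"
  shows "\<And>k. integrable lborel (\<lambda>x. mean_quotient v (axis i 1) (r k) x * \<phi> x)"
    and "(\<lambda>k. \<integral>x. mean_quotient v (axis i 1) (r k) x * \<phi> x \<partial>lborel)
      \<longlonglongrightarrow> - (\<integral>x. v x * partial_deriv i \<phi> x \<partial>lborel)"
proof -
  obtain M R where M0: "0 \<le> M" and R: "0 < R" and M: "\<forall>x. \<bar>\<phi> x\<bar> \<le> M" and M': "\<forall>j x. \<bar>partial_deriv j \<phi> x\<bar> \<le> M"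
    and lip: "\<forall>x y. \<bar>\<phi> x - \<phi> y\<bar> \<le> M * norm (x - y)" and out: "\<forall>x. R \<le> norm x \<longrightarrow> \<phi> x = 0"
    and out': "\<forall>j x. R \<le> norm x \<longrightarrow> partial_deriv j \<phi> x = 0"
    and cont: "continuous_on UNIV \<phi>" and cont': "\<forall>j. continuous_on UNIV (partial_deriv j \<phi>)"
    using \<phi> by (rule test_function_derivative_bounds)
  have \<phi>_meas[measurable]: "\<phi> \<in> borel_measurable borel" using cont by (rule borel_measurable_continuous_onI)
  have p_meas[measurable]: "partial_deriv j \<phi> \<in> borel_measurable borel" for j
    using cont' by (intro borel_measurable_continuous_onI) simp
  have "C_k (Suc 0) \<phi>" using \<phi> unfolding test_function_def by blast
  then have diff: "\<phi> differentiable (at x)" for x by simp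
  let ?e = "axis i 1 :: real^'n"
  let ?B = "ball ?e (1/3)"
  define \<beta> where "\<beta> = measure lborel ?B"
  have \<beta>: "0 < \<beta>" unfolding \<beta>_def by (rule content_ball_pos) simp
  have [measurable]: "?B \<in> sets borel" by simp
  have B_int: "integrable lborel (\<lambda>h. indicator ?B h :: real)"
    using emeasure_lborel_ball_finite[of ?e "1/3"] by (simp add: integrable_indicator_iff less_top)
  have norm_h: "norm h \<le> 2" if "h \<in> ?B" for h
    using norm_triangle_ineq[of "h - ?e" ?e] that by (simp add: dist_norm norm_minus_commute)
  \<comment> \<open>The test function lives in \<open>ball 0 R\<close>, and \<open>r k *\<^sub>R h\<close> has norm at most 2.\<close>
  define W where "W x = indicator (ball 0 (R + 2)) x * v x" for x
  have W: "integrable lborel W" using int[of "R + 2"] R by (simp add: W_def[abs_def])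
  have W_meas[measurable]: "W \<in> borel_measurable borel" using borel_measurable_integrable[OF W] by simp
  have agree: "W (x + r k *\<^sub>R h) = v (x + r k *\<^sub>R h) \<and> W x = v x" if "\<phi> x \<noteq> 0" "h \<in> ?B" for x h k
  proof -
    have x: "norm x < R" using out that(1) not_less by blast
    have "norm (r k *\<^sub>R h) \<le> 1 * 2"
      unfolding norm_scaleR using r(1)[of k] r(2)[of k] norm_h[OF that(2)] by (intro mult_mono) auto
    then have "norm (x + r k *\<^sub>R h) < R + 2" using x norm_triangle_ineq[of x "r k *\<^sub>R h"] by linarith
    moreover have "norm x < R + 2" using x by linarith
    ultimately show ?thesis unfolding W_def by (simp add: indicator_def)
  qed
  note mq = mean_quotient_test_integral[OF W \<phi>_meas M[rule_format] r(1), where e = ?e and v = v]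
  show "integrable lborel (\<lambda>x. mean_quotient v ?e (r k) x * \<phi> x)" for k
    by (rule mq(1)) (rule agree)
  define \<Psi> where "\<Psi> k h = (\<integral>x. W x * ((\<phi> (x - r k *\<^sub>R h) - \<phi> x) / r k) \<partial>lborel)" for k h
  define c where "c j = (\<integral>x. W x * partial_deriv j \<phi> x \<partial>lborel)" for j
  define l where "l h = - (\<Sum>j\<in>UNIV. h $ j * c j)" for h :: "real^'n"
  have quot_bound: "\<bar>(\<phi> (x - r k *\<^sub>R h) - \<phi> x) / r k\<bar> \<le> M * norm h" for x h k
  proof -
    have "\<bar>\<phi> (x - r k *\<^sub>R h) - \<phi> x\<bar> \<le> M * norm (x - r k *\<^sub>R h - x)" using lip by blast
    also have "\<dots> = M * norm h * r k" using r(1)[of k] by simp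
    finally show ?thesis using r(1)[of k] by (simp add: pos_divide_le_eq)
  qed
  have quot_lim: "(\<lambda>k. (\<phi> (x - r k *\<^sub>R h) - \<phi> x) / r k) \<longlonglongrightarrow> - (\<Sum>j\<in>UNIV. h $ j * partial_deriv j \<phi> x)" for x h
  proof -
    have "((\<lambda>t. \<phi> (x - t *\<^sub>R h)) has_derivative (\<lambda>t. frechet_derivative \<phi> (at x) (- (t *\<^sub>R h)))) (at 0)"
    proof (rule has_derivative_compose[where f = "\<lambda>t. x - t *\<^sub>R h" and g = \<phi>])
      show "((\<lambda>t. x - t *\<^sub>R h) has_derivative (\<lambda>t. - (t *\<^sub>R h))) (at 0)"
        by (auto intro!: derivative_eq_intros)
      show "(\<phi> has_derivative frechet_derivative \<phi> (at x)) (at (x - 0 *\<^sub>R h))"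
        using diff[of x] by (simp add: frechet_derivative_works)
    qed
    moreover have "frechet_derivative \<phi> (at x) (- (t *\<^sub>R h)) = - (\<Sum>j\<in>UNIV. h $ j * partial_deriv j \<phi> x) * t" for t
      unfolding frechet_derivative_partial_sum[OF diff]
      by (simp add: sum_negf sum_distrib_left mult_ac)
    ultimately have "((\<lambda>t. \<phi> (x - t *\<^sub>R h)) has_field_derivative - (\<Sum>j\<in>UNIV. h $ j * partial_deriv j \<phi> x)) (at 0)"
      unfolding has_field_derivative_def by (simp only:)
    then have "((\<lambda>t. (\<phi> (x - t *\<^sub>R h) - \<phi> x) / t) \<longlongrightarrow> - (\<Sum>j\<in>UNIV. h $ j * partial_deriv j \<phi> x)) (at 0)"
      by (simp add: DERIV_def)
    moreover have "filterlim r (at 0) sequentially"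
      using r(1) r(3) by (auto simp: filterlim_at intro!: always_eventually less_imp_neq[symmetric])
    ultimately show ?thesis by (rule filterlim_compose)
  qed
  have \<Psi>_lim: "(\<lambda>k. \<Psi> k h) \<longlonglongrightarrow> l h" for h
  proof -
    have "(\<lambda>k. \<Psi> k h) \<longlonglongrightarrow> (\<integral>x. W x * (- (\<Sum>j\<in>UNIV. h $ j * partial_deriv j \<phi> x)) \<partial>lborel)"
      unfolding \<Psi>_def
    proof (rule integral_dominated_convergence[where w = "\<lambda>x. \<bar>W x\<bar> * (M * norm h)"])
      show "integrable lborel (\<lambda>x. \<bar>W x\<bar> * (M * norm h))" using W by simp
      show "AE x in lborel. (\<lambda>k. W x * ((\<phi> (x - r k *\<^sub>R h) - \<phi> x) / r k)) \<longlonglongrightarrow> W x * (- (\<Sum>j\<in>UNIV. h $ j * partial_deriv j \<phi> x))"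
        by (intro AE_I2 tendsto_mult tendsto_const quot_lim)
      show "AE x in lborel. norm (W x * ((\<phi> (x - r k *\<^sub>R h) - \<phi> x) / r k)) \<le> \<bar>W x\<bar> * (M * norm h)" for k
        unfolding real_norm_def abs_mult by (intro AE_I2 mult_left_mono quot_bound) simp
    qed measurable
    also have "(\<integral>x. W x * (- (\<Sum>j\<in>UNIV. h $ j * partial_deriv j \<phi> x)) \<partial>lborel)
        = (\<integral>x. - (\<Sum>j\<in>UNIV. h $ j * (W x * partial_deriv j \<phi> x)) \<partial>lborel)"
      by (intro Bochner_Integration.integral_cong refl) (simp add: sum_distrib_left mult_ac)
    also have "\<dots> = l h"
      using integrable_mult_bounded_lborel[OF W p_meas M'[rule_format]]
      by (simp add: l_def c_def)
    finally show ?thesis .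
  qed
  have \<Psi>_bound: "\<bar>\<Psi> k h\<bar> \<le> (\<integral>x. \<bar>W x\<bar> \<partial>lborel) * (M * norm h)" for k h
  proof -
    have "\<bar>\<Psi> k h\<bar> \<le> (\<integral>x. norm (W x * ((\<phi> (x - r k *\<^sub>R h) - \<phi> x) / r k)) \<partial>lborel)"
      unfolding \<Psi>_def real_norm_def[symmetric] by (rule integral_norm_bound)
    also have "\<dots> \<le> (\<integral>x. \<bar>W x\<bar> * (M * norm h) \<partial>lborel)"
    proof (rule integral_mono)
      show "integrable lborel (\<lambda>x. norm (W x * ((\<phi> (x - r k *\<^sub>R h) - \<phi> x) / r k)))"
        by (intro integrable_norm integrable_mult_bounded_lborel[OF W _ quot_bound]) measurable
      show "integrable lborel (\<lambda>x. \<bar>W x\<bar> * (M * norm h))" using W by simp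
      show "norm (W x * ((\<phi> (x - r k *\<^sub>R h) - \<phi> x) / r k)) \<le> \<bar>W x\<bar> * (M * norm h)" for x
        unfolding real_norm_def abs_mult by (intro mult_left_mono quot_bound) simp
    qed
    finally show ?thesis by simp
  qed
  have \<Psi>_meas[measurable]: "\<Psi> k \<in> borel_measurable borel" for k
    unfolding \<Psi>_def[abs_def]
    by (rule lborel.borel_measurable_lebesgue_integral) measurable
  have l_lin: "bounded_linear l"
  proof -
    have "linear l"
      by (rule linearI) (simp_all add: l_def sum.distrib distrib_right sum_distrib_left mult.assoc)
    then show ?thesis by (simp add: linear_conv_bounded_linear)
  qed
  have l_meas[measurable]: "l \<in> borel_measurable borel"
    by (intro borel_measurable_continuous_onI linear_continuous_on l_lin)
  have "(\<lambda>k. \<integral>h. indicator ?B h * \<Psi> k h \<partial>lborel) \<longlonglongrightarrow> (\<integral>h. indicator ?B h * l h \<partial>lborel)"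
  proof (rule integral_dominated_convergence[where w = "\<lambda>h. indicator ?B h * ((\<integral>x. \<bar>W x\<bar> \<partial>lborel) * (M * 2))"])
    show "integrable lborel (\<lambda>h. indicator ?B h * ((\<integral>x. \<bar>W x\<bar> \<partial>lborel) * (M * 2)))" using B_int by simp
    show "AE h in lborel. (\<lambda>k. indicator ?B h * \<Psi> k h) \<longlonglongrightarrow> indicator ?B h * l h"
      by (intro AE_I2 tendsto_mult tendsto_const \<Psi>_lim)
    show "AE h in lborel. norm (indicator ?B h * \<Psi> k h) \<le> indicator ?B h * ((\<integral>x. \<bar>W x\<bar> \<partial>lborel) * (M * 2))" for k
    proof (rule AE_I2)
      fix h
      have "\<bar>\<Psi> k h\<bar> \<le> (\<integral>x. \<bar>W x\<bar> \<partial>lborel) * (M * 2)" if "h \<in> ?B"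
        using norm_h[OF that] M0
        by (intro order_trans[OF \<Psi>_bound] mult_left_mono integral_nonneg_AE) auto
      then show "norm (indicator ?B h * \<Psi> k h) \<le> indicator ?B h * ((\<integral>x. \<bar>W x\<bar> \<partial>lborel) * (M * 2))"
        by (cases "h \<in> ?B") simp_all
    qed
  qed measurable
  also have "(\<integral>h. indicator ?B h * l h \<partial>lborel) = \<beta> * l ?e"
    unfolding \<beta>_def by (rule integral_ball_linear[OF l_lin])
  finally have "(\<lambda>k. (\<integral>h. indicator ?B h * \<Psi> k h \<partial>lborel) / \<beta>) \<longlonglongrightarrow> \<beta> * l ?e / \<beta>"
    by (rule tendsto_divide[OF _ tendsto_const]) (use \<beta> in simp)
  moreover have "\<beta> * l ?e / \<beta> = - (\<integral>x. v x * partial_deriv i \<phi> x \<partial>lborel)"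
  proof -
    have "l ?e = - c i"
      by (simp add: l_def axis_def if_distrib[of "\<lambda>t. t * _"] cong: if_cong)
    moreover have "W x * partial_deriv i \<phi> x = v x * partial_deriv i \<phi> x" for x
    proof (cases "norm x < R")
      case False
      then show ?thesis using out' by (simp add: not_less)
    qed (simp add: W_def)
    ultimately show ?thesis using \<beta> by (simp add: c_def)
  qed
  moreover have "(\<integral>x. mean_quotient v ?e (r k) x * \<phi> x \<partial>lborel) = (\<integral>h. indicator ?B h * \<Psi> k h \<partial>lborel) / \<beta>" for k
    unfolding \<Psi>_def \<beta>_def by (rule mq(2)) (rule agree)
  ultimately show "(\<lambda>k. \<integral>x. mean_quotient v ?e (r k) x * \<phi> x \<partial>lborel)
      \<longlonglongrightarrow> - (\<integral>x. v x * partial_deriv i \<phi> x \<partial>lborel)"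
    by simp
qed

section \<open>The weak gradient and its energy\<close>

lemma powr_abs_diff_le:
  fixes a b p :: real
  assumes "0 \<le> a" "0 \<le> b" "1 < p"
  shows "\<bar>a - b\<bar> powr p \<le> a powr p + b powr p"
proof -
  have "\<bar>a - b\<bar> powr p \<le> (max a b) powr p" using assms by (intro powr_mono2) auto
  also have "\<dots> \<le> a powr p + b powr p" by (auto simp: max_def)
  finally show ?thesis .
qed

lemma norm_powr_le_sum:
  fixes g :: "real^'n"
  assumes "0 < p"
  shows "norm g powr p \<le> real CARD('n) powr p * (\<Sum>i\<in>UNIV. \<bar>g $ i\<bar> powr p)"
proof -
  define m where "m = Max (range (\<lambda>i. \<bar>g $ i\<bar>))"
  have le_m: "\<bar>g $ i\<bar> \<le> m" for i by (simp add: m_def)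
  have "m \<in> range (\<lambda>i. \<bar>g $ i\<bar>)" unfolding m_def by (rule Max_in) auto
  then obtain i0 where i0: "m = \<bar>g $ i0\<bar>" by auto
  have "norm g \<le> (\<Sum>i\<in>UNIV. \<bar>g $ i\<bar>)" by (rule norm_le_l1_cart)
  also have "\<dots> \<le> real CARD('n) * m" using le_m by (intro sum_bounded_above) auto
  finally have "norm g powr p \<le> (real CARD('n) * m) powr p" using assms by (intro powr_mono2) auto
  also have "\<dots> = real CARD('n) powr p * \<bar>g $ i0\<bar> powr p" unfolding i0 by (rule powr_mult)
  also have "\<dots> \<le> real CARD('n) powr p * (\<Sum>i\<in>UNIV. \<bar>g $ i\<bar> powr p)"
    by (intro mult_left_mono member_le_sum) auto
  finally show ?thesis .
qed

lemma nn_integral_lebesgue_cong_AE_lborel: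
  assumes "AE x in lborel. f x = g x"
  shows "(\<integral>\<^sup>+x. f x \<partial>lebesgue) = (\<integral>\<^sup>+x. g x \<partial>lebesgue)"
  unfolding nn_integral_completion using assms by (rule nn_integral_cong_AE)

lemma trace_energy_cong_AE:
  fixes u u' :: "(real^'n) \<times> real \<Rightarrow> real"
  assumes "AE x in lborel. v x = v' x" and "AE y in lborel. y \<in> half_space \<longrightarrow> u y = u' y"
  shows "trace_energy N p s u v = trace_energy N p s u' v'"
  unfolding trace_energy_def
proof (rule nn_integral_lebesgue_cong_AE_lborel, rule AE_mp[OF assms(1)], rule AE_I2, rule impI)
  fix x assume vx: "v x = v' x"
  show "(\<integral>\<^sup>+y\<in>half_space. ennreal (\<bar>v x - u y\<bar> powr p / dist (x, 0) y powr (real N + s * p)) \<partial>lebesgue)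
      = (\<integral>\<^sup>+y\<in>half_space. ennreal (\<bar>v' x - u' y\<bar> powr p / dist (x, 0) y powr (real N + s * p)) \<partial>lebesgue)"
    by (rule nn_integral_lebesgue_cong_AE_lborel, rule AE_mp[OF assms(2)], rule AE_I2)
      (simp add: vx split: split_indicator)
qed

lemma borel_representative_half_space:
  fixes u :: "(real^'n) \<times> real \<Rightarrow> real"
  assumes "u \<in> borel_measurable (lebesgue_on half_space)"
  obtains u' where "u' \<in> borel_measurable borel" "AE y in lborel. y \<in> half_space \<longrightarrow> u y = u' y"
proof -
  have "open (half_space :: ((real^'n) \<times> real) set)"
    unfolding half_space_def by (intro open_Times) auto
  then have "(half_space :: ((real^'n) \<times> real) set) \<in> sets lebesgue" by auto
  then have "(\<lambda>y. if y \<in> half_space then u y else 0) \<in> borel_measurable lebesgue"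
    by (rule borel_measurable_if_I[OF assms])
  then obtain u' where u': "u' \<in> borel_measurable lborel" "AE y in lborel. (if y \<in> half_space then u y else 0) = u' y"
    using completion_ex_borel_measurable_real by blast
  show thesis
  proof (rule that[of u'])
    show "u' \<in> borel_measurable borel" using u'(1) by simp
    show "AE y in lborel. y \<in> half_space \<longrightarrow> u y = u' y"
      using u'(2) by eventually_elim auto
  qed
qed

text \<open>Weak gradients see only the class of \<open>v\<close> modulo null sets; with the analogous
  \<open>trace_energy_cong_AE\<close> this reduces the problem to Borel functions.\<close>

lemma has_weak_gradient_cong_AE:
  fixes v v' :: "real^'n \<Rightarrow> real"
  assumes v: "v \<in> borel_measurable lebesgue" and v': "v' \<in> borel_measurable lebesgue"
    and ae: "AE x in lebesgue. v' x = v x" and g: "has_weak_gradient v' g"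
  shows "has_weak_gradient v g"
proof -
  have "locally_integrable v"
    unfolding locally_integrable_def
  proof (intro allI impI)
    fix K :: "(real^'n) set" assume K: "compact K"
    have [measurable]: "K \<in> sets lebesgue" using lmeasurable_compact[OF K] by (rule fmeasurableD)
    have "integrable lebesgue (\<lambda>x. indicator K x *\<^sub>R v' x)"
      using g K by (simp add: has_weak_gradient_def locally_integrable_def set_integrable_def)
    then have "integrable lebesgue (\<lambda>x. indicator K x *\<^sub>R v x)"
      by (rule integrable_cong_AE_imp) (use v ae in \<open>auto elim!: eventually_mono\<close>)
    then show "v absolutely_integrable_on K" by (simp add: set_integrable_def)
  qed
  moreover have "(LINT x|lebesgue. v x * partial_deriv i \<phi> x) = - (LINT x|lebesgue. g x $ i * \<phi> x)"
    if \<phi>: "test_function \<phi>" for \<phi> i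
  proof -
    obtain M R where "\<forall>j. continuous_on UNIV (partial_deriv j \<phi>)"
      using \<phi> by (rule test_function_derivative_bounds)
    then have [measurable]: "partial_deriv i \<phi> \<in> borel_measurable lebesgue"
      by (intro continuous_imp_borel_measurable_lebesgue) simp
    have "(LINT x|lebesgue. v x * partial_deriv i \<phi> x) = (LINT x|lebesgue. v' x * partial_deriv i \<phi> x)"
      using v v' ae by (intro integral_cong_AE) (auto elim!: eventually_mono)
    then show ?thesis using g \<phi> by (simp add: has_weak_gradient_def)
  qed
  ultimately show ?thesis using g by (simp add: has_weak_gradient_def)
qed

lemma dirichlet_energy_eq:
  assumes "has_weak_gradient v g"
  shows "dirichlet_energy p v = (\<integral>\<^sup>+x. ennreal (norm (g x) powr p) \<partial>lborel)"
proof -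
  have "has_weak_gradient v (weak_gradient v)"
    unfolding weak_gradient_def by (rule someI[of "has_weak_gradient v", OF assms])
  from weak_gradient_AE_unique[OF this assms]
  have "AE x in lebesgue. weak_gradient v x = g x" .
  then have "dirichlet_energy p v = (\<integral>\<^sup>+x. ennreal (norm (g x) powr p) \<partial>lebesgue)"
    unfolding dirichlet_energy_def by (intro nn_integral_cong_AE) (auto elim!: eventually_mono)
  then show ?thesis by (simp only: nn_integral_completion)
qed

lemma locally_integrable_vec:
  fixes g :: "real^'n \<Rightarrow> real^'n"
  assumes "\<And>i. locally_integrable (\<lambda>x. g x $ i)"
  shows "locally_integrable g"
  unfolding locally_integrable_def
proof (intro allI impI)
  fix K :: "(real^'n) set" assume K: "compact K"
  have "integrable lebesgue (\<lambda>x. \<Sum>i\<in>UNIV. (indicator K x *\<^sub>R g x $ i) *\<^sub>R axis i (1::real))"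
    using assms K by (intro Bochner_Integration.integrable_sum integrable_scaleR_left)
      (simp add: locally_integrable_def set_integrable_def)
  moreover have "(\<Sum>i\<in>UNIV. (indicator K x *\<^sub>R g x $ i) *\<^sub>R axis i (1::real)) = indicator K x *\<^sub>R g x" for x
    by (simp add: vec_eq_iff axis_def if_distrib cong: if_cong)
  ultimately show "g absolutely_integrable_on K" by (simp add: set_integrable_def)
qed

text \<open>The positive and the negative parts of the quotients are bounded in Lp separately, and the second
  weak limit is taken along a refinement of the filter obtained for the first.  The difference of
  the two limits is the weak limit of the quotients, which \<open>lim\<close> identifies.\<close>

lemma weak_partial_derivative_of_bounded_quotients:
  fixes v :: "real^'n \<Rightarrow> real"
  assumes v[measurable]: "v \<in> borel_measurable borel" and p: "1 < p" and K: "0 \<le> K"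
    and lim: "\<And>\<phi> r. test_function \<phi> \<Longrightarrow> (\<And>k. 0 < r k) \<Longrightarrow> (\<And>k. r k \<le> 1) \<Longrightarrow> r \<longlonglongrightarrow> 0 \<Longrightarrow>
      (\<forall>k. integrable lborel (\<lambda>x. mean_quotient v (axis i 1) (r k) x * \<phi> x)) \<and>
      (\<lambda>k. \<integral>x. mean_quotient v (axis i 1) (r k) x * \<phi> x \<partial>lborel) \<longlonglongrightarrow> - (\<integral>x. v x * partial_deriv i \<phi> x \<partial>lborel)"
    and bound: "\<And>r. 0 < r \<Longrightarrow> r \<le> 1 \<Longrightarrow> (\<integral>\<^sup>+x. ennreal (\<bar>mean_quotient v (axis i 1) r x\<bar> powr p) \<partial>lborel) \<le> ennreal K"
  obtains g where "g \<in> borel_measurable borel" "locally_integrable g"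
    "(\<integral>\<^sup>+x. ennreal (\<bar>g x\<bar> powr p) \<partial>lborel) \<le> ennreal (2 * K)"
    "\<forall>\<phi>. test_function \<phi> \<longrightarrow> (\<integral>x. v x * partial_deriv i \<phi> x \<partial>lborel) = - (\<integral>x. g x * \<phi> x \<partial>lborel)"
proof -
  define r where "r k = 1 / real (Suc k)" for k
  have r: "0 < r k" "r k \<le> 1" for k by (simp_all add: r_def)
  have r0: "r \<longlonglongrightarrow> 0" unfolding r_def[abs_def] using LIMSEQ_inverse_real_of_nat by (simp add: divide_inverse)
  define q where "q k = mean_quotient v (axis i 1) (r k)" for k
  have q[measurable]: "q k \<in> borel_measurable borel" for k unfolding q_def by measurable
  have P_bound: "(\<integral>\<^sup>+x. ennreal (max 0 (q k x) powr p) \<partial>lborel) \<le> ennreal K"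
    and Q_bound: "(\<integral>\<^sup>+x. ennreal (max 0 (- q k x) powr p) \<partial>lborel) \<le> ennreal K" for k
  proof -
    have "(\<integral>\<^sup>+x. ennreal (max 0 (q k x) powr p) \<partial>lborel) \<le> (\<integral>\<^sup>+x. ennreal (\<bar>q k x\<bar> powr p) \<partial>lborel)"
      "(\<integral>\<^sup>+x. ennreal (max 0 (- q k x) powr p) \<partial>lborel) \<le> (\<integral>\<^sup>+x. ennreal (\<bar>q k x\<bar> powr p) \<partial>lborel)"
      using p by (auto intro!: nn_integral_mono ennreal_leI powr_mono2)
    then show "(\<integral>\<^sup>+x. ennreal (max 0 (q k x) powr p) \<partial>lborel) \<le> ennreal K"
      "(\<integral>\<^sup>+x. ennreal (max 0 (- q k x) powr p) \<partial>lborel) \<le> ennreal K"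
      using bound[OF r[of k]] by (auto simp: q_def intro: order_trans)
  qed
  have P_meas: "(\<lambda>x. max 0 (q k x)) \<in> borel_measurable borel" and Q_meas: "(\<lambda>x. max 0 (- q k x)) \<in> borel_measurable borel" for k
    by measurable
  have P_nonneg: "0 \<le> max 0 (q k x)" and Q_nonneg: "0 \<le> max 0 (- q k x)" for k x by simp_all
  obtain F1 a where F1: "F1 \<le> sequentially" "F1 \<noteq> bot" and a[measurable]: "a \<in> borel_measurable borel" and a0: "\<forall>x. 0 \<le> a x"
    and aK: "(\<integral>\<^sup>+x. ennreal (a x powr p) \<partial>lborel) \<le> ennreal K"
    and a_lim: "\<forall>\<phi> c. \<phi> \<in> borel_measurable borel \<longrightarrow> (\<forall>x. \<bar>\<phi> x\<bar> \<le> c) \<longrightarrow> bounded {x. \<phi> x \<noteq> 0} \<longrightarrow>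
       integrable lborel (\<lambda>x. a x * \<phi> x) \<and>
       ((\<lambda>k. \<integral>x. max 0 (q k x) * \<phi> x \<partial>lborel) \<longlongrightarrow> (\<integral>x. a x * \<phi> x \<partial>lborel)) F1"
    by (rule weak_Lp_compactness[where f = "\<lambda>k x. max 0 (q k x)", OF sequentially_bot p P_meas P_nonneg P_bound K])
  obtain F b where F: "F \<le> F1" "F \<noteq> bot" and b[measurable]: "b \<in> borel_measurable borel" and b0: "\<forall>x. 0 \<le> b x"
    and bK: "(\<integral>\<^sup>+x. ennreal (b x powr p) \<partial>lborel) \<le> ennreal K"
    and b_lim: "\<forall>\<phi> c. \<phi> \<in> borel_measurable borel \<longrightarrow> (\<forall>x. \<bar>\<phi> x\<bar> \<le> c) \<longrightarrow> bounded {x. \<phi> x \<noteq> 0} \<longrightarrow>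
       integrable lborel (\<lambda>x. b x * \<phi> x) \<and>
       ((\<lambda>k. \<integral>x. max 0 (- q k x) * \<phi> x \<partial>lborel) \<longlongrightarrow> (\<integral>x. b x * \<phi> x \<partial>lborel)) F"
    by (rule weak_Lp_compactness[where f = "\<lambda>k x. max 0 (- q k x)", OF F1(2) p Q_meas Q_nonneg Q_bound K])
  define g where "g x = a x - b x" for x
  have g[measurable]: "g \<in> borel_measurable borel" unfolding g_def[abs_def] by measurable
  have g_lp: "(\<integral>\<^sup>+x. ennreal (\<bar>g x\<bar> powr p) \<partial>lborel) \<le> ennreal (2 * K)"
  proof -
    have "(\<integral>\<^sup>+x. ennreal (\<bar>g x\<bar> powr p) \<partial>lborel) \<le> (\<integral>\<^sup>+x. ennreal (a x powr p) + ennreal (b x powr p) \<partial>lborel)"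
      using powr_abs_diff_le[OF _ _ p] a0 b0
      by (intro nn_integral_mono) (simp add: g_def ennreal_plus[symmetric] ennreal_leI del: ennreal_plus)
    also have "\<dots> \<le> ennreal K + ennreal K"
      using aK bK by (subst nn_integral_add) (auto intro: add_mono)
    also have "\<dots> = ennreal (2 * K)" using K by (simp add: ennreal_plus[symmetric] del: ennreal_plus)
    finally show ?thesis .
  qed
  have g_loc: "locally_integrable g"
  proof (rule locally_integrable_of_balls[OF g])
    fix R :: real
    have ind: "(indicator (ball 0 R) :: real^'n \<Rightarrow> real) \<in> borel_measurable borel" "\<forall>x::real^'n. \<bar>indicator (ball 0 R) x :: real\<bar> \<le> 1"
      "bounded {x::real^'n. indicator (ball 0 R) x \<noteq> (0::real)}"
    proof -
      show "(indicator (ball 0 R) :: real^'n \<Rightarrow> real) \<in> borel_measurable borel"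
        by (rule borel_measurable_indicator) simp
      show "bounded {x::real^'n. indicator (ball 0 R) x \<noteq> (0::real)}"
        by (rule bounded_subset[OF bounded_ball[of 0 R]]) (auto simp: indicator_def)
    qed (simp split: split_indicator)
    have "integrable lborel (\<lambda>x. a x * indicator (ball 0 R) x - b x * indicator (ball 0 R) x)"
      using a_lim[rule_format, OF ind(1) ind(2)[rule_format] ind(3)] b_lim[rule_format, OF ind(1) ind(2)[rule_format] ind(3)]
      by (intro Bochner_Integration.integrable_diff) auto
    then show "integrable lborel (\<lambda>x. indicator (ball 0 R) x * g x)"
      by (simp add: g_def algebra_simps)
  qed
  have weak: "(\<integral>x. v x * partial_deriv i \<phi> x \<partial>lborel) = - (\<integral>x. g x * \<phi> x \<partial>lborel)" if \<phi>: "test_function \<phi>" for \<phi>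
  proof -
    obtain c S where cont: "continuous_on UNIV \<phi>" and c: "\<forall>x. \<bar>\<phi> x\<bar> \<le> c" and S: "compact S" "\<forall>x. x \<notin> S \<longrightarrow> \<phi> x = 0"
      using \<phi> by (rule test_function_bounded_support)
    have \<phi>_meas[measurable]: "\<phi> \<in> borel_measurable borel" using cont by (rule borel_measurable_continuous_onI)
    have bdd: "bounded {x. \<phi> x \<noteq> 0}" using S(2) by (intro bounded_subset[OF compact_imp_bounded[OF S(1)]]) auto
    note A = a_lim[rule_format, OF \<phi>_meas c[rule_format] bdd]
    note B = b_lim[rule_format, OF \<phi>_meas c[rule_format] bdd]
    have q_int: "integrable lborel (\<lambda>x. q k x * \<phi> x)" for k
      unfolding q_def using lim[OF \<phi> r r0] by simp
    have split: "(\<integral>x. max 0 (q k x) * \<phi> x \<partial>lborel) - (\<integral>x. max 0 (- q k x) * \<phi> x \<partial>lborel) = (\<integral>x. q k x * \<phi> x \<partial>lborel)" for k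
    proof -
      have i1: "integrable lborel (\<lambda>x. max 0 (q k x) * \<phi> x)"
      proof (rule Bochner_Integration.integrable_bound[OF q_int[of k]])
        show "AE x in lborel. norm (max 0 (q k x) * \<phi> x) \<le> norm (q k x * \<phi> x)"
          unfolding real_norm_def abs_mult by (intro AE_I2 mult_right_mono) auto
      qed measurable
      have i2: "integrable lborel (\<lambda>x. max 0 (- q k x) * \<phi> x)"
      proof (rule Bochner_Integration.integrable_bound[OF q_int[of k]])
        show "AE x in lborel. norm (max 0 (- q k x) * \<phi> x) \<le> norm (q k x * \<phi> x)"
          unfolding real_norm_def abs_mult by (intro AE_I2 mult_right_mono) auto
      qed measurable
      have "max 0 (q k x) * \<phi> x - max 0 (- q k x) * \<phi> x = q k x * \<phi> x" for x
        by (simp add: max_def)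
      then show ?thesis using Bochner_Integration.integral_diff[OF i1 i2] by simp
    qed
    have "((\<lambda>k. (\<integral>x. max 0 (q k x) * \<phi> x \<partial>lborel) - (\<integral>x. max 0 (- q k x) * \<phi> x \<partial>lborel))
        \<longlongrightarrow> (\<integral>x. a x * \<phi> x \<partial>lborel) - (\<integral>x. b x * \<phi> x \<partial>lborel)) F"
      by (intro tendsto_diff tendsto_mono[OF F(1) conjunct2[OF A]] conjunct2[OF B])
    moreover have "(\<integral>x. a x * \<phi> x \<partial>lborel) - (\<integral>x. b x * \<phi> x \<partial>lborel) = (\<integral>x. g x * \<phi> x \<partial>lborel)"
      using A B by (simp add: g_def left_diff_distrib)
    ultimately have lim_g: "((\<lambda>k. \<integral>x. q k x * \<phi> x \<partial>lborel) \<longlongrightarrow> (\<integral>x. g x * \<phi> x \<partial>lborel)) F"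
      by (simp add: split)
    have "((\<lambda>k. \<integral>x. q k x * \<phi> x \<partial>lborel) \<longlongrightarrow> - (\<integral>x. v x * partial_deriv i \<phi> x \<partial>lborel)) F"
      unfolding q_def using lim[OF \<phi> r r0] by (intro tendsto_mono[OF order_trans[OF F(1) F1(1)]]) simp
    from tendsto_unique[OF F(2) lim_g this] show ?thesis by simp
  qed
  show thesis
    by (rule that[OF g g_loc g_lp]) (use weak in simp)
qed

text \<open>The constant collects \<open>D\<close> from \<open>mean_increment_le_liminf\<close>, the volume of the ball over which
  the quotients are averaged, a factor 2 for positive and negative parts, and the comparison of the
  Euclidean norm with the sum over the coordinates.\<close>

lemma trace_energy_controls_weak_gradient:
  fixes p :: real
  assumes p: "1 < p" and N: "N = CARD('n::finite) + 1"
  obtains C :: real where "0 \<le> C"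
    "\<And>(u :: (real^'n) \<times> real \<Rightarrow> real) (v :: real^'n \<Rightarrow> real) L.
       u \<in> borel_measurable borel \<Longrightarrow> v \<in> borel_measurable borel \<Longrightarrow>
       Liminf (at_left 1) (\<lambda>s. ennreal (1 - s) * trace_energy N p s u v) = ennreal L \<Longrightarrow> 0 \<le> L \<Longrightarrow>
       \<exists>g. has_weak_gradient v g \<and> (\<integral>\<^sup>+x. ennreal (norm (g x) powr p) \<partial>lborel) \<le> ennreal (C * L)"
proof -
  obtain D :: real where D: "0 < D"
    and mean: "\<And>(u :: (real^'n) \<times> real \<Rightarrow> real) (v :: real^'n \<Rightarrow> real) e r.
       u \<in> borel_measurable borel \<Longrightarrow> v \<in> borel_measurable borel \<Longrightarrow> norm e = 1 \<Longrightarrow> 0 < r \<Longrightarrow>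
       mean_increment p v e r \<le> ennreal (D * r powr p) *
         Liminf (at_left 1) (\<lambda>s. ennreal (1 - s) * trace_energy N p s u v)"
    using mean_increment_le_liminf[OF p N] by blast
  define \<beta> where "\<beta> = measure lborel (ball (0::real^'n) (1/3))"
  have \<beta>: "0 < \<beta>" unfolding \<beta>_def by (rule content_ball_pos) simp
  have \<beta>_eq: "measure lborel (ball e (1/3)) = \<beta>" for e :: "real^'n"
    by (simp add: \<beta>_def content_ball)
  define C where "C = real CARD('n) powr p * (real CARD('n) * (2 * (D / \<beta>)))"
  show thesis
  proof (rule that[of C])
    show "0 \<le> C" using D \<beta> by (simp add: C_def)
    fix u :: "(real^'n) \<times> real \<Rightarrow> real" and v :: "real^'n \<Rightarrow> real" and L :: real
    assume u: "u \<in> borel_measurable borel" and v[measurable]: "v \<in> borel_measurable borel"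
      and L: "Liminf (at_left 1) (\<lambda>s. ennreal (1 - s) * trace_energy N p s u v) = ennreal L" and L0: "0 \<le> L"
    define K where "K = D / \<beta> * L"
    have K: "0 \<le> K" using D \<beta> L0 by (simp add: K_def)
    have incr: "mean_increment p v e r \<le> ennreal (D * r powr p * L)" if "norm e = 1" "0 < r" for e r
      using mean[OF u v that] D L0 by (simp add: L ennreal_mult'')
    have ball_int: "integrable lborel (\<lambda>x. indicator (ball 0 R) x * v x)" if R: "0 < R" for R
    proof -
      obtain e :: "real^'n" where e: "norm e = 1" using vector_choose_size[of 1] by auto
      have "mean_increment p v e (6 * R) < \<infinity>"
        using incr[OF e, of "6 * R"] R by (auto intro: le_less_trans)
      then show ?thesis by (rule set_integrable_ball_of_mean_increment[OF v p R])
    qed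
    have quot: "(\<integral>\<^sup>+x. ennreal (\<bar>mean_quotient v (axis i 1) r x\<bar> powr p) \<partial>lborel) \<le> ennreal K" if r: "0 < r" for i r
    proof -
      have "(\<integral>\<^sup>+x. ennreal (\<bar>mean_quotient v (axis i 1) r x\<bar> powr p) \<partial>lborel)
          \<le> ennreal (r powr (- p) / \<beta>) * mean_increment p v (axis i 1) r"
        using mean_quotient_powr_integral_le[OF v p r, of "axis i 1"] by (simp only: \<beta>_eq)
      also have "\<dots> \<le> ennreal (r powr (- p) / \<beta>) * ennreal (D * r powr p * L)"
        using r by (intro mult_left_mono incr) auto
      also have "\<dots> = ennreal (r powr (- p) / \<beta> * (D * r powr p * L))"
        using D L0 by (intro ennreal_mult''[symmetric]) simp
      also have "r powr (- p) / \<beta> * (D * r powr p * L) = K"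
        using r by (simp add: K_def powr_minus field_simps)
      finally show ?thesis .
    qed
    have "\<exists>g. g \<in> borel_measurable borel \<and> locally_integrable g \<and>
        (\<integral>\<^sup>+x. ennreal (\<bar>g x\<bar> powr p) \<partial>lborel) \<le> ennreal (2 * K) \<and>
        (\<forall>\<phi>. test_function \<phi> \<longrightarrow> (\<integral>x. v x * partial_deriv i \<phi> x \<partial>lborel) = - (\<integral>x. g x * \<phi> x \<partial>lborel))" for i
    proof (rule weak_partial_derivative_of_bounded_quotients[OF v p K, of i])
      show "(\<forall>k. integrable lborel (\<lambda>x. mean_quotient v (axis i 1) (r k) x * \<phi> x)) \<and>
        (\<lambda>k. \<integral>x. mean_quotient v (axis i 1) (r k) x * \<phi> x \<partial>lborel) \<longlonglongrightarrow> - (\<integral>x. v x * partial_deriv i \<phi> x \<partial>lborel)"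
        if "test_function \<phi>" "\<And>k. 0 < r k" "\<And>k. r k \<le> 1" "r \<longlonglongrightarrow> 0" for \<phi> and r :: "nat \<Rightarrow> real"
        using mean_quotient_test_tendsto[OF v ball_int that] by simp
    qed (use quot in auto)
    then have "\<forall>i. \<exists>g. g \<in> borel_measurable borel \<and> locally_integrable g \<and>
        (\<integral>\<^sup>+x. ennreal (\<bar>g x\<bar> powr p) \<partial>lborel) \<le> ennreal (2 * K) \<and>
        (\<forall>\<phi>. test_function \<phi> \<longrightarrow> (\<integral>x. v x * partial_deriv i \<phi> x \<partial>lborel) = - (\<integral>x. g x * \<phi> x \<partial>lborel))"
      by (rule allI)
    from choice[OF this] obtain G where G: "\<And>i. G i \<in> borel_measurable borel" "\<And>i. locally_integrable (G i)"
      "\<And>i. (\<integral>\<^sup>+x. ennreal (\<bar>G i x\<bar> powr p) \<partial>lborel) \<le> ennreal (2 * K)"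
      "\<And>i \<phi>. test_function \<phi> \<Longrightarrow> (\<integral>x. v x * partial_deriv i \<phi> x \<partial>lborel) = - (\<integral>x. G i x * \<phi> x \<partial>lborel)"
      by auto
    note G(1)[measurable]
    define g where "g x = (\<chi> i. G i x)" for x
    have "has_weak_gradient v g"
      unfolding has_weak_gradient_def
    proof (intro conjI allI impI)
      show "locally_integrable v" by (rule locally_integrable_of_balls[OF v ball_int])
      show "locally_integrable g" by (rule locally_integrable_vec) (simp add: g_def G(2))
      fix \<phi> :: "real^'n \<Rightarrow> real" and i
      assume \<phi>: "test_function \<phi>"
      obtain M R where cont: "continuous_on UNIV \<phi>" "\<forall>j. continuous_on UNIV (partial_deriv j \<phi>)"
        using \<phi> by (rule test_function_derivative_bounds)
      have [measurable]: "\<phi> \<in> borel_measurable borel" "partial_deriv i \<phi> \<in> borel_measurable borel"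
        using cont by (auto intro: borel_measurable_continuous_onI)
      have "(\<lambda>x. v x * partial_deriv i \<phi> x) \<in> borel_measurable lborel" "(\<lambda>x. g x $ i * \<phi> x) \<in> borel_measurable lborel"
        unfolding g_def vec_lambda_beta by measurable
      then show "(LINT x|lebesgue. v x * partial_deriv i \<phi> x) = - (LINT x|lebesgue. g x $ i * \<phi> x)"
        using G(4)[OF \<phi>, of i] by (simp add: integral_completion g_def)
    qed
    moreover have "(\<integral>\<^sup>+x. ennreal (norm (g x) powr p) \<partial>lborel) \<le> ennreal (C * L)"
    proof -
      have "(\<integral>\<^sup>+x. ennreal (norm (g x) powr p) \<partial>lborel)
          \<le> (\<integral>\<^sup>+x. ennreal (real CARD('n) powr p) * (\<Sum>i\<in>UNIV. ennreal (\<bar>G i x\<bar> powr p)) \<partial>lborel)"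
      proof (rule nn_integral_mono)
        fix x
        have "norm (g x) powr p \<le> real CARD('n) powr p * (\<Sum>i\<in>UNIV. \<bar>G i x\<bar> powr p)"
          using norm_powr_le_sum[of p "g x"] p by (simp add: g_def)
        then have "ennreal (norm (g x) powr p) \<le> ennreal (real CARD('n) powr p * (\<Sum>i\<in>UNIV. \<bar>G i x\<bar> powr p))"
          by (rule ennreal_leI)
        then show "ennreal (norm (g x) powr p) \<le> ennreal (real CARD('n) powr p) * (\<Sum>i\<in>UNIV. ennreal (\<bar>G i x\<bar> powr p))"
          by (simp add: ennreal_mult' sum_nonneg)
      qed
      also have "\<dots> = ennreal (real CARD('n) powr p) * (\<Sum>i\<in>UNIV. \<integral>\<^sup>+x. ennreal (\<bar>G i x\<bar> powr p) \<partial>lborel)"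
      proof -
        have meas: "(\<lambda>x. \<Sum>i\<in>UNIV. ennreal (\<bar>G i x\<bar> powr p)) \<in> borel_measurable lborel"
          by measurable
        have "(\<integral>\<^sup>+x. (\<Sum>i\<in>UNIV. ennreal (\<bar>G i x\<bar> powr p)) \<partial>lborel) = (\<Sum>i\<in>UNIV. \<integral>\<^sup>+x. ennreal (\<bar>G i x\<bar> powr p) \<partial>lborel)"
          by (rule nn_integral_sum) measurable
        then show ?thesis by (simp only: nn_integral_cmult[OF meas])
      qed
      also have "\<dots> \<le> ennreal (real CARD('n) powr p) * (\<Sum>i\<in>(UNIV::'n set). ennreal (2 * K))"
        by (intro mult_left_mono sum_mono G(3)) simp
      also have "(\<Sum>i\<in>(UNIV::'n set). ennreal (2 * K)) = ennreal (real CARD('n) * (2 * K))"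
        using K by (simp add: ennreal_mult'' ennreal_of_nat_eq_real_of_nat)
      also have "ennreal (real CARD('n) powr p) * \<dots> = ennreal (real CARD('n) powr p * (real CARD('n) * (2 * K)))"
        using K by (intro ennreal_mult''[symmetric]) simp
      also have "real CARD('n) powr p * (real CARD('n) * (2 * K)) = C * L"
        by (simp add: C_def K_def)
      finally show ?thesis .
    qed
    ultimately show "\<exists>g. has_weak_gradient v g \<and> (\<integral>\<^sup>+x. ennreal (norm (g x) powr p) \<partial>lborel) \<le> ennreal (C * L)"
      by blast
  qed
qed

theorem theorem8p3:
  fixes N :: nat and p :: real
  assumes "N \<ge> 2" and "CARD('n::finite) = N - 1" and "1 < p"
  shows "\<exists>C::real. C \<ge> 0 \<and>
    (\<forall>(u :: (real^'n) \<times> real \<Rightarrow> real) (v :: (real^'n) \<Rightarrow> real).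
       u \<in> borel_measurable (lebesgue_on half_space) \<longrightarrow>
       v \<in> borel_measurable lebesgue \<longrightarrow>
       Liminf (at_left 1) (\<lambda>s. ennreal (1 - s) * trace_energy N p s u v) < \<infinity> \<longrightarrow>
       v \<in> hom_sobolev p \<and>
       dirichlet_energy p v
         \<le> ennreal C * Liminf (at_left 1) (\<lambda>s. ennreal (1 - s) * trace_energy N p s u v))"
proof -
  have N: "N = CARD('n) + 1" using assms(1,2) by simp
  obtain C :: real where C: "0 \<le> C"
    and grad: "\<And>(u :: (real^'n) \<times> real \<Rightarrow> real) (v :: real^'n \<Rightarrow> real) L.
       u \<in> borel_measurable borel \<Longrightarrow> v \<in> borel_measurable borel \<Longrightarrow>
       Liminf (at_left 1) (\<lambda>s. ennreal (1 - s) * trace_energy N p s u v) = ennreal L \<Longrightarrow> 0 \<le> L \<Longrightarrow>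
       \<exists>g. has_weak_gradient v g \<and> (\<integral>\<^sup>+x. ennreal (norm (g x) powr p) \<partial>lborel) \<le> ennreal (C * L)"
    using trace_energy_controls_weak_gradient[OF assms(3) N] by blast
  have "v \<in> hom_sobolev p \<and> dirichlet_energy p v
      \<le> ennreal C * Liminf (at_left 1) (\<lambda>s. ennreal (1 - s) * trace_energy N p s u v)"
    if u: "u \<in> borel_measurable (lebesgue_on half_space)" and v: "v \<in> borel_measurable lebesgue"
      and fin: "Liminf (at_left 1) (\<lambda>s. ennreal (1 - s) * trace_energy N p s u v) < \<infinity>"
    for u :: "(real^'n) \<times> real \<Rightarrow> real" and v :: "real^'n \<Rightarrow> real"
  proof -
    obtain u' where u': "u' \<in> borel_measurable borel" "AE y in lborel. y \<in> half_space \<longrightarrow> u y = u' y"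
      using u by (rule borel_representative_half_space)
    obtain v' where v': "v' \<in> borel_measurable lborel" "AE x in lborel. v x = v' x"
      using completion_ex_borel_measurable_real[OF v] by blast
    have same: "trace_energy N p s u v = trace_energy N p s u' v'" for s
      by (rule trace_energy_cong_AE[OF v'(2) u'(2)])
    obtain L where L: "0 \<le> L" "Liminf (at_left 1) (\<lambda>s. ennreal (1 - s) * trace_energy N p s u v) = ennreal L"
      using fin by (cases "Liminf (at_left 1) (\<lambda>s. ennreal (1 - s) * trace_energy N p s u v)" rule: ennreal_cases) auto
    obtain g where g': "has_weak_gradient v' g" and g: "(\<integral>\<^sup>+x. ennreal (norm (g x) powr p) \<partial>lborel) \<le> ennreal (C * L)"
      using grad[OF u'(1) _ L(2)[unfolded same] L(1)] v'(1) by auto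
    have "has_weak_gradient v g"
    proof (rule has_weak_gradient_cong_AE[OF v _ _ g'])
      show "v' \<in> borel_measurable lebesgue" using v'(1) by (rule measurable_completion)
      show "AE x in lebesgue. v' x = v x" using AE_completion[OF v'(2)] by eventually_elim simp
    qed
    moreover from dirichlet_energy_eq[OF this, of p] g
    have energy: "dirichlet_energy p v \<le> ennreal (C * L)" by simp
    moreover have "dirichlet_energy p v < \<infinity>"
      using energy by (rule le_less_trans) simp
    ultimately show ?thesis
      using C L by (auto simp: hom_sobolev_def weakly_differentiable_def ennreal_mult)
  qed
  with C show ?thesis by blast
qed

end
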